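(* Let $H\subset\mathcal{H}$ be a standard subspace and let $(H,U_1)$, $(H,U_2)$ be non-degenerate standard pairs with generators $P_1,P_2$ and spectral measures $E_1,E_2$ respectively. If $U_1(1)H\subset U_2(1)H$, then for all $0<a_1\le b_1\le a_2\le b_2$ the ranges of $E_1[(a_1,b_1)]$ and $E_2[(a_2,b_2)]$ are orthogonal. In particular $E_1[(0,1)]\le E_2[(0,1)]$.
   Context: A closed real subspace $H$ of a complex Hilbert space $\mathcal{H}$ is standard if $H\cap iH=\{0\}$ and $H+iH$ is dense. A standard pair $(H,U)$ consists of a standard subspace $H$ and a strongly continuous unitary one-parameter group $U(s)=e^{isP}$ with positive self-adjoint generator $P\ge0$ such that $U(s)H\subset H$ for all $s\ge0$; it is non-degenerate if $\ker P=\{0\}$. *)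

theory Defs
  imports "HOL-Analysis.Analysis"
begin

text \<open>A complex Hilbert space, encoded as a real Hilbert space (real part of the
complex inner product) together with an orthogonal complex structure imult
(multiplication by the imaginary unit).\<close>

class complex_hilbert = real_inner + complete_space +
  fixes imult :: "'a \<Rightarrow> 'a"
  assumes imult_add: "imult (x + y) = imult x + imult y"
    and imult_scaleR: "imult (r *\<^sub>R x) = r *\<^sub>R imult x"
    and imult_imult: "imult (imult x) = - x"
    and inner_imult_imult: "inner (imult x) (imult y) = inner x y"

text \<open>Complex inner product, linear in the second argument.\<close>
definition cinner :: "'a::complex_hilbert \<Rightarrow> 'a \<Rightarrow> complex" where
  "cinner x y = Complex (inner x y) (inner (imult x) y)"

definition clinear :: "('a::complex_hilbert \<Rightarrow> 'a) \<Rightarrow> bool" where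
  "clinear f \<longleftrightarrow> linear f \<and> (\<forall>x. f (imult x) = imult (f x))"

definition standard_subspace :: "'a::complex_hilbert set \<Rightarrow> bool" where
  "standard_subspace H \<longleftrightarrow> subspace H \<and> closed H \<and> H \<inter> imult ` H = {0} \<and>
     closure {h + imult k | h k. h \<in> H \<and> k \<in> H} = UNIV"

definition unitary_group :: "(real \<Rightarrow> 'a::complex_hilbert \<Rightarrow> 'a) \<Rightarrow> bool" where
  "unitary_group U \<longleftrightarrow>
     (\<forall>s. clinear (U s) \<and> surj (U s) \<and> (\<forall>x. norm (U s x) = norm x)) \<and>
     U 0 = id \<and> (\<forall>s t. U (s + t) = U s \<circ> U t) \<and>
     (\<forall>x. continuous_on UNIV (\<lambda>s. U s x))"

definition proj_valued_measure :: "(real set \<Rightarrow> 'a::complex_hilbert \<Rightarrow> 'a) \<Rightarrow> bool" where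
  "proj_valued_measure E \<longleftrightarrow>
     (\<forall>B\<in>sets borel. clinear (E B) \<and> (\<forall>x y. inner (E B x) y = inner x (E B y)) \<and>
        E B \<circ> E B = E B) \<and>
     E UNIV = id \<and>
     (\<forall>A\<in>sets borel. \<forall>B\<in>sets borel. E (A \<inter> B) = E A \<circ> E B) \<and>
     (\<forall>Bs. range Bs \<subseteq> sets borel \<longrightarrow> disjoint_family Bs \<longrightarrow>
        (\<forall>x. (\<lambda>n. E (Bs n) x) sums E (\<Union>n. Bs n) x))"

text \<open>E is the spectral measure of the generator P of U, i.e. U(s) = e^{isP} = \<integral> e^{is\<lambda>} dE(\<lambda>),
  expressed weakly: <x, U(s) x> = \<integral> e^{is\<lambda>} d<x, E(\<lambda>) x>.\<close>
definition spectral_measure_of :: "(real \<Rightarrow> 'a::complex_hilbert \<Rightarrow> 'a) \<Rightarrow> (real set \<Rightarrow> 'a \<Rightarrow> 'a) \<Rightarrow> bool" where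
  "spectral_measure_of U E \<longleftrightarrow> proj_valued_measure E \<and>
     (\<forall>x. \<exists>\<mu>. sets \<mu> = sets borel \<and>
        (\<forall>B\<in>sets borel. emeasure \<mu> B = ennreal ((norm (E B x))\<^sup>2)) \<and>
        (\<forall>s. cinner x (U s x) = (LINT l|\<mu>. cis (s * l))))"

text \<open>Standard pair: positive generator (spectral measure vanishes on (-\<infinity>,0)),
  and U(s)H \<subseteq> H for s \<ge> 0.\<close>
definition standard_pair :: "'a::complex_hilbert set \<Rightarrow> (real \<Rightarrow> 'a \<Rightarrow> 'a) \<Rightarrow> bool" where
  "standard_pair H U \<longleftrightarrow> standard_subspace H \<and> unitary_group U \<and>
     (\<exists>E. spectral_measure_of U E \<and> E {..<0} = (\<lambda>_. 0)) \<and>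
     (\<forall>s\<ge>0. U s ` H \<subseteq> H)"

text \<open>Non-degenerate: ker P = {0}, i.e. E({0}) = 0.\<close>
definition nondegenerate_standard_pair :: "'a::complex_hilbert set \<Rightarrow> (real \<Rightarrow> 'a \<Rightarrow> 'a) \<Rightarrow> bool" where
  "nondegenerate_standard_pair H U \<longleftrightarrow> standard_pair H U \<and>
     (\<forall>E. spectral_measure_of U E \<longrightarrow> E {0} = (\<lambda>_. 0))"

end

theory Submission
  imports Defs "HOL-Complex_Analysis.Complex_Analysis" "HOL-Probability.Probability"
    "HOL-Real_Asymp.Real_Asymp"
begin

text \<open>Let \<open>\<Delta>\<close> and \<open>J\<close> be the modular objects of \<open>H\<close>. By Borchers' theorem the unitaries
  \<open>\<Delta>\<^sup>i\<^sup>t\<close> scale both groups in the same way, so \<open>V s = U\<^sub>2 (- s) U\<^sub>1 s\<close> for \<open>s > 0\<close> is conjugate to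
  \<open>V 1\<close> by some \<open>\<Delta>\<^sup>i\<^sup>t\<close>. As \<open>V 1\<close> maps \<open>H\<close> into itself, conjugating it by \<open>\<Delta>\<^sup>1\<^sup>/\<^sup>2\<close> gives the
  contraction \<open>J (V 1) J\<close>. By the three lines theorem \<open>V\<close> then extends to a contraction-valued
  analytic function on the upper half plane, in particular \<open>exp (s P\<^sub>2) exp (- s P\<^sub>1)\<close> is a
  contraction for all \<open>s > 0\<close>. Applied to vectors of spectral support in \<open>[a\<^sub>1, b\<^sub>1)\<close> for \<open>P\<^sub>1\<close> and in
  \<open>[a\<^sub>2, b\<^sub>2)\<close> for \<open>P\<^sub>2\<close> with \<open>b\<^sub>1 < a\<^sub>2\<close>, this forces orthogonality as \<open>s\<close> tends to infinity.

  The modular objects are reached through the bounded operators \<open>P \<plusminus> Q\<close>, where \<open>P\<close> and \<open>Q\<close> are the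
  real projections onto \<open>H\<close> and \<open>i H\<close>, and through binomial series in \<open>1 - P - Q\<close>.\<close>

section \<open>Complex scalars and the complex inner product\<close>

text \<open>The obstacle is that \<Delta> is unbounded: its complex powers make sense only on
  domains. They are therefore multiplied by \<open>R\<close>, a power of 1 - A^2 with A = (\<Delta>
  - 1) / (\<Delta> + 1); this turns a power of \<Delta> into a product of powers of 1 + A and 1 - A,
  which is bounded, and \<open>R\<close> can be removed at the end because it is injective with
  dense range. Its exponent 3 keeps the exponents of 1 + A and 1 - A at real part at least 2 when
  \<bar>Im z\<bar> \<le> 1; there the binomial coefficients are O(1/n^2) locally uniformly, so the
  series converge although the norm of A may be 1. The strip has width 1/2 for two reasons that must
  fit together: exp (2 pi z) maps it onto the upper half plane, where a positive generator makes exp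
  (i \<zeta> P) a contraction, and \<Delta>^(1/2) is the power that carries H to its symplectic
  complement. The product of exp (- i \<zeta> P2) and exp (i \<zeta> P1) has an unbounded factor and
  is never formed; its matrix elements on vectors of bounded spectral support are matched with the
  continuation of V s through their common boundary values.\<close>

instance complex_hilbert \<subseteq> banach ..

definition cscale :: "complex \<Rightarrow> 'a::complex_hilbert \<Rightarrow> 'a" (infixr \<open>*\<^sub>C\<close> 75) where
  "c *\<^sub>C x = Re c *\<^sub>R x + Im c *\<^sub>R imult x"

lemma norm_imult [simp]: "norm (imult x) = norm x"
  by (simp add: norm_eq_sqrt_inner inner_imult_imult)

lemma linear_imult: "linear imult"
  by (rule linearI) (auto simp: imult_add imult_scaleR)

lemma bounded_linear_imult: "bounded_linear imult"
  using linear_imult by (intro bounded_linear_intro[where K = 1]) (auto simp: imult_add imult_scaleR)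

lemmas imult_zero [simp] = linear_0[OF linear_imult]
lemmas imult_minus [simp] = linear_neg[OF linear_imult]
lemmas imult_diff = linear_diff[OF linear_imult]
lemmas imult_sum = linear_sum[OF linear_imult]

declare imult_imult [simp]

lemma inner_imult_left: "inner (imult x) y = - inner x (imult y)"
  using inner_imult_imult[of x "imult y"] by simp

lemma inner_imult_self [simp]: "inner (imult x) x = 0" "inner x (imult x) = 0"
  using inner_imult_left[of x x] by (auto simp: inner_commute)

lemma cscale_add_right: "c *\<^sub>C (x + y) = c *\<^sub>C x + c *\<^sub>C y"
  by (simp add: cscale_def imult_add algebra_simps)

lemma cscale_add_left: "(a + b) *\<^sub>C x = a *\<^sub>C x + b *\<^sub>C x"
  by (simp add: cscale_def algebra_simps)

lemma cscale_cscale: "a *\<^sub>C b *\<^sub>C x = (a * b) *\<^sub>C x"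
  by (simp add: cscale_def imult_add imult_scaleR algebra_simps)

lemma cscale_one [simp]: "1 *\<^sub>C x = x" and cscale_zero_left [simp]: "0 *\<^sub>C x = 0"
  and cscale_zero_right [simp]: "c *\<^sub>C 0 = 0"
  by (auto simp: cscale_def)

lemma cscale_of_real: "of_real r *\<^sub>C x = r *\<^sub>R x"
  by (simp add: cscale_def)

lemma cscale_ii: "\<i> *\<^sub>C x = imult x"
  by (simp add: cscale_def)

lemma cscale_diff_left: "(a - b) *\<^sub>C x = a *\<^sub>C x - b *\<^sub>C x"
  by (simp add: cscale_def algebra_simps)

lemma imult_cscale: "imult (c *\<^sub>C x) = c *\<^sub>C imult x"
  by (simp add: cscale_def imult_add imult_scaleR)

lemma norm_cscale: "norm (c *\<^sub>C x) = cmod c * norm x"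
proof -
  have "(norm (c *\<^sub>C x))\<^sup>2 = (cmod c * norm x)\<^sup>2"
    unfolding cscale_def power_mult_distrib cmod_power2 unfolding power2_norm_eq_inner
    by (simp add: inner_add_left inner_add_right inner_imult_imult distrib_right power2_eq_square)
  then show ?thesis by simp
qed

lemma linear_cscale: "linear (\<lambda>x. c *\<^sub>C x)"
  by (rule linearI) (auto simp: cscale_add_right, auto simp: cscale_def imult_scaleR algebra_simps)

lemma bounded_linear_cscale: "bounded_linear (\<lambda>x. c *\<^sub>C x)"
  using linear_cscale[of c]
  by (intro bounded_linear_intro[where K = "cmod c"])
     (auto simp: linear_add[OF linear_cscale] linear_scale[OF linear_cscale] norm_cscale)

lemma cscale_sum_left: "(\<Sum>i\<in>I. f i) *\<^sub>C x = (\<Sum>i\<in>I. f i *\<^sub>C x)"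
  by (induction I rule: infinite_finite_induct) (auto simp: cscale_add_left)

lemma Re_cinner [simp]: "Re (cinner x y) = inner x y"
  by (simp add: cinner_def)

lemma Im_cinner: "Im (cinner x y) = inner (imult x) y"
  by (simp add: cinner_def)

lemma cinner_add_right: "cinner x (y + z) = cinner x y + cinner x z"
  and cinner_add_left: "cinner (x + y) z = cinner x z + cinner y z"
  and cinner_diff_right: "cinner x (y - z) = cinner x y - cinner x z"
  and cinner_diff_left: "cinner (x - y) z = cinner x z - cinner y z"
  and cinner_zero_right [simp]: "cinner x 0 = 0"
  and cinner_zero_left [simp]: "cinner 0 x = 0"
  by (auto simp: complex_eq_iff Im_cinner inner_add_left inner_add_right inner_diff_left
      inner_diff_right imult_add imult_diff)

lemma cinner_sum_right: "cinner x (\<Sum>i\<in>I. f i) = (\<Sum>i\<in>I. cinner x (f i))"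
  by (induction I rule: infinite_finite_induct) (auto simp: cinner_add_right)

lemma cinner_commute: "cinner y x = cnj (cinner x y)"
  using inner_imult_left[of y x] by (simp add: complex_eq_iff Im_cinner inner_commute)

lemma cinner_cscale_right: "cinner x (c *\<^sub>C y) = c * cinner x y"
  by (simp add: complex_eq_iff Im_cinner cscale_def inner_add_right inner_imult_imult
      inner_imult_left algebra_simps)

lemma cinner_cscale_left: "cinner (c *\<^sub>C x) y = cnj c * cinner x y"
  by (subst (1 2) cinner_commute) (simp add: cinner_cscale_right)

lemma cinner_imult_right: "cinner x (imult y) = \<i> * cinner x y"
  using cinner_cscale_right[of x "\<i>" y] by (simp add: cscale_ii)

lemma cinner_self: "cinner x x = of_real ((norm x)\<^sup>2)"
  by (simp add: complex_eq_iff Im_cinner power2_norm_eq_inner)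

text \<open>A phase moves the inner product onto the positive real axis, where it equals its real
  part and the real Cauchy-Schwarz inequality applies.\<close>

lemma cmod_cinner_le: "cmod (cinner x y) \<le> norm x * norm y"
proof (cases "cinner x y = 0")
  case False
  define c where "c = cnj (sgn (cinner x y))"
  have "c * cinner x y = of_real (cmod (cinner x y))"
    using False unfolding c_def
    by (simp add: sgn_eq field_simps flip: complex_norm_square) (simp add: power2_eq_square)
  then have "cmod (cinner x y) = Re (cinner x (c *\<^sub>C y))"
    by (simp add: cinner_cscale_right)
  also have "\<dots> \<le> norm x * norm (c *\<^sub>C y)"
    using norm_cauchy_schwarz by simp
  also have "\<dots> = norm x * norm y"
    using False by (simp add: norm_cscale c_def norm_sgn)
  finally show ?thesis .
qed auto

lemma bounded_bilinear_cinner: "bounded_bilinear cinner"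
proof
  show "\<exists>K. \<forall>a b. cmod (cinner a b) \<le> norm a * norm b * K"
    by (rule exI[of _ 1]) (auto simp: cmod_cinner_le)
  show "cinner (r *\<^sub>R a) b = r *\<^sub>R cinner a b" "cinner a (r *\<^sub>R b) = r *\<^sub>R cinner a b" for r a b
    using cinner_cscale_left[of "of_real r" a b] cinner_cscale_right[of a "of_real r" b]
    by (auto simp: cscale_of_real scaleR_conv_of_real)
qed (auto simp: cinner_add_left cinner_add_right)

lemmas tendsto_cinner [tendsto_intros] = bounded_bilinear.tendsto[OF bounded_bilinear_cinner]
lemmas continuous_on_cinner [continuous_intros] =
  bounded_bilinear.continuous_on[OF bounded_bilinear_cinner]

lemma cinner_eqI: "(\<And>y. cinner y x = cinner y x') \<Longrightarrow> x = x'"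
proof -
  assume "\<And>y. cinner y x = cinner y x'"
  then have "cinner (x - x') (x - x') = 0"
    by (simp add: cinner_diff_right)
  then show ?thesis by (simp add: cinner_self)
qed

lemma norm_le_cinnerI:
  assumes "\<And>y. cmod (cinner y x) \<le> M * norm y" "0 \<le> M"
  shows "norm x \<le> M"
proof (cases "x = 0")
  case False
  have "norm x * norm x \<le> M * norm x"
    using assms(1)[of x] by (simp add: cinner_self power2_eq_square norm_mult)
  then show ?thesis using False by simp
qed (use assms in simp)

lemma clinearD:
  assumes "clinear f"
  shows "linear f" "f (imult x) = imult (f x)" "f (c *\<^sub>C x) = c *\<^sub>C f x"
    "f (x + y) = f x + f y" "f (x - y) = f x - f y" "f 0 = 0" "f (r *\<^sub>R x) = r *\<^sub>R f x"
    "f (- x) = - f x"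
proof -
  show l: "linear f" and i: "f (imult x) = imult (f x)" for x
    using assms by (auto simp: clinear_def)
  show "f (c *\<^sub>C x) = c *\<^sub>C f x" "f (x + y) = f x + f y" "f (x - y) = f x - f y" "f 0 = 0"
    "f (r *\<^sub>R x) = r *\<^sub>R f x" "f (- x) = - f x"
    using l by (auto simp: linear_add linear_scale linear_diff linear_0 cscale_def i linear_neg)
qed

text \<open>Testing on x + y and on x + i y gives the sum of the two mixed terms and i times their
  difference. The subspace is a parameter because the orbits of a unitary group are first known
  through diagonal matrix elements on a spectral subspace.\<close>

lemma cinner_polarization:
  fixes f g :: "'a::complex_hilbert \<Rightarrow> 'a"
  assumes "clinear f" "subspace S" "\<And>x. x \<in> S \<Longrightarrow> imult x \<in> S"
    and "\<And>x. x \<in> S \<Longrightarrow> cinner x (f x) = 0" "x \<in> S" "y \<in> S"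
  shows "cinner x (f y) = 0"
proof -
  note lin = clinearD[OF assms(1)]
  have "cinner (x + y) (f (x + y)) = 0" "cinner (x + imult y) (f (x + imult y)) = 0"
    using assms by (auto intro!: assms(4) subspace_add)
  then have "cinner x (f y) + cinner y (f x) = 0"
    and "\<i> * cinner x (f y) - \<i> * cinner y (f x) = 0"
    using assms(4)[OF assms(5)] assms(4)[OF assms(6)]
    by (auto simp: lin cinner_add_left cinner_add_right cinner_cscale_left cinner_cscale_right
        simp flip: cscale_ii)
  then show ?thesis
    by (auto simp: complex_eq_iff algebra_simps)
qed

section \<open>Bounded holomorphic functions on a strip\<close>

definition strip :: "real \<Rightarrow> complex set" where
  "strip b = {z. 0 < Im z \<and> Im z < b}"

definition cstrip :: "real \<Rightarrow> complex set" where
  "cstrip b = {z. 0 \<le> Im z \<and> Im z \<le> b}"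

lemma open_strip: "open (strip b)"
proof -
  have "strip b = {z. 0 < Im z} \<inter> {z. Im z < b}" by (auto simp: strip_def)
  then show ?thesis
    by (simp add: open_Int open_halfspace_Im_gt open_halfspace_Im_lt)
qed

lemma open_abs_Im_less: "open {z. \<bar>Im z\<bar> < b}"
  by (intro open_Collect_less continuous_intros)

lemma convex_strip: "convex (strip b)"
proof -
  have "strip b = {z. 0 < Im z} \<inter> {z. Im z < b}" by (auto simp: strip_def)
  then show ?thesis
    by (simp add: convex_Int convex_halfspace_Im_gt convex_halfspace_Im_lt)
qed

lemma strip_subset_cstrip: "strip b \<subseteq> cstrip b"
  by (auto simp: strip_def cstrip_def)

text \<open>The Gaussian factor makes the function small on the short sides of a long rectangle.\<close>

lemma phragmen_lindelof_strip_pos: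
  assumes Mpos: "0 < M" and cont: "continuous_on (cstrip b) f" and hol: "f holomorphic_on strip b"
    and bdd: "\<And>z. z \<in> cstrip b \<Longrightarrow> cmod (f z) \<le> B"
    and bot: "\<And>t. cmod (f (of_real t)) \<le> M"
    and top: "\<And>t. cmod (f (Complex t b)) \<le> M"
    and z: "z \<in> cstrip b"
  shows "cmod (f z) \<le> M"
proof -
  have b0: "0 \<le> b" using z by (auto simp: cstrip_def)
  have B0: "0 \<le> B" using bdd[OF z] norm_ge_zero order_trans by blast
  have key: "cmod (exp (- of_real \<epsilon> * z\<^sup>2) * f z) \<le> exp (\<epsilon> * b\<^sup>2) * M" if "\<epsilon> > 0" for \<epsilon> :: real
  proof -
    have nexp: "cmod (exp (- of_real \<epsilon> * w\<^sup>2)) = exp (\<epsilon> * ((Im w)\<^sup>2 - (Re w)\<^sup>2))" for w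
      by (simp add: algebra_simps power2_eq_square)
    define g where "g w = exp (- of_real \<epsilon> * w\<^sup>2) * f w" for w
    have "filterlim (\<lambda>R::real. exp (- \<epsilon> * R\<^sup>2) * B) (nhds 0) at_top"
      using \<open>\<epsilon> > 0\<close> by real_asymp
    then have "eventually (\<lambda>R. exp (- \<epsilon> * R\<^sup>2) * B < M) at_top"
      using Mpos by (simp add: order_tendsto_iff)
    then obtain R0 where R0: "\<And>R. R \<ge> R0 \<Longrightarrow> exp (- \<epsilon> * R\<^sup>2) * B < M"
      by (auto simp: eventually_at_top_linorder)
    \<comment> \<open>Beyond \<open>R0\<close> the Gaussian outweighs the crude bound
      \<open>B\<close> on the short sides; the other term puts \<open>z\<close> inside the
      rectangle.\<close>
    define R where "R = max R0 (\<bar>Re z\<bar> + 1)"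
    have R: "R > \<bar>Re z\<bar>" "R \<ge> R0" by (auto simp: R_def)
    define S where "S = cbox (Complex (-R) 0) (Complex R b)"
    have Scs: "S \<subseteq> cstrip b" by (auto simp: S_def cstrip_def in_cbox_complex_iff)
    have intS: "interior S \<subseteq> strip b"
      by (auto simp: S_def interior_cbox in_box_complex_iff strip_def)
    have "cmod (g z) \<le> exp (\<epsilon> * b\<^sup>2) * M"
    proof (rule maximum_modulus_frontier[where f = g and S = S])
      show "g holomorphic_on interior S"
        unfolding g_def using holomorphic_on_subset[OF hol intS] by (intro holomorphic_intros)
      have "closure S = S" by (simp add: S_def)
      then show "continuous_on (closure S) g"
        unfolding g_def using continuous_on_subset[OF cont Scs] by (auto intro!: continuous_intros)
      show "bounded S" by (simp add: S_def)
      show "z \<in> S" using R z by (auto simp: S_def in_cbox_complex_iff cstrip_def)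
      fix w assume "w \<in> frontier S"
      then have w: "w \<in> S" and w': "w \<notin> box (Complex (-R) 0) (Complex R b)"
        by (auto simp: frontier_def S_def interior_cbox)
      have wb: "0 \<le> Im w" "Im w \<le> b" "- R \<le> Re w" "Re w \<le> R"
        using w by (auto simp: S_def in_cbox_complex_iff)
      consider "Im w = 0" | "Im w = b" | "\<bar>Re w\<bar> = R"
        using w' wb by (fastforce simp: in_box_complex_iff)
      then show "cmod (g w) \<le> exp (\<epsilon> * b\<^sup>2) * M"
      proof cases
        case 1
        then have "w = of_real (Re w)" by (simp add: complex_eq_iff)
        then have "cmod (f w) \<le> M" using bot[of "Re w"] by simp
        moreover have "exp (\<epsilon> * ((Im w)\<^sup>2 - (Re w)\<^sup>2)) \<le> exp (\<epsilon> * b\<^sup>2)"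
          using 1 \<open>\<epsilon> > 0\<close> by (simp add: order_trans[of _ 0])
        ultimately show ?thesis unfolding g_def norm_mult nexp by (intro mult_mono) auto
      next
        case 2
        then have "w = Complex (Re w) b" by (simp add: complex_eq_iff)
        then have "cmod (f w) \<le> M" using top[of "Re w"] by metis
        moreover have "exp (\<epsilon> * ((Im w)\<^sup>2 - (Re w)\<^sup>2)) \<le> exp (\<epsilon> * b\<^sup>2)"
          using 2 \<open>\<epsilon> > 0\<close> by simp
        ultimately show ?thesis unfolding g_def norm_mult nexp by (intro mult_mono) auto
      next
        case 3
        then have R2: "(Re w)\<^sup>2 = R\<^sup>2" by (metis power2_abs)
        have "cmod (f w) \<le> B" using bdd w Scs by auto
        moreover have "exp (\<epsilon> * ((Im w)\<^sup>2 - (Re w)\<^sup>2)) \<le> exp (\<epsilon> * b\<^sup>2) * exp (- \<epsilon> * R\<^sup>2)"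
          unfolding R2 using \<open>\<epsilon> > 0\<close> wb power_mono[of "Im w" b 2]
          by (simp flip: exp_add add: algebra_simps)
        ultimately have "cmod (g w) \<le> (exp (\<epsilon> * b\<^sup>2) * exp (- \<epsilon> * R\<^sup>2)) * B"
          unfolding g_def norm_mult nexp by (intro mult_mono) auto
        also have "\<dots> = exp (\<epsilon> * b\<^sup>2) * (exp (- \<epsilon> * R\<^sup>2) * B)" by simp
        also have "\<dots> \<le> exp (\<epsilon> * b\<^sup>2) * M"
          using R0[OF R(2)] by (intro mult_left_mono) auto
        finally show ?thesis .
      qed
    qed
    then show ?thesis by (simp add: g_def)
  qed
  have "((\<lambda>\<epsilon>. cmod (exp (- of_real \<epsilon> * z\<^sup>2) * f z)) \<longlongrightarrow> cmod (exp (- of_real 0 * z\<^sup>2) * f z)) (at_right 0)"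
    by (intro tendsto_intros)
  moreover have "((\<lambda>\<epsilon>. exp (\<epsilon> * b\<^sup>2) * M) \<longlongrightarrow> exp (0 * b\<^sup>2) * M) (at_right 0)"
    by (intro tendsto_intros)
  moreover have "eventually (\<lambda>\<epsilon>. cmod (exp (- of_real \<epsilon> * z\<^sup>2) * f z) \<le> exp (\<epsilon> * b\<^sup>2) * M) (at_right (0::real))"
    using eventually_at_right_less[of 0] by eventually_elim (rule key)
  ultimately have "cmod (exp (- of_real 0 * z\<^sup>2) * f z) \<le> exp (0 * b\<^sup>2) * M"
    by (intro tendsto_le[OF _ _ _]) auto
  then show ?thesis by simp
qed

text \<open>The strict positivity of the bound, on which the choice of the rectangle relies, is
  removed by raising M to M + e.\<close>

lemma phragmen_lindelof_strip:
  assumes cont: "continuous_on (cstrip b) f" and hol: "f holomorphic_on strip b"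
    and bdd: "\<And>z. z \<in> cstrip b \<Longrightarrow> cmod (f z) \<le> B"
    and bot: "\<And>t. cmod (f (of_real t)) \<le> M"
    and top: "\<And>t. cmod (f (Complex t b)) \<le> M"
    and z: "z \<in> cstrip b"
  shows "cmod (f z) \<le> M"
proof (rule field_le_epsilon)
  fix e :: real assume "e > 0"
  have "0 \<le> M" using bot[of 0] norm_ge_zero order_trans by blast
  then have "0 < M + e" "cmod (f (of_real t)) \<le> M + e" "cmod (f (Complex t b)) \<le> M + e" for t
    using \<open>e > 0\<close> bot[of t] top[of t] by auto
  then show "cmod (f z) \<le> M + e"
    using phragmen_lindelof_strip_pos[OF _ cont hol bdd _ _ z, of "M + e"] by blast
qed

text \<open>Multiplying by \<open>exp (i n z)\<close> gains \<open>exp (- n b)\<close> on the upper edge and loses only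
  \<open>exp (- n Im z)\<close> at \<open>z\<close>.\<close>

lemma strip_unique:
  assumes b: "b > 0" and cont: "continuous_on (cstrip b) f" and hol: "f holomorphic_on strip b"
    and bdd: "\<And>z. z \<in> cstrip b \<Longrightarrow> cmod (f z) \<le> B"
    and bot: "\<And>t. f (of_real t) = 0" and z: "z \<in> strip b"
  shows "f z = 0"
proof -
  have "cmod (f 0) \<le> B" using bdd[of 0] b by (simp add: cstrip_def)
  then have B0: "0 \<le> B" using norm_ge_zero[of "f 0"] by linarith
  have le: "cmod (f z) \<le> B * exp (- (b - Im z) * real n)" for n
  proof -
    have "cmod (exp (\<i> * of_nat n * z) * f z) \<le> B * exp (- b * real n)"
    proof (rule phragmen_lindelof_strip[where B = B and f = "\<lambda>z. exp (\<i> * of_nat n * z) * f z"])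
      show "continuous_on (cstrip b) (\<lambda>z. exp (\<i> * of_nat n * z) * f z)"
        using cont by (intro continuous_intros) auto
      show "(\<lambda>z. exp (\<i> * of_nat n * z) * f z) holomorphic_on strip b"
        using hol by (intro holomorphic_intros) auto
      show "cmod (exp (\<i> * of_nat n * w) * f w) \<le> B" if "w \<in> cstrip b" for w
      proof -
        have "cmod (exp (\<i> * of_nat n * w)) * cmod (f w) \<le> 1 * B"
          using that bdd[OF that] by (intro mult_mono) (auto simp: cstrip_def)
        then show ?thesis by (simp add: norm_mult)
      qed
      show "cmod (exp (\<i> * of_nat n * of_real t) * f (of_real t)) \<le> B * exp (- b * real n)" for t
        using B0 by (simp add: bot)
      show "cmod (exp (\<i> * of_nat n * Complex t b) * f (Complex t b)) \<le> B * exp (- b * real n)" for t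
      proof -
        have "Complex t b \<in> cstrip b" using b by (simp add: cstrip_def)
        then show ?thesis using bdd[of "Complex t b"]
          by (simp add: norm_mult mult.commute mult_right_mono)
      qed
      show "z \<in> cstrip b" using z strip_subset_cstrip by auto
    qed
    then show ?thesis
      by (simp add: norm_mult) (simp add: algebra_simps exp_minus exp_add exp_diff divide_simps)
  qed
  have "(\<lambda>n. B * exp (- (b - Im z) * real n)) \<longlonglongrightarrow> 0"
    using z unfolding strip_def by real_asymp
  then have "cmod (f z) \<le> 0"
    by (rule LIMSEQ_le_const) (use le in auto)
  then show ?thesis by simp
qed

text \<open>If \<open>Im f\<close> vanishes on the boundary then \<open>exp (i f)\<close> and \<open>exp (- i f)\<close> have modulus one there,
  so both are bounded by one inside.\<close>

lemma strip_real_boundary_const: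
  assumes b: "b > 0" and cont: "continuous_on (cstrip b) f" and hol: "f holomorphic_on strip b"
    and bdd: "\<And>z. z \<in> cstrip b \<Longrightarrow> cmod (f z) \<le> B"
    and bot: "\<And>t. Im (f (of_real t)) = 0" and top: "\<And>t. Im (f (Complex t b)) = 0"
  shows "f (of_real s) = f (of_real t)"
proof -
  have Im0: "Im (f z) = 0" if "z \<in> strip b" for z
  proof -
    have le: "cmod (exp (c * f z)) \<le> 1" if c: "c = \<i> \<or> c = - \<i>" for c
    proof (rule phragmen_lindelof_strip[where B = "exp B" and f = "\<lambda>z. exp (c * f z)"])
      show "continuous_on (cstrip b) (\<lambda>z. exp (c * f z))"
        using cont by (intro continuous_intros)
      show "(\<lambda>z. exp (c * f z)) holomorphic_on strip b"
        using hol by (intro holomorphic_intros)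
      show "cmod (exp (c * f w)) \<le> exp B" if "w \<in> cstrip b" for w
        using c bdd[OF that] abs_Im_le_cmod[of "f w"] by auto
      show "cmod (exp (c * f (of_real t))) \<le> 1" "cmod (exp (c * f (Complex t b))) \<le> 1" for t
        using c bot top by auto
      show "z \<in> cstrip b" using \<open>z \<in> strip b\<close> strip_subset_cstrip by auto
    qed
    show ?thesis using le[of "\<i>"] le[of "- \<i>"] by simp
  qed
  have "f constant_on strip b"
  proof (rule ccontr)
    assume nc: "\<not> f constant_on strip b"
    \<comment> \<open>\<open>f\<close> takes only real values on the strip, while an open image
      would contain points off the real axis.\<close>
    have "open (f ` strip b)"
      by (rule open_mapping_thm[OF hol open_strip convex_connected[OF convex_strip] open_strip order_refl nc])
    moreover have z0: "f (Complex 0 (b/2)) \<in> f ` strip b" using b by (auto simp: strip_def)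
    ultimately obtain e where e: "e > 0" "ball (f (Complex 0 (b/2))) e \<subseteq> f ` strip b"
      by (meson openE)
    have "f (Complex 0 (b/2)) + \<i> * of_real (e/2) \<in> ball (f (Complex 0 (b/2))) e"
      using e(1) by (simp add: dist_norm norm_mult)
    then have "f (Complex 0 (b/2)) + \<i> * of_real (e/2) \<in> f ` strip b"
      using e(2) by blast
    then obtain w where "f (Complex 0 (b/2)) + \<i> * of_real (e/2) = f w" "w \<in> strip b"
      by (rule imageE)
    then show False using Im0[of w] Im0[of "Complex 0 (b/2)"] b e(1)
      by (auto simp: strip_def complex_eq_iff)
  qed
  then obtain c where c: "\<And>z. z \<in> strip b \<Longrightarrow> f z = c" by (auto simp: constant_on_def)
  \<comment> \<open>The constant passes to the lower edge along the vertical segment above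
    t.\<close>
  have "f (of_real t) = c" for t
  proof -
    have "((\<lambda>y. f (Complex t y)) \<longlongrightarrow> f (Complex t 0)) (at 0 within {0..b})"
    proof -
      have "continuous_on {0..b} (\<lambda>y. f (Complex t y))"
        by (rule continuous_on_compose2[OF cont])
           (auto simp: Complex_eq cstrip_def intro!: continuous_intros)
      then show ?thesis using b by (auto simp: continuous_on_def)
    qed
    then have "((\<lambda>y. f (Complex t y)) \<longlongrightarrow> f (Complex t 0)) (at_right 0)"
      using b by (simp add: at_within_Icc_at_right)
    moreover have "eventually (\<lambda>y. f (Complex t y) = c) (at_right 0)"
      using eventually_at_right_less[of 0] eventually_at_right_real[OF b]
      by eventually_elim (rule c, simp add: strip_def)
    ultimately have "((\<lambda>y. c) \<longlongrightarrow> f (Complex t 0)) (at_right (0::real))"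
      by (rule Lim_transform_eventually)
    then have "f (Complex t 0) = c"
      by (simp add: tendsto_const_iff)
    then show ?thesis by (simp add: complex_of_real_def)
  qed
  then show ?thesis by simp
qed

section \<open>Weakly holomorphic vector-valued functions\<close>

text \<open>Only scalar functions are ever differentiated. The local bound makes Cauchy's estimate
  for the matrix elements uniform in y, which is how norm continuity is obtained.\<close>

definition wholo :: "(complex \<Rightarrow> 'a::complex_hilbert) \<Rightarrow> complex set \<Rightarrow> bool" where
  "wholo X S \<longleftrightarrow> (\<forall>y. (\<lambda>z. cinner y (X z)) holomorphic_on S) \<and>
     (\<forall>z\<in>S. \<exists>e>0. \<exists>M. \<forall>w\<in>ball z e. norm (X w) \<le> M)"

lemma wholoI:
  assumes "\<And>y. (\<lambda>z. cinner y (X z)) holomorphic_on S"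
    and "\<And>z. z \<in> S \<Longrightarrow> \<exists>e>0. \<exists>M. \<forall>w\<in>ball z e. norm (X w) \<le> M"
  shows "wholo X S"
  using assms by (auto simp: wholo_def)

text \<open>Cauchy's inequality bounds the derivative of every matrix element by a constant times
  the norm of y; the mean value inequality and duality then bound the norm of the increment.\<close>

lemma wholo_locally_lipschitz:
  assumes X: "wholo X S" and S: "open S" and z0: "z0 \<in> S"
  obtains e M where "e > 0" "M \<ge> 0" "ball z0 e \<subseteq> S"
    "\<forall>w\<in>ball z0 e. norm (X w - X z0) \<le> M * cmod (w - z0)"
proof -
  obtain e1 M where e1: "e1 > 0" "\<And>w. w \<in> ball z0 e1 \<Longrightarrow> norm (X w) \<le> M"
    using X z0 unfolding wholo_def by blast
  obtain e2 where e2: "e2 > 0" "ball z0 e2 \<subseteq> S" using S z0 openE by blast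
  \<comment> \<open>With a third of the smaller radius, closed discs of radius r around points of
    \<open>ball z0 r\<close> stay inside both balls.\<close>
  define r where "r = min e1 e2 / 3"
  have r: "r > 0" "3 * r \<le> e1" "3 * r \<le> e2" using e1(1) e2(1) by (auto simp: r_def)
  have "norm (X z0) \<le> M" using e1 by simp
  then have M0: "M \<ge> 0" using norm_ge_zero[of "X z0"] by linarith
  have *: "cmod (cinner y (X w - X z0)) \<le> M / r * cmod (w - z0) * norm y"
    if w: "w \<in> ball z0 r" for w y
  proof -
    define g where "g = (\<lambda>z. cinner y (X z))"
    have hol: "g holomorphic_on S" using X by (auto simp: wholo_def g_def)
    have "cmod (g w - g z0) \<le> (M * norm y / r) * cmod (w - z0)"
    proof (rule field_differentiable_bound[of "ball z0 r" g "deriv g"])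
      fix u assume u: "u \<in> ball z0 r"
      have sub: "cball u r \<subseteq> ball z0 (3 * r)"
      proof
        fix v assume "v \<in> cball u r"
        then have "dist z0 v < r + r" using u dist_triangle[of z0 v u] by auto
        then show "v \<in> ball z0 (3 * r)" using r(1) by simp
      qed
      have "ball z0 (3 * r) \<subseteq> ball z0 e2" using r(3) by (rule subset_ball)
      then have subS: "cball u r \<subseteq> S" using sub e2(2) by blast
      have "u \<in> S" using subS r(1) by auto
      then show "(g has_field_derivative deriv g u) (at u within ball z0 r)"
        using hol S holomorphic_derivI by blast
      have "cmod ((deriv ^^ 1) g u) \<le> fact 1 * (M * norm y) / r ^ 1"
      proof (rule Cauchy_inequality)
        show "g holomorphic_on ball u r" using subS hol ball_subset_cball holomorphic_on_subset by blast
        show "continuous_on (cball u r) g"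
          using subS hol holomorphic_on_imp_continuous_on continuous_on_subset by blast
        fix x assume "cmod (u - x) = r"
        then have "x \<in> cball u r" by (simp add: dist_norm)
        then have "x \<in> ball z0 e1" using sub subset_ball[OF r(2), of z0] by blast
        then have "norm y * norm (X x) \<le> norm y * M" using e1(2) by (intro mult_left_mono) auto
        then show "cmod (g x) \<le> M * norm y"
          using cmod_cinner_le[of y "X x"] by (simp add: g_def mult.commute)
      qed (use r in auto)
      then show "cmod (deriv g u) \<le> M * norm y / r" by simp
    qed (use w r in auto)
    then show ?thesis by (simp add: g_def cinner_diff_right mult.commute mult.left_commute)
  qed
  show thesis
  proof (rule that[of r "M / r"])
    show "ball z0 r \<subseteq> S" using r e2 by (auto simp: subset_iff)
    show "\<forall>w\<in>ball z0 r. norm (X w - X z0) \<le> M / r * cmod (w - z0)"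
      using * r M0 by (intro ballI norm_le_cinnerI) auto
  qed (use r M0 in auto)
qed

lemma wholo_continuous_on:
  assumes "wholo X S" "open S"
  shows "continuous_on S X"
proof -
  have "isCont X z0" if z0: "z0 \<in> S" for z0
  proof -
    obtain e M where e: "e > 0" "M \<ge> 0" "ball z0 e \<subseteq> S"
      "\<forall>w\<in>ball z0 e. norm (X w - X z0) \<le> M * cmod (w - z0)"
      by (rule wholo_locally_lipschitz[OF assms z0])
    have "((\<lambda>w. X w - X z0) \<longlongrightarrow> 0) (at z0)"
    proof (rule Lim_null_comparison)
      show "eventually (\<lambda>w. norm (X w - X z0) \<le> M * cmod (w - z0)) (at z0)"
        using e by (auto simp: eventually_at dist_commute intro!: exI[of _ e])
      have "((\<lambda>w. M * cmod (w - z0)) \<longlongrightarrow> M * cmod (z0 - z0)) (at z0)" by (intro tendsto_intros)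
      then show "((\<lambda>w. M * cmod (w - z0)) \<longlongrightarrow> 0) (at z0)" by simp
    qed
    then show ?thesis by (simp add: isCont_def LIM_zero_iff)
  qed
  then show ?thesis by (auto intro: continuous_at_imp_continuous_on)
qed

lemma open_cnj_image: "open S \<Longrightarrow> open (cnj ` S)"
proof -
  assume "open S"
  moreover have "cnj ` S = cnj -` S" by (auto simp: image_iff) (metis complex_cnj_cnj)
  ultimately show ?thesis by (simp add: continuous_on_cnj open_vimage)
qed

lemma holomorphic_cinner_cnj:
  assumes "wholo K (cnj ` S)" "open S"
  shows "(\<lambda>z. cinner (K (cnj z)) y) holomorphic_on S"
proof -
  have "cnj \<circ> (\<lambda>z. cinner y (K z)) \<circ> cnj holomorphic_on S"
    using assms by (intro holomorphic_on_compose_cnj_cnj) (auto simp: wholo_def)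
  then show ?thesis by (simp add: o_def flip: cinner_commute)
qed

text \<open>Conjugating the argument of \<open>K\<close> cancels the antilinearity of the first
  slot. Expanding both factors around z0 leaves terms with one increment, which are scalar
  holomorphic, and the product of the two increments, which is quadratically small by the local
  Lipschitz bounds.\<close>

lemma holomorphic_cinner:
  assumes X: "wholo X S" and K: "wholo K (cnj ` S)" and S: "open S"
  shows "(\<lambda>z. cinner (K (cnj z)) (X z)) holomorphic_on S"
proof -
  have Sc: "open (cnj ` S)" using S by (rule open_cnj_image)
  have "(\<lambda>z. cinner (K (cnj z)) (X z)) field_differentiable (at z0)" if z0: "z0 \<in> S" for z0
  proof -
    obtain e1 M1 where e1: "e1 > 0" "M1 \<ge> 0" "ball z0 e1 \<subseteq> S"
      "\<forall>w\<in>ball z0 e1. norm (X w - X z0) \<le> M1 * cmod (w - z0)"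
      by (rule wholo_locally_lipschitz[OF X S z0])
    obtain e2 M2 where e2: "e2 > 0" "M2 \<ge> 0" "ball (cnj z0) e2 \<subseteq> cnj ` S"
      "\<forall>w\<in>ball (cnj z0) e2. norm (K w - K (cnj z0)) \<le> M2 * cmod (w - cnj z0)"
      by (rule wholo_locally_lipschitz[OF K Sc imageI[OF z0]])
    define r where "r z = cinner (K (cnj z) - K (cnj z0)) (X z - X z0)" for z
    have dist_cnj: "dist (cnj a) (cnj b) = dist a b" for a b
      by (metis complex_cnj_diff complex_mod_cnj dist_norm)
    have "((\<lambda>z. (r z - r z0) / (z - z0)) \<longlongrightarrow> 0) (at z0)"
    proof (rule Lim_null_comparison)
      show "eventually (\<lambda>z. norm ((r z - r z0) / (z - z0)) \<le> M2 * M1 * cmod (z - z0)) (at z0)"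
        unfolding eventually_at
      proof (intro exI[of _ "min e1 e2"] conjI ballI impI)
        fix z assume z: "z \<noteq> z0 \<and> dist z z0 < min e1 e2"
        have "cmod (r z) \<le> (M2 * cmod (cnj z - cnj z0)) * (M1 * cmod (z - z0))"
          unfolding r_def using e1(1,2) e2(1,2) z
          by (intro order_trans[OF cmod_cinner_le] mult_mono e1(4)[rule_format] e2(4)[rule_format])
             (auto simp: dist_commute dist_cnj)
        moreover have "cmod (cnj z - cnj z0) = cmod (z - z0)"
          by (metis complex_cnj_diff complex_mod_cnj)
        ultimately show "norm ((r z - r z0) / (z - z0)) \<le> M2 * M1 * cmod (z - z0)"
          using z by (simp add: r_def norm_divide divide_simps) (simp add: mult_ac)
      qed (use e1 e2 in auto)
      have "((\<lambda>z. M2 * M1 * cmod (z - z0)) \<longlongrightarrow> M2 * M1 * cmod (z0 - z0)) (at z0)"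
        by (intro tendsto_intros)
      then show "((\<lambda>z. M2 * M1 * cmod (z - z0)) \<longlongrightarrow> 0) (at z0)" by simp
    qed
    then have "r field_differentiable (at z0)"
      by (auto simp: field_differentiable_def has_field_derivative_iff)
    moreover have "(\<lambda>z. cinner (K (cnj z)) (X z0)) field_differentiable (at z0)"
      using holomorphic_cinner_cnj[OF K S] z0 S holomorphic_on_imp_differentiable_at by blast
    moreover have "(\<lambda>z. cinner (K (cnj z0)) (X z)) field_differentiable (at z0)"
      using X z0 S holomorphic_on_imp_differentiable_at by (auto simp: wholo_def)
    ultimately have "(\<lambda>z. r z + cinner (K (cnj z)) (X z0) + cinner (K (cnj z0)) (X z)
        - cinner (K (cnj z0)) (X z0)) field_differentiable (at z0)"
      by (intro field_differentiable_add field_differentiable_diff field_differentiable_const)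
    then show ?thesis
      by (simp add: r_def cinner_diff_left cinner_diff_right algebra_simps)
  qed
  then show ?thesis
    by (simp add: field_differentiable_at_within holomorphic_on_def)
qed

lemma wholo_subset: "wholo X S \<Longrightarrow> T \<subseteq> S \<Longrightarrow> wholo X T"
  unfolding wholo_def by (meson holomorphic_on_subset subsetD)

lemma wholo_compose:
  assumes X: "wholo X S" and g: "g holomorphic_on T" "g ` T \<subseteq> S" and T: "open T"
  shows "wholo (\<lambda>z. X (g z)) T"
proof (rule wholoI)
  fix y
  show "(\<lambda>z. cinner y (X (g z))) holomorphic_on T"
    using holomorphic_on_compose_gen[OF g(1) _ g(2), of "\<lambda>z. cinner y (X z)"] X
    by (auto simp: wholo_def o_def)
next
  fix z assume z: "z \<in> T"
  then obtain e M where e: "e > 0" "\<And>w. w \<in> ball (g z) e \<Longrightarrow> norm (X w) \<le> M"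
    using X g unfolding wholo_def by blast
  have "isCont g z"
    using g z T holomorphic_on_imp_continuous_on continuous_on_eq_continuous_at by blast
  then obtain d where "d > 0" "\<And>w. dist w z < d \<Longrightarrow> dist (g w) (g z) < e"
    using e(1) unfolding continuous_at_eps_delta by blast
  then show "\<exists>e>0. \<exists>M. \<forall>w\<in>ball z e. norm (X (g w)) \<le> M"
    using e(2) by (intro exI[of _ d] conjI exI[of _ M]) (auto simp: dist_commute)
qed

section \<open>Hilbert space geometry\<close>

text \<open>Stated over the reals because H is only a real subspace. The parallelogram law makes a
  minimising sequence Cauchy.\<close>

lemma closed_subspace_projection:
  fixes S :: "'a::{real_inner,complete_space} set"
  assumes S: "subspace S" "closed S"
  obtains p where "p \<in> S" "\<And>y. y \<in> S \<Longrightarrow> inner (x - p) y = 0"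
proof -
  define d where "d = Inf ((\<lambda>y. (norm (x - y))\<^sup>2) ` S)"
  have bdd: "bdd_below ((\<lambda>y. (norm (x - y))\<^sup>2) ` S)" by (rule bdd_belowI[of _ 0]) auto
  have ne: "(\<lambda>y. (norm (x - y))\<^sup>2) ` S \<noteq> {}" using S subspace_0 by blast
  have d_le: "d \<le> (norm (x - y))\<^sup>2" if "y \<in> S" for y
    unfolding d_def using bdd that by (intro cInf_lower) auto
  have "\<exists>y\<in>S. (norm (x - y))\<^sup>2 < d + 1 / real (Suc n)" for n
    using cInf_lessD[OF ne, of "d + 1 / real (Suc n)"] unfolding d_def[symmetric] by auto
  then obtain f where f: "\<And>n. f n \<in> S" "\<And>n. (norm (x - f n))\<^sup>2 < d + 1 / real (Suc n)" by metis
  have par: "(norm (f n - f m))\<^sup>2 \<le> 2 / real (Suc n) + 2 / real (Suc m)" for n m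
  proof -
    have "(1/2) *\<^sub>R (f n + f m) \<in> S" using S f by (simp add: subspace_add subspace_scale)
    then have "d \<le> (norm (x - (1/2) *\<^sub>R (f n + f m)))\<^sup>2" by (rule d_le)
    moreover have "(norm (f n - f m))\<^sup>2 = 2 * (norm (x - f n))\<^sup>2 + 2 * (norm (x - f m))\<^sup>2
        - 4 * (norm (x - (1/2) *\<^sub>R (f n + f m)))\<^sup>2"
      by (simp add: power2_norm_eq_inner inner_diff_left inner_diff_right inner_add_left
          inner_add_right inner_commute algebra_simps)
    ultimately show ?thesis using f(2)[of n] f(2)[of m] by simp
  qed
  have "Cauchy f"
  proof (rule metric_CauchyI)
    fix e :: real assume "e > 0"
    then obtain N where N: "4 / real (Suc N) < e\<^sup>2"
      using reals_Archimedean[of "e\<^sup>2 / 4"] by (auto simp: field_simps)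
    have "dist (f m) (f n) < e" if "m \<ge> N" "n \<ge> N" for m n
    proof -
      have "2 / real (Suc m) \<le> 2 / real (Suc N)" "2 / real (Suc n) \<le> 2 / real (Suc N)"
        using that by (auto intro!: divide_left_mono)
      then have "(norm (f m - f n))\<^sup>2 < e\<^sup>2" using par[of m n] N by simp
      then show ?thesis using \<open>e > 0\<close> by (simp add: dist_norm power2_less_imp_less)
    qed
    then show "\<exists>M. \<forall>m\<ge>M. \<forall>n\<ge>M. dist (f m) (f n) < e" by blast
  qed
  then obtain p where p: "f \<longlonglongrightarrow> p" using Cauchy_convergent convergent_def by blast
  have pS: "p \<in> S" using p f S closed_sequentially by blast
  have pd: "(norm (x - p))\<^sup>2 \<le> d"
  proof (rule LIMSEQ_le)
    show "(\<lambda>n. (norm (x - f n))\<^sup>2) \<longlonglongrightarrow> (norm (x - p))\<^sup>2" using p by (intro tendsto_intros)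
    show "(\<lambda>n. d + 1 / real (Suc n)) \<longlonglongrightarrow> d" by real_asymp
    show "\<exists>N. \<forall>n\<ge>N. (norm (x - f n))\<^sup>2 \<le> d + 1 / real (Suc n)" using f(2) less_imp_le by blast
  qed
  have "inner (x - p) y = 0" if y: "y \<in> S" for y
  proof (cases "y = 0")
    case False
    \<comment> \<open>The minimiser of the quadratic polynomial in t below; minimality of p leaves
      no room for a decrease.\<close>
    define t where "t = inner (x - p) y / (norm y)\<^sup>2"
    have "p + t *\<^sub>R y \<in> S" using S pS y by (simp add: subspace_add subspace_scale)
    then have "(norm (x - p))\<^sup>2 \<le> (norm (x - (p + t *\<^sub>R y)))\<^sup>2"
      using pd d_le order_trans by blast
    also have "\<dots> = (norm (x - p))\<^sup>2 - 2 * t * inner (x - p) y + t\<^sup>2 * (norm y)\<^sup>2"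
      unfolding power2_norm_eq_inner
      by (simp add: inner_diff_left inner_diff_right inner_add_left
          inner_add_right inner_commute algebra_simps power2_eq_square)
    also have "\<dots> = (norm (x - p))\<^sup>2 - (inner (x - p) y)\<^sup>2 / (norm y)\<^sup>2"
      using False by (simp add: t_def field_simps power2_eq_square)
    finally show ?thesis using False by (simp add: divide_le_0_iff)
  qed auto
  then show thesis using that pS by blast
qed

lemma dense_subspaceI:
  fixes S :: "'a::{real_inner,complete_space} set"
  assumes S: "subspace S" and orth: "\<And>x. (\<And>y. y \<in> S \<Longrightarrow> inner x y = 0) \<Longrightarrow> x = 0"
  shows "closure S = UNIV"
proof -
  have cs: "subspace (closure S)"
    unfolding subspace_def
  proof (intro conjI ballI allI)
    show "0 \<in> closure S" using S subspace_0 closure_subset by blast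
    fix x y assume xy: "x \<in> closure S" "y \<in> closure S"
    then obtain f g where "\<And>n. f n \<in> S" "f \<longlonglongrightarrow> x" "\<And>n. g n \<in> S" "g \<longlonglongrightarrow> y"
      unfolding closure_sequential by metis
    then show "x + y \<in> closure S"
      unfolding closure_sequential using S by (intro exI[of _ "\<lambda>n. f n + g n"])
        (auto intro!: tendsto_intros simp: subspace_add)
  next
    fix c x assume "x \<in> closure S"
    then obtain f where "\<And>n. f n \<in> S" "f \<longlonglongrightarrow> x" unfolding closure_sequential by metis
    then show "c *\<^sub>R x \<in> closure S"
      unfolding closure_sequential using S by (intro exI[of _ "\<lambda>n. c *\<^sub>R f n"])
        (auto intro!: tendsto_intros simp: subspace_scale)
  qed
  have "x \<in> closure S" for x
  proof -
    obtain p where p: "p \<in> closure S" "\<And>y. y \<in> closure S \<Longrightarrow> inner (x - p) y = 0"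
      using closed_subspace_projection[OF cs closed_closure] by blast
    then have "x - p = 0" using closure_subset by (intro orth) blast
    then show ?thesis using p(1) by simp
  qed
  then show ?thesis by auto
qed

lemma eq_on_dense:
  fixes f g :: "'a::topological_space \<Rightarrow> 'b::t2_space"
  assumes "closure A = UNIV" "continuous_on UNIV f" "continuous_on UNIV g"
    and "\<And>x. x \<in> A \<Longrightarrow> f x = g x"
  shows "f x = g x"
proof -
  have "closed {x. f x = g x}" using assms by (intro closed_Collect_eq)
  then have "closure A \<subseteq> {x. f x = g x}" using assms(4) by (intro closure_minimal) auto
  then show ?thesis using assms(1) by auto
qed

lemma dense_range_sequence:
  fixes R :: "'b \<Rightarrow> 'a::first_countable_topology"
  assumes dense: "closure (range R) = UNIV"
  shows "\<exists>f. (\<lambda>n. R (f n)) \<longlonglongrightarrow> a"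
proof -
  have "a \<in> closure (range R)" using dense by simp
  then obtain g where g: "\<forall>n. g n \<in> range R" "g \<longlonglongrightarrow> a" unfolding closure_sequential by blast
  then have "\<forall>n. \<exists>x. g n = R x" by blast
  then obtain f where "\<forall>n. g n = R (f n)" using choice[of "\<lambda>n x. g n = R x"] by blast
  then have "g = (\<lambda>n. R (f n))" by auto
  then show ?thesis using g(2) by auto
qed

lemma isometry_bounded_linear:
  assumes "linear f" "\<And>x. norm (f x) = norm x"
  shows "bounded_linear f"
  using assms by (intro bounded_linear_intro[where K = 1]) (auto simp: linear_add linear_scale)

lemma isometry_inner:
  assumes "linear f" "\<And>x. norm (f x) = norm x"
  shows "inner (f x) (f y) = inner x y"
proof -
  have "(norm (f (x + y)))\<^sup>2 = (norm (x + y))\<^sup>2" using assms by simp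
  then show ?thesis
    using arg_cong[OF assms(2)[of x], of "\<lambda>r. r\<^sup>2"] arg_cong[OF assms(2)[of y], of "\<lambda>r. r\<^sup>2"]
    unfolding linear_add[OF assms(1)] power2_norm_eq_inner
    by (simp add: inner_add_left inner_add_right inner_commute)
qed

lemma isometry_cinner:
  assumes "clinear f" "\<And>x. norm (f x) = norm x"
  shows "cinner (f x) (f y) = cinner x y"
  using isometry_inner[OF clinearD(1)[OF assms(1)] assms(2)] clinearD(2)[OF assms(1)]
  by (metis cinner_def)

text \<open>\<open>D\<close> is T composed with the inverse of R: equal norms make it well defined
  and carry Cauchy sequences to Cauchy sequences. Only real linearity is asked, so that the same
  lemma yields the modular unitaries and the antilinear modular conjugation.\<close>

lemma isometric_extension:
  fixes R S :: "'a::real_normed_vector \<Rightarrow> 'b::real_normed_vector"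
    and T :: "'a \<Rightarrow> 'c::banach"
  assumes R: "linear R" and T: "linear T" and dense: "closure (range R) = UNIV"
    and iso: "\<And>x. norm (T x) = norm (R x)"
  obtains D where "linear D" "\<And>x. norm (D x) = norm x" "\<And>x. D (R x) = T x"
proof -
  have iso': "norm (T x - T y) = norm (R x - R y)" for x y
    using iso[of "x - y"] by (simp add: linear_diff[OF R] linear_diff[OF T])
  note ex = dense_range_sequence[OF dense]
  have lim: "\<exists>b. \<forall>f. (\<lambda>n. R (f n)) \<longlonglongrightarrow> a \<longrightarrow> (\<lambda>n. T (f n)) \<longlonglongrightarrow> b" for a
  proof -
    obtain f where f: "(\<lambda>n. R (f n)) \<longlonglongrightarrow> a" using ex by blast
    then have "Cauchy (\<lambda>n. R (f n))" using LIMSEQ_imp_Cauchy by blast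
    then have "Cauchy (\<lambda>n. T (f n))" by (simp add: Cauchy_def dist_norm iso')
    then obtain b where b: "(\<lambda>n. T (f n)) \<longlonglongrightarrow> b" using Cauchy_convergent convergent_def by blast
    have "(\<lambda>n. T (g n)) \<longlonglongrightarrow> b" if g: "(\<lambda>n. R (g n)) \<longlonglongrightarrow> a" for g
    proof -
      have "(\<lambda>n. R (g n) - R (f n)) \<longlonglongrightarrow> 0" using tendsto_diff[OF g f] by simp
      then have "(\<lambda>n. T (g n) - T (f n)) \<longlonglongrightarrow> 0"
        by (subst (asm) tendsto_norm_zero_iff[symmetric], subst tendsto_norm_zero_iff[symmetric])
           (simp add: iso')
      from tendsto_add[OF this b] show ?thesis by simp
    qed
    then show ?thesis by blast
  qed
  define D where "D a = (SOME b. \<forall>f. (\<lambda>n. R (f n)) \<longlonglongrightarrow> a \<longrightarrow> (\<lambda>n. T (f n)) \<longlonglongrightarrow> b)" for a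
  have D: "(\<lambda>n. T (f n)) \<longlonglongrightarrow> D a" if "(\<lambda>n. R (f n)) \<longlonglongrightarrow> a" for a f
    using someI_ex[OF lim[of a]] that unfolding D_def by blast
  show thesis
  proof (rule that[of D])
    show "linear D"
    proof (rule linearI)
      fix a b c
      obtain f g where f: "(\<lambda>n. R (f n)) \<longlonglongrightarrow> a" and g: "(\<lambda>n. R (g n)) \<longlonglongrightarrow> b"
        using ex[of a] ex[of b] by blast
      have "(\<lambda>n. R (f n + g n)) \<longlonglongrightarrow> a + b"
        using tendsto_add[OF f g] by (simp add: linear_add[OF R])
      from D[OF this] have "(\<lambda>n. T (f n) + T (g n)) \<longlonglongrightarrow> D (a + b)" by (simp add: linear_add[OF T])
      then show "D (a + b) = D a + D b"
        using tendsto_add[OF D[OF f] D[OF g]] LIMSEQ_unique by blast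
      have "(\<lambda>n. R (c *\<^sub>R f n)) \<longlonglongrightarrow> c *\<^sub>R a"
        using tendsto_scaleR[OF tendsto_const f] by (simp add: linear_scale[OF R])
      from D[OF this] have "(\<lambda>n. c *\<^sub>R T (f n)) \<longlonglongrightarrow> D (c *\<^sub>R a)" by (simp add: linear_scale[OF T])
      then show "D (c *\<^sub>R a) = c *\<^sub>R D a"
        using tendsto_scaleR[OF tendsto_const D[OF f]] LIMSEQ_unique by blast
    qed
    show "norm (D a) = norm a" for a
    proof -
      obtain f where f: "(\<lambda>n. R (f n)) \<longlonglongrightarrow> a" using ex[of a] by blast
      show ?thesis
        using tendsto_norm[OF f] tendsto_norm[OF D[OF f]] LIMSEQ_unique by (simp add: iso)
    qed
    show "D (R x) = T x" for x
      using D[of "\<lambda>_. x" "R x"] by (simp add: LIMSEQ_const_iff)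
  qed
qed

section \<open>Power series in a contraction\<close>

definition opseries :: "('a::complex_hilbert \<Rightarrow> 'a) \<Rightarrow> (nat \<Rightarrow> complex) \<Rightarrow> 'a \<Rightarrow> 'a" where
  "opseries A c x = (\<Sum>n. c n *\<^sub>C (A ^^ n) x)"

definition contraction :: "('a::complex_hilbert \<Rightarrow> 'a) \<Rightarrow> bool" where
  "contraction A \<longleftrightarrow> clinear A \<and> (\<forall>x. norm (A x) \<le> norm x)"

lemma contraction_uminus: "contraction A \<Longrightarrow> contraction (\<lambda>x. - A x)"
  by (auto simp: contraction_def clinear_def linear_compose_neg)

context
  fixes A :: "'a::complex_hilbert \<Rightarrow> 'a"
  assumes A: "contraction A"
begin

lemma clinear_funpow: "clinear (A ^^ n)"
proof (induction n)
  case 0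
  show ?case using linear_id by (simp add: clinear_def id_def)
next
  case (Suc n)
  then show ?case using A linear_compose[of "A ^^ n" A] by (simp add: clinear_def contraction_def comp_def)
qed

lemma norm_funpow_le: "norm ((A ^^ n) x) \<le> norm x"
  by (induction n) (use A in \<open>auto simp: contraction_def intro: order_trans\<close>)

lemma opseries_summable_norm:
  assumes "summable (\<lambda>n. cmod (c n))"
  shows "summable (\<lambda>n. norm (c n *\<^sub>C (A ^^ n) x))"
  by (rule summable_comparison_test'[OF summable_mult2[OF assms, of "norm x"], of 0])
     (auto simp: norm_cscale norm_funpow_le mult_left_mono)

lemma opseries_sums:
  assumes "summable (\<lambda>n. cmod (c n))"
  shows "(\<lambda>n. c n *\<^sub>C (A ^^ n) x) sums opseries A c x"
  unfolding opseries_def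
  by (rule summable_sums[OF summable_norm_cancel[OF opseries_summable_norm[OF assms]]])

lemma norm_opseries_le:
  assumes "summable (\<lambda>n. cmod (c n))"
  shows "norm (opseries A c x) \<le> (\<Sum>n. cmod (c n)) * norm x"
proof -
  have "norm (opseries A c x) \<le> (\<Sum>n. norm (c n *\<^sub>C (A ^^ n) x))"
    unfolding opseries_def by (rule summable_norm[OF opseries_summable_norm[OF assms]])
  also have "\<dots> \<le> (\<Sum>n. cmod (c n) * norm x)"
    by (rule suminf_le[OF _ opseries_summable_norm[OF assms] summable_mult2[OF assms]])
       (auto simp: norm_cscale norm_funpow_le mult_left_mono)
  also have "\<dots> = (\<Sum>n. cmod (c n)) * norm x"
    by (rule suminf_mult2[OF assms, symmetric])
  finally show ?thesis .
qed

lemma clinear_opseries: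
  assumes c: "summable (\<lambda>n. cmod (c n))"
  shows "clinear (opseries A c)"
  unfolding clinear_def
proof (intro conjI allI)
  note lin = clinearD[OF clinear_funpow]
  show "linear (opseries A c)"
  proof (rule linearI)
    fix x y r
    show "opseries A c (x + y) = opseries A c x + opseries A c y"
      using opseries_sums[OF c, of "x + y"] sums_add[OF opseries_sums[OF c, of x] opseries_sums[OF c, of y]]
      by (intro sums_unique2) (auto simp: lin(4) cscale_add_right)
    have "(\<lambda>n. r *\<^sub>R c n *\<^sub>C (A ^^ n) x) sums (r *\<^sub>R opseries A c x)"
      by (rule sums_scaleR_right[OF opseries_sums[OF c]])
    then show "opseries A c (r *\<^sub>R x) = r *\<^sub>R opseries A c x"
      using opseries_sums[OF c, of "r *\<^sub>R x"]
      by (intro sums_unique2) (auto simp: lin(7) linear_scale[OF linear_cscale])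
  qed
  fix x
  have "(\<lambda>n. imult (c n *\<^sub>C (A ^^ n) x)) sums imult (opseries A c x)"
    by (rule bounded_linear.sums[OF bounded_linear_imult opseries_sums[OF c]])
  then show "opseries A c (imult x) = imult (opseries A c x)"
    using opseries_sums[OF c, of "imult x"]
    by (intro sums_unique2) (auto simp: lin(2) imult_cscale)
qed

text \<open>\<open>\<sigma>\<close> covers both kinds of intertwiner: the identity for complex
  linear \<open>T\<close>, and \<open>cnj\<close> for antilinear ones such as
  \<open>S0\<close>.\<close>

lemma opseries_intertwine:
  assumes c: "summable (\<lambda>n. cmod (c n))" and B: "contraction B" and T: "bounded_linear T"
    and TA: "\<And>x. T (A x) = B (T x)" and \<sigma>: "\<And>c x. T (c *\<^sub>C x) = \<sigma> c *\<^sub>C T x"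
  shows "T (opseries A c x) = opseries B (\<lambda>n. \<sigma> (c n)) (T x)"
proof -
  have "T ((A ^^ n) x) = (B ^^ n) (T x)" for n
    by (induction n) (auto simp: TA)
  then have "(\<lambda>n. \<sigma> (c n) *\<^sub>C (B ^^ n) (T x)) sums T (opseries A c x)"
    using bounded_linear.sums[OF T opseries_sums[OF c, of x]] by (simp add: \<sigma>)
  then show ?thesis unfolding opseries_def by (simp add: sums_iff)
qed

lemma bounded_linear_opseries:
  "summable (\<lambda>n. cmod (c n)) \<Longrightarrow> bounded_linear (opseries A c)"
  using clinearD[OF clinear_opseries] norm_opseries_le
  by (intro bounded_linear_intro[where K = "\<Sum>n. cmod (c n)"]) (auto simp: mult.commute)

lemma opseries_adjoint:
  assumes c: "summable (\<lambda>n. cmod (c n))" and sa: "\<And>x y. inner (A x) y = inner x (A y)"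
  shows "cinner (opseries A c x) y = cinner x (opseries A (\<lambda>n. cnj (c n)) y)"
proof -
  have sa': "cinner (A x) y = cinner x (A y)" for x y
    using A sa by (auto simp: cinner_def contraction_def clinear_def) (metis)
  have "cinner ((A ^^ n) x) y = cinner x ((A ^^ n) y)" for n x y
    by (induction n arbitrary: x y) (auto simp: sa' funpow_swap1)
  then have *: "(\<lambda>n. cinner (c n *\<^sub>C (A ^^ n) x) y) = (\<lambda>n. cinner x (cnj (c n) *\<^sub>C (A ^^ n) y))"
    by (simp add: cinner_cscale_left cinner_cscale_right)
  have "(\<lambda>n. cinner (c n *\<^sub>C (A ^^ n) x) y) sums cinner (opseries A c x) y"
    by (rule bounded_linear.sums[OF bounded_bilinear.bounded_linear_left[OF bounded_bilinear_cinner]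
          opseries_sums[OF c]])
  moreover have "(\<lambda>n. cinner x (cnj (c n) *\<^sub>C (A ^^ n) y)) sums cinner x (opseries A (\<lambda>n. cnj (c n)) y)"
    using c by (intro bounded_linear.sums[OF bounded_bilinear.bounded_linear_right[OF bounded_bilinear_cinner]
          opseries_sums]) simp
  ultimately show ?thesis unfolding * by (rule sums_unique2)
qed

text \<open>A Cauchy product: the double family is absolutely summable, so summing it by rows and by
  antidiagonals gives the same value.\<close>

lemma opseries_mult:
  assumes c: "summable (\<lambda>n. cmod (c n))" and d: "summable (\<lambda>n. cmod (d n))"
  shows "opseries A c (opseries A d x) = opseries A (\<lambda>n. \<Sum>i\<le>n. c i * d (n - i)) x"
proof -
  define f where "f = (\<lambda>(i, j). (c i * d j) *\<^sub>C (A ^^ (i + j)) x)"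
  have hs: "((\<lambda>n. e n *\<^sub>C (A ^^ n) y) has_sum opseries A e y) UNIV"
    if "summable (\<lambda>n. cmod (e n))" for e y
    by (rule norm_summable_imp_has_sum[OF opseries_summable_norm[OF that] opseries_sums[OF that]])
  have rows: "((\<lambda>j. f (i, j)) has_sum c i *\<^sub>C (A ^^ i) (opseries A d x)) UNIV" for i
  proof -
    have "bounded_linear (A ^^ i)"
      using clinearD[OF clinear_funpow] norm_funpow_le
      by (intro bounded_linear_intro[where K = 1]) auto
    then have "bounded_linear (\<lambda>y. c i *\<^sub>C (A ^^ i) y)"
      by (rule bounded_linear_compose[OF bounded_linear_cscale])
    from has_sum_bounded_linear[OF this hs[OF d]] show ?thesis
      by (simp add: f_def o_def clinearD(3)[OF clinear_funpow] cscale_cscale funpow_add)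
  qed
  have "(\<lambda>p. norm (f p)) summable_on UNIV \<times> UNIV"
  proof (subst Infinite_Sum.abs_summable_on_Sigma_iff, intro conjI ballI)
    have b: "norm (f (i, j)) \<le> cmod (c i) * norm x * cmod (d j)" for i j
      using mult_left_mono[OF norm_funpow_le[of "i + j" x], of "cmod (c i * d j)"]
      by (simp add: f_def norm_cscale norm_mult mult_ac)
    have row: "summable (\<lambda>j. norm (f (i, j)))" for i
      by (rule summable_comparison_test'[OF summable_mult[OF d, of "cmod (c i) * norm x"], of 0])
         (use b in auto)
    then show row': "(\<lambda>j. norm (f (i, j))) summable_on UNIV" for i
      by (auto intro: norm_summable_imp_summable_on)
    have inf: "(\<Sum>\<^sub>\<infinity>j. norm (f (i, j))) \<le> cmod (c i) * (norm x * (\<Sum>j. cmod (d j)))" for i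
    proof -
      have "(\<Sum>\<^sub>\<infinity>j. norm (f (i, j))) = (\<Sum>j. norm (f (i, j)))"
        using row'[of i] has_sum_imp_sums[OF has_sum_infsum[OF row'[of i]]] by (simp add: sums_iff)
      also have "\<dots> \<le> (\<Sum>j. cmod (c i) * norm x * cmod (d j))"
        using b row summable_mult[OF d] by (intro suminf_le) auto
      also have "\<dots> = cmod (c i) * (norm x * (\<Sum>j. cmod (d j)))"
        by (simp add: suminf_mult[OF d])
      finally show ?thesis .
    qed
    have nn: "0 \<le> (\<Sum>\<^sub>\<infinity>j. norm (f (i, j)))" for i by (rule infsum_nonneg) auto
    have "summable (\<lambda>i. norm (\<Sum>\<^sub>\<infinity>j. norm (f (i, j))))"
      by (rule summable_comparison_test'[OF summable_mult2[OF c], of 0])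
         (use inf nn in auto)
    then show "(\<lambda>i. norm (\<Sum>\<^sub>\<infinity>j. norm (f (i, j)))) summable_on UNIV"
      by (auto intro: norm_summable_imp_summable_on)
  qed
  then have "f summable_on UNIV \<times> UNIV" by (rule Infinite_Sum.abs_summable_summable)
  then have total: "(f has_sum infsum f UNIV) (UNIV \<times> UNIV)" by (simp add: has_sum_infsum)
  have "((\<lambda>i. c i *\<^sub>C (A ^^ i) (opseries A d x)) has_sum infsum f UNIV) UNIV"
    by (rule has_sum_SigmaD[OF total rows])
  then have 1: "opseries A c (opseries A d x) = infsum f UNIV"
    using has_sum_unique[OF hs[OF c]] by blast
  have "bij_betw (\<lambda>(n, i). (i, n - i)) (SIGMA n:UNIV. {..n}) (UNIV \<times> UNIV :: (nat \<times> nat) set)"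
    by (rule bij_betw_byWitness[where f' = "\<lambda>(i, j). (i + j, i)"]) auto
  from has_sum_reindex_bij_betw[OF this, of f]
  have "((\<lambda>(n, i). f (i, n - i)) has_sum infsum f UNIV) (SIGMA n:UNIV. {..n})"
    using total by (simp add: case_prod_unfold)
  then have "((\<lambda>n. \<Sum>i\<le>n. f (i, n - i)) has_sum infsum f UNIV) UNIV"
    by (rule has_sum_SigmaD) (auto intro!: has_sum_finiteI)
  then have "(\<lambda>n. \<Sum>i\<le>n. f (i, n - i)) sums infsum f UNIV" by (rule has_sum_imp_sums)
  moreover have "(\<Sum>i\<le>n. f (i, n - i)) = (\<Sum>i\<le>n. c i * d (n - i)) *\<^sub>C (A ^^ n) x" for n
    by (simp add: f_def cscale_sum_left)
  ultimately show ?thesis unfolding 1 by (simp add: opseries_def sums_iff)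
qed

end

section \<open>Binomial series of a contraction\<close>

text \<open>The product of \<open>cmod (a gchoose n)\<close> and (n + 1)^2 does not increase once n
  is large, because the square of \<open>cmod (a - of_nat n)\<close> is at most n^2 - 4 n + M^2; the
  first terms are absorbed in \<open>C\<close>. Uniformity in \<open>a\<close> is what analyticity
  in the exponent requires.\<close>

lemma gbinomial_bound:
  fixes M :: real
  obtains C where "C \<ge> 0" "\<And>a n. 2 \<le> Re a \<Longrightarrow> cmod a \<le> M \<Longrightarrow> cmod (a gchoose n) \<le> C / (real (Suc n))\<^sup>2"
proof -
  \<comment> \<open>The coefficients of n^5 are 4 on the left and 6 on the right; the 4 is 8 - 4,
    where - 4 n comes from Re a \<ge> 2.\<close>
  have "eventually (\<lambda>n::nat. ((real n)\<^sup>2 - 4 * real n + M\<^sup>2) * (real n + 2) ^ 4 \<le> (real n + 1) ^ 6) at_top"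
    by real_asymp
  then obtain N where N: "\<And>n::nat. n \<ge> N \<Longrightarrow>
      ((real n)\<^sup>2 - 4 * real n + M\<^sup>2) * (real n + 2) ^ 4 \<le> (real n + 1) ^ 6"
    by (auto simp: eventually_at_top_linorder)
  define P where "P n = (real (Suc n))\<^sup>2 * (\<Prod>i<n. \<bar>M\<bar> + real i)" for n
  have P0: "0 \<le> P n" for n by (auto simp: P_def intro!: mult_nonneg_nonneg prod_nonneg)
  define C where "C = (\<Sum>n\<le>N. P n)"
  have small: "cmod (a gchoose n) * (real (Suc n))\<^sup>2 \<le> C" if a: "cmod a \<le> M" and n: "n \<le> N" for a n
  proof -
    have "cmod (a gchoose n) \<le> cmod (\<Prod>i<n. a - of_nat i) / 1"
      unfolding gbinomial_prod_rev norm_divide lessThan_atLeast0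
      by (rule divide_left_mono) auto
    also have "cmod (\<Prod>i<n. a - of_nat i) \<le> (\<Prod>i<n. \<bar>M\<bar> + real i)"
      unfolding prod_norm[symmetric]
    proof (rule prod_mono, intro conjI)
      fix i
      show "cmod (a - of_nat i) \<le> \<bar>M\<bar> + real i"
        using norm_triangle_ineq4[of a "of_nat i"] a by simp
    qed auto
    finally have "cmod (a gchoose n) * (real (Suc n))\<^sup>2 \<le> P n"
      unfolding P_def by (simp add: mult.commute mult_left_mono)
    also have "\<dots> \<le> C" unfolding C_def using n P0 by (intro member_le_sum) auto
    finally show ?thesis .
  qed
  have main: "cmod (a gchoose n) * (real (Suc n))\<^sup>2 \<le> C" if a: "2 \<le> Re a" "cmod a \<le> M" for a n
  proof (cases "n \<le> N")
    case True
    then show ?thesis using small a by blast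
  next
    case False
    then have "N \<le> n" by simp
    then show ?thesis
    proof (induction n rule: dec_induct)
      case base
      show ?case using small a by blast
    next
      case (step n)
      have rec: "(a gchoose Suc n) * of_nat (Suc n) = (a gchoose n) * (a - of_nat n)"
        using gbinomial_mult_1'[of a n] by (simp add: algebra_simps)
      have "(cmod (a - of_nat n))\<^sup>2 = (real n)\<^sup>2 - 2 * real n * Re a + (cmod a)\<^sup>2"
        unfolding cmod_power2 by (simp add: power2_eq_square algebra_simps)
      also have "\<dots> \<le> (real n)\<^sup>2 - 4 * real n + M\<^sup>2"
      proof -
        have "2 * real n * 2 \<le> 2 * real n * Re a" "(cmod a)\<^sup>2 \<le> M\<^sup>2"
          using mult_left_mono[OF a(1), of "2 * real n"] power_mono[OF a(2), of 2] by auto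
        then show ?thesis by linarith
      qed
      finally have "(cmod (a - of_nat n))\<^sup>2 * (real n + 2) ^ 4 \<le> (real n + 1) ^ 6"
        using N[of n] step(1) by (elim order_trans[OF mult_right_mono]) auto
      then have "(cmod (a - of_nat n) * (real n + 2)\<^sup>2)\<^sup>2 \<le> ((real n + 1) ^ 3)\<^sup>2"
        by (simp add: power_mult_distrib flip: power_mult)
      then have q: "cmod (a - of_nat n) * (real n + 2)\<^sup>2 \<le> (real n + 1) ^ 3"
        by (rule power2_le_imp_le) simp
      have "cmod (a gchoose Suc n) * (real n + 1) = cmod (a gchoose n) * cmod (a - of_nat n)"
        using arg_cong[OF rec, of cmod] unfolding norm_mult norm_of_nat by (simp add: add.commute)
      then have "cmod (a gchoose Suc n) * (real n + 2)\<^sup>2 * (real n + 1)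
          = cmod (a gchoose n) * (cmod (a - of_nat n) * (real n + 2)\<^sup>2)"
        by (simp add: mult_ac)
      also have "\<dots> \<le> cmod (a gchoose n) * (real n + 1) ^ 3"
        using q by (rule mult_left_mono) simp
      also have "\<dots> = (cmod (a gchoose n) * (real (Suc n))\<^sup>2) * (real n + 1)"
        by (simp add: power2_eq_square power3_eq_cube add.commute)
      finally have "cmod (a gchoose Suc n) * (real n + 2)\<^sup>2 \<le> cmod (a gchoose n) * (real (Suc n))\<^sup>2"
        by (rule mult_right_le_imp_le) simp
      then show ?case using step by (simp add: add.commute)
    qed
  qed
  show thesis
  proof (rule that[of C])
    show "C \<ge> 0" unfolding C_def using P0 by (intro sum_nonneg) auto
    show "cmod (a gchoose n) \<le> C / (real (Suc n))\<^sup>2" if "2 \<le> Re a" "cmod a \<le> M" for a n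
      using main[OF that, of n] by (simp add: pos_le_divide_eq del: of_nat_Suc)
  qed
qed

lemma summable_inverse_Suc_squared: "summable (\<lambda>n. C / (real (Suc n))\<^sup>2)"
proof -
  have "summable (\<lambda>n. inverse ((real (Suc n)) ^ 2))"
    using inverse_power_summable[of 2, where 'a = real] by (subst summable_Suc_iff) simp
  from summable_mult[OF this, of C] show ?thesis by (simp add: divide_inverse)
qed

lemma summable_gbinomial: "2 \<le> Re a \<Longrightarrow> summable (\<lambda>n. cmod (a gchoose n))"
proof -
  assume a: "2 \<le> Re a"
  obtain C where C: "C \<ge> 0" "\<And>b n. 2 \<le> Re b \<Longrightarrow> cmod b \<le> cmod a \<Longrightarrow> cmod (b gchoose n) \<le> C / (real (Suc n))\<^sup>2"
    using gbinomial_bound[of "cmod a"] by blast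
  show ?thesis
    by (rule summable_comparison_test'[OF summable_inverse_Suc_squared[of C], of 0]) (simp add: C(2) a del: of_nat_Suc)
qed

lemma gbinomial_1_complex: "(1::complex) gchoose n = (if n \<le> 1 then 1 else 0)"
  using binomial_gbinomial[of 1 n, where 'a = complex] by (cases n) (auto simp: binomial_eq_0)

text \<open>The exponent 1 is below the range Re a \<ge> 2, yet 1 + A and 1 - A themselves occur as
  factors, in the injectivity of \<open>R\<close> and in the values of \<open>q\<close> at i/2 and -
  i/2.\<close>

lemma summable_gbinomial_1: "summable (\<lambda>n. cmod (1 gchoose n))"
  by (rule summable_finite[of "{..1}"]) (auto simp: gbinomial_1_complex)

text \<open>This is (1 + A)^a.\<close>

definition binop :: "('a::complex_hilbert \<Rightarrow> 'a) \<Rightarrow> complex \<Rightarrow> 'a \<Rightarrow> 'a" where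
  "binop A a = opseries A (\<lambda>n. a gchoose n)"

lemma cnj_gbinomial: "cnj (a gchoose n) = (cnj a gchoose n)"
  by (simp add: gbinomial_prod_rev)

text \<open>Vandermonde's identity is the exponent law (1 + A)^a (1 + A)^b = (1 + A)^(a + b) at the
  level of coefficients.\<close>

lemma binop_add:
  assumes "contraction A" "summable (\<lambda>n. cmod (a gchoose n))" "summable (\<lambda>n. cmod (b gchoose n))"
  shows "binop A a (binop A b x) = binop A (a + b) x"
  unfolding binop_def opseries_mult[OF assms]
  by (simp add: gbinomial_Vandermonde atMost_atLeast0)

lemma binop_1: "binop A 1 x = x + A x"
proof -
  have "binop A 1 x = (\<Sum>n\<in>{0,1}. (1 gchoose n) *\<^sub>C (A ^^ n) x)"
    unfolding binop_def opseries_def by (rule suminf_finite) (auto simp: gbinomial_1_complex)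
  then show ?thesis by simp
qed

lemma binop_bounded:
  assumes A: "contraction A"
  obtains K where "K \<ge> 0" "\<And>a x. 2 \<le> Re a \<Longrightarrow> cmod a \<le> M \<Longrightarrow> norm (binop A a x) \<le> K * norm x"
proof -
  obtain C where C: "C \<ge> 0" "\<And>b n. 2 \<le> Re b \<Longrightarrow> cmod b \<le> M \<Longrightarrow> cmod (b gchoose n) \<le> C / (real (Suc n))\<^sup>2"
    using gbinomial_bound[of M] by blast
  show thesis
  proof (rule that[of "\<Sum>n. C / (real (Suc n))\<^sup>2"])
    show "0 \<le> (\<Sum>n. C / (real (Suc n))\<^sup>2)"
      using C(1) by (intro suminf_nonneg summable_inverse_Suc_squared) auto
    fix b x assume b: "2 \<le> Re b" "cmod b \<le> M"
    have "(\<Sum>n. cmod (b gchoose n)) \<le> (\<Sum>n. C / (real (Suc n))\<^sup>2)"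
      by (rule suminf_le[OF C(2)[OF b] summable_gbinomial[OF b(1)] summable_inverse_Suc_squared])
    then show "norm (binop A b x) \<le> (\<Sum>n. C / (real (Suc n))\<^sup>2) * norm x"
      unfolding binop_def using norm_opseries_le[OF A summable_gbinomial[OF b(1)], of x]
      by (meson mult_right_mono norm_ge_zero order_trans)
  qed
qed

text \<open>The partial sums are polynomials in the exponent, and the uniform coefficient bound
  supplies the majorant for the M-test.\<close>

lemma wholo_binop:
  assumes A: "contraction A"
  shows "wholo (\<lambda>a. binop A a x) {a. 2 < Re a}"
proof (rule wholoI)
  have opn: "open {a. 2 < Re a}" by (rule open_halfspace_Re_gt)
  fix y
  show "(\<lambda>a. cinner y (binop A a x)) holomorphic_on {a. 2 < Re a}"
  proof (rule holomorphic_uniform_sequence[where f = "\<lambda>n a. \<Sum>i<n. (a gchoose i) * cinner y ((A ^^ i) x)"])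
    show "(\<lambda>a. \<Sum>i<n. (a gchoose i) * cinner y ((A ^^ i) x)) holomorphic_on {a. 2 < Re a}" for n
      unfolding gbinomial_prod_rev by (intro holomorphic_intros) auto
    fix a assume "a \<in> {a. 2 < Re a}"
    then obtain d where d: "d > 0" "cball a d \<subseteq> {a. 2 < Re a}" using opn open_contains_cball by blast
    obtain C where C: "C \<ge> 0" "\<And>b n. 2 \<le> Re b \<Longrightarrow> cmod b \<le> cmod a + d \<Longrightarrow> cmod (b gchoose n) \<le> C / (real (Suc n))\<^sup>2"
      using gbinomial_bound[of "cmod a + d"] by blast
    have "uniform_limit (cball a d) (\<lambda>n b. \<Sum>i<n. (b gchoose i) * cinner y ((A ^^ i) x))
        (\<lambda>b. \<Sum>i. (b gchoose i) * cinner y ((A ^^ i) x)) sequentially"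
    proof (rule Weierstrass_m_test)
      show "summable (\<lambda>n. C * (norm y * norm x) / (real (Suc n))\<^sup>2)" by (rule summable_inverse_Suc_squared)
      fix n b assume b: "b \<in> cball a d"
      have "cmod b \<le> cmod a + d" using b norm_triangle_sub[of b a] by (simp add: dist_norm norm_minus_commute)
      then have "cmod (b gchoose n) \<le> C / (real (Suc n))\<^sup>2" using b d by (intro C) auto
      moreover have "cmod (cinner y ((A ^^ n) x)) \<le> norm y * norm x"
        using cmod_cinner_le[of y "(A ^^ n) x"] mult_left_mono[OF norm_funpow_le[OF A, of n x], of "norm y"]
        by (meson norm_ge_zero order_trans)
      ultimately have "cmod (b gchoose n) * cmod (cinner y ((A ^^ n) x)) \<le> C / (real (Suc n))\<^sup>2 * (norm y * norm x)"
        using C(1) by (intro mult_mono) auto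
      then show "norm ((b gchoose n) * cinner y ((A ^^ n) x)) \<le> C * (norm y * norm x) / (real (Suc n))\<^sup>2"
        by (simp add: norm_mult del: of_nat_Suc)
    qed
    moreover have "(\<Sum>i. (b gchoose i) * cinner y ((A ^^ i) x)) = cinner y (binop A b x)"
      if "b \<in> cball a d" for b
    proof -
      have "summable (\<lambda>n. cmod (b gchoose n))" using that d by (intro summable_gbinomial) auto
      from bounded_linear.sums[OF bounded_bilinear.bounded_linear_right[OF bounded_bilinear_cinner]
          opseries_sums[OF A this]]
      show ?thesis by (simp add: binop_def cinner_cscale_right sums_iff)
    qed
    ultimately have "uniform_limit (cball a d) (\<lambda>n b. \<Sum>i<n. (b gchoose i) * cinner y ((A ^^ i) x))
        (\<lambda>b. cinner y (binop A b x)) sequentially"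
      by (subst uniform_limit_cong') auto
    then show "\<exists>d>0. cball a d \<subseteq> {a. 2 < Re a} \<and>
        uniform_limit (cball a d) (\<lambda>n b. \<Sum>i<n. (b gchoose i) * cinner y ((A ^^ i) x))
        (\<lambda>b. cinner y (binop A b x)) sequentially" using d by blast
  qed (rule opn)
next
  fix a :: complex assume "a \<in> {a. 2 < Re a}"
  moreover have "open {a. 2 < Re a}" by (rule open_halfspace_Re_gt)
  ultimately obtain d where d: "d > 0" "ball a d \<subseteq> {a. 2 < Re a}" using openE by blast
  obtain K where K: "\<And>b x. 2 \<le> Re b \<Longrightarrow> cmod b \<le> cmod a + d \<Longrightarrow> norm (binop A b x) \<le> K * norm x"
    using binop_bounded[OF A, of "cmod a + d"] by blast
  have "norm (binop A b x) \<le> K * norm x" if b: "b \<in> ball a d" for b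
  proof -
    have "cmod b \<le> cmod a + d" using b norm_triangle_sub[of b a] by (simp add: dist_norm norm_minus_commute)
    then show ?thesis using b d by (intro K) auto
  qed
  then show "\<exists>e>0. \<exists>M. \<forall>w\<in>ball a e. norm (binop A w x) \<le> M" using d(1) by blast
qed

section \<open>Modular objects of a standard subspace\<close>

lemma bounded_linear_eq_on_dense:
  assumes "bounded_linear f" "bounded_linear g" "closure A = UNIV" "\<And>x. x \<in> A \<Longrightarrow> f x = g x"
  shows "f x = g x"
  by (rule eq_on_dense[where f = f and g = g, OF assms(3) linear_continuous_on[OF assms(1)]
        linear_continuous_on[OF assms(2)] assms(4)])

locale standard_sub =
  fixes H :: "'a::complex_hilbert set"
  assumes std: "standard_subspace H"
begin

lemma subspace_H: "subspace H" and closed_H: "closed H"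
  and H_inter: "H \<inter> imult ` H = {0}"
  and H_dense: "closure {h + imult k | h k. h \<in> H \<and> k \<in> H} = UNIV"
  using std by (auto simp: standard_subspace_def)

section \<open>Real orthogonal projections onto H and i H\<close>

definition P :: "'a \<Rightarrow> 'a" where
  "P x = (SOME p. p \<in> H \<and> (\<forall>y\<in>H. inner (x - p) y = 0))"

lemma P_in: "P x \<in> H" and P_orth: "y \<in> H \<Longrightarrow> inner (x - P x) y = 0"
proof -
  have "\<exists>p. p \<in> H \<and> (\<forall>y\<in>H. inner (x - p) y = 0)"
    by (rule closed_subspace_projection[OF subspace_H closed_H, of x]) blast
  from someI_ex[OF this] show "P x \<in> H" "y \<in> H \<Longrightarrow> inner (x - P x) y = 0"
    unfolding P_def by auto
qed

lemma P_unique: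
  assumes "p \<in> H" "\<And>y. y \<in> H \<Longrightarrow> inner (x - p) y = 0"
  shows "P x = p"
proof -
  have d: "P x - p \<in> H" using assms P_in subspace_H by (simp add: subspace_diff)
  have "inner (P x - p) (P x - p) = inner (x - p) (P x - p) - inner (x - P x) (P x - p)"
    by (simp add: inner_diff_left)
  also have "\<dots> = 0" using assms(2)[OF d] P_orth[OF d] by simp
  finally show ?thesis by simp
qed

lemma P_fix: "x \<in> H \<Longrightarrow> P x = x"
  by (rule P_unique) auto

lemma P_P [simp]: "P (P x) = P x"
  by (simp add: P_fix P_in)

lemma linear_P: "linear P"
proof (rule linearI)
  show "P (x + y) = P x + P y" for x y
  proof (rule P_unique)
    show "P x + P y \<in> H" using P_in subspace_H by (simp add: subspace_add)
    show "inner (x + y - (P x + P y)) z = 0" if "z \<in> H" for z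
      using P_orth[OF that, of x] P_orth[OF that, of y] by (simp add: inner_diff_left inner_add_left)
  qed
  show "P (c *\<^sub>R x) = c *\<^sub>R P x" for c x
  proof (rule P_unique)
    show "c *\<^sub>R P x \<in> H" using P_in subspace_H by (simp add: subspace_scale)
    show "inner (c *\<^sub>R x - c *\<^sub>R P x) z = 0" if "z \<in> H" for z
      using P_orth[OF that, of x] by (simp flip: scaleR_diff_right)
  qed
qed

lemma P_sym: "inner (P x) y = inner x (P y)"
proof -
  have "inner x (P y) = inner (P x) (P y)" for x y
    using P_orth[OF P_in, of x y] by (simp add: inner_diff_left)
  then show ?thesis by (metis inner_commute)
qed

lemma inner_P_self: "inner x (P x) = (norm (P x))\<^sup>2"
  using P_sym[of x "P x"] by (simp add: power2_norm_eq_inner)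

text \<open>The real orthogonal projection onto \<open>i H\<close>.\<close>

definition Q :: "'a \<Rightarrow> 'a" where
  "Q x = - imult (P (imult x))"

lemma P_imult: "P (imult x) = imult (Q x)" and Q_imult: "Q (imult x) = imult (P x)"
  by (simp_all add: Q_def linear_neg[OF linear_P])

lemma linear_Q: "linear Q"
  by (rule linearI)
    (auto simp: Q_def imult_add imult_scaleR linear_add[OF linear_P] linear_scale[OF linear_P])

lemma Q_Q [simp]: "Q (Q x) = Q x"
  by (simp add: Q_def linear_neg[OF linear_P])

lemma Q_sym: "inner (Q x) y = inner x (Q y)"
  by (simp add: Q_def inner_imult_left P_sym)

lemma inner_Q_self: "inner x (Q x) = (norm (Q x))\<^sup>2"
  using Q_sym[of x "Q x"] by (simp add: power2_norm_eq_inner)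

lemmas P_lin = linear_add[OF linear_P] linear_diff[OF linear_P] linear_neg[OF linear_P]
  linear_scale[OF linear_P]
lemmas Q_lin = linear_add[OF linear_Q] linear_diff[OF linear_Q] linear_neg[OF linear_Q]
  linear_scale[OF linear_Q]

text \<open>The symplectic complement of \<open>H\<close>, that is, the real orthogonal complement of \<open>i H\<close>.\<close>

definition Hc :: "'a set" where
  "Hc = {x. Q x = 0}"

lemma Im_cinner_Hc_H: "k \<in> Hc \<Longrightarrow> h \<in> H \<Longrightarrow> Im (cinner k h) = 0"
proof -
  assume k: "k \<in> Hc" and h: "h \<in> H"
  have "inner (imult k) h = - inner k (Q (imult h))"
    using h by (simp add: inner_imult_left Q_imult P_fix)
  also have "\<dots> = 0" using k Q_sym[of k "imult h"] by (simp add: Hc_def)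
  finally show ?thesis by (simp add: Im_cinner)
qed

lemma Im_cinner_H_Hc: "k \<in> Hc \<Longrightarrow> h \<in> H \<Longrightarrow> Im (cinner h k) = 0"
  using Im_cinner_Hc_H[of k h] by (subst cinner_commute) simp

text \<open>A vector orthogonal to the complement and to i times it is fixed by both
  \<open>Q\<close> and \<open>P\<close>, hence lies in H \<inter> i H. Triviality of that
  intersection is thus dual to density for the complement.\<close>

lemma Hc_dense: "closure {k + imult k' | k k'. k \<in> Hc \<and> k' \<in> Hc} = UNIV"
proof (rule dense_subspaceI)
  show "subspace {k + imult k' | k k'. k \<in> Hc \<and> k' \<in> Hc}"
    unfolding subspace_def
  proof (intro conjI ballI allI)
    show "0 \<in> {k + imult k' | k k'. k \<in> Hc \<and> k' \<in> Hc}"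
      by (auto intro!: exI[of _ 0] simp: Hc_def linear_0[OF linear_Q])
    fix x y assume "x \<in> {k + imult k' | k k'. k \<in> Hc \<and> k' \<in> Hc}"
      "y \<in> {k + imult k' | k k'. k \<in> Hc \<and> k' \<in> Hc}"
    then obtain a b c d where "x = a + imult b" "y = c + imult d" "a \<in> Hc" "b \<in> Hc" "c \<in> Hc" "d \<in> Hc"
      by blast
    then show "x + y \<in> {k + imult k' | k k'. k \<in> Hc \<and> k' \<in> Hc}"
      by (intro CollectI exI[of _ "a + c"] exI[of _ "b + d"]) (auto simp: Hc_def Q_lin imult_add)
  next
    fix r x assume "x \<in> {k + imult k' | k k'. k \<in> Hc \<and> k' \<in> Hc}"
    then obtain a b where "x = a + imult b" "a \<in> Hc" "b \<in> Hc" by blast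
    then show "r *\<^sub>R x \<in> {k + imult k' | k k'. k \<in> Hc \<and> k' \<in> Hc}"
      by (intro CollectI exI[of _ "r *\<^sub>R a"] exI[of _ "r *\<^sub>R b"])
         (auto simp: Hc_def Q_lin imult_scaleR scaleR_add_right)
  qed
  fix x assume x: "\<And>y. y \<in> {k + imult k' | k k'. k \<in> Hc \<and> k' \<in> Hc} \<Longrightarrow> inner x y = 0"
  have Hc0: "0 \<in> Hc" by (simp add: Hc_def linear_0[OF linear_Q])
  have "x - Q x \<in> Hc" by (simp add: Hc_def Q_lin)
  then have "inner x (x - Q x) = 0" using Hc0 by (intro x) (force intro: exI[of _ 0])
  then have "inner (x - Q x) (x - Q x) = 0"
    using Q_sym[of x "x - Q x"] by (simp add: inner_diff_left Q_lin)
  then have xQ: "x = Q x" by simp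
  define k where "k = - imult x - Q (- imult x)"
  have "k \<in> Hc" by (simp add: k_def Hc_def Q_lin)
  moreover have "imult k = x - P x"
    by (simp add: k_def imult_diff Q_lin Q_imult)
  ultimately have "inner x (x - P x) = 0" using Hc0 by (intro x) (force intro: exI[of _ 0])
  then have "inner (x - P x) (x - P x) = 0"
    using P_sym[of x "x - P x"] by (simp add: inner_diff_left P_lin)
  then have "x = P x" by simp
  then have "x \<in> H" using P_in by metis
  moreover have "x \<in> imult ` H"
    using xQ P_in[of "imult x"] subspace_neg[OF subspace_H]
    by (metis Q_def imageI imult_minus)
  ultimately show "x = 0" using H_inter by blast
qed

text \<open>In the notation of Rieffel and van Daele, \<open>A = 1 - (P + Q) = (\<Delta> - 1) / (\<Delta> + 1)\<close>, and the
  antilinear \<open>S0 = P - Q\<close> is \<open>J (1 - A\<^sup>2)\<^sup>1\<^sup>/\<^sup>2\<close> with \<open>J\<close> the modular conjugation.\<close>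

definition S0 :: "'a \<Rightarrow> 'a" where "S0 x = P x - Q x"

definition A :: "'a \<Rightarrow> 'a" where "A x = x - P x - Q x"

lemma linear_S0: "linear S0" unfolding S0_def[abs_def] by (rule linear_compose_sub[OF linear_P linear_Q])

lemma linear_A: "linear A"
  unfolding A_def[abs_def] by (intro linear_compose_sub linear_P linear_Q linear_ident)

lemma S0_imult: "S0 (imult x) = - imult (S0 x)"
  by (simp add: S0_def P_imult Q_imult imult_diff)

lemma clinear_A: "clinear A"
  using linear_A by (simp add: clinear_def) (simp add: A_def P_imult Q_imult imult_diff)

lemma S0_A: "S0 (A x) = - A (S0 x)"
  by (simp add: S0_def A_def P_lin Q_lin)

lemma S0_S0: "S0 (S0 x) = x - A (A x)"
  by (simp add: S0_def A_def P_lin Q_lin)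

lemma P_eq: "P x = (1/2) *\<^sub>R (x - A x + S0 x)" and Q_eq: "Q x = (1/2) *\<^sub>R (x - A x - S0 x)"
  by (simp_all add: A_def S0_def scaleR_2[symmetric])

lemma S0_sym: "inner (S0 x) y = inner x (S0 y)"
  by (simp add: S0_def inner_diff_left inner_diff_right P_sym Q_sym)

lemma A_sym: "inner (A x) y = inner x (A y)"
  by (simp add: A_def inner_diff_left inner_diff_right P_sym Q_sym)

text \<open>S0^2 = 1 - A^2 with both operators symmetric; this makes each of them contractive at
  once.\<close>

lemma norm_A_S0: "(norm (A x))\<^sup>2 + (norm (S0 x))\<^sup>2 = (norm x)\<^sup>2"
  using A_sym[of x "A x"] S0_sym[of x "S0 x"]
  by (simp add: power2_norm_eq_inner S0_S0 inner_diff_right)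

lemma contraction_A: "contraction A"
  unfolding contraction_def
proof (intro conjI allI clinear_A)
  fix x
  have "(norm (A x))\<^sup>2 \<le> (norm x)\<^sup>2" using norm_A_S0[of x] zero_le_power2[of "norm (S0 x)"] by linarith
  then show "norm (A x) \<le> norm x" by (rule power2_le_imp_le) simp
qed

lemma bounded_linear_A: "bounded_linear A"
  using contraction_A linear_A by (intro bounded_linear_intro[where K = 1])
    (auto simp: contraction_def linear_add linear_scale)

lemma bounded_linear_S0: "bounded_linear S0"
proof (rule bounded_linear_intro[where K = 1])
  fix x
  have "(norm (S0 x))\<^sup>2 \<le> (norm x)\<^sup>2" using norm_A_S0[of x] zero_le_power2[of "norm (A x)"] by linarith
  then show "norm (S0 x) \<le> norm x * 1" using power2_le_imp_le by fastforce
qed (auto simp: linear_add[OF linear_S0] linear_scale[OF linear_S0])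

lemma bounded_linear_P: "bounded_linear P"
  unfolding P_eq[abs_def]
  by (intro bounded_linear_const_scaleR bounded_linear_add bounded_linear_sub bounded_linear_ident
      bounded_linear_A bounded_linear_S0)

text \<open>Pairing (1 - A) x = P x + Q x with x gives P x = Q x = 0, so x is orthogonal to H + i H:
  density makes 1 - A injective.\<close>

lemma A_fix: "A x = x \<Longrightarrow> x = 0"
proof -
  assume fx: "A x = x"
  have "P x + Q x = x - A x" by (simp add: A_def)
  then have "inner x (P x) + inner x (Q x) = 0"
    by (simp add: fx flip: inner_add_right)
  then have "(norm (P x))\<^sup>2 + (norm (Q x))\<^sup>2 = 0" by (simp add: inner_P_self inner_Q_self)
  then have PQ: "P x = 0" "Q x = 0" by (simp_all add: sum_power2_eq_zero_iff)
  have "inner x y = 0" for y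
  proof (rule bounded_linear_eq_on_dense[OF bounded_linear_inner_right bounded_linear_zero H_dense])
    fix z assume "z \<in> {h + imult k | h k. h \<in> H \<and> k \<in> H}"
    then obtain h k where "z = h + imult k" "h \<in> H" "k \<in> H" by blast
    then have z: "z = P h + Q (imult k)" by (simp add: Q_imult P_fix)
    show "inner x z = 0" unfolding z inner_add_right using PQ P_sym[of x h] Q_sym[of x "imult k"] by simp
  qed
  from this[of x] show "x = 0" by simp
qed

text \<open>Here 2 x = P x + Q x, so neither projection can shorten x, and x lies in H \<inter> i H:
  the trivial intersection makes 1 + A injective.\<close>

lemma A_neg_fix: "A x = - x \<Longrightarrow> x = 0"
proof -
  assume fx: "A x = - x"
  have "P x + Q x = x - A x" by (simp add: A_def)
  then have "2 *\<^sub>R x = P x + Q x" by (simp add: fx scaleR_2)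
  then have "inner x (2 *\<^sub>R x) = (norm (P x))\<^sup>2 + (norm (Q x))\<^sup>2"
    by (simp add: inner_add_right inner_P_self inner_Q_self)
  then have s: "2 * (norm x)\<^sup>2 = (norm (P x))\<^sup>2 + (norm (Q x))\<^sup>2" by (simp add: power2_norm_eq_inner)
  have p: "(norm (x - P x))\<^sup>2 = (norm x)\<^sup>2 - (norm (P x))\<^sup>2"
    using inner_P_self[of x] by (simp add: power2_norm_eq_inner inner_diff_left inner_diff_right inner_commute)
  have q: "(norm (x - Q x))\<^sup>2 = (norm x)\<^sup>2 - (norm (Q x))\<^sup>2"
    using inner_Q_self[of x] by (simp add: power2_norm_eq_inner inner_diff_left inner_diff_right inner_commute)
  have "(norm (x - P x))\<^sup>2 + (norm (x - Q x))\<^sup>2 = 0" using p q s by linarith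
  then have "x = P x" "x = Q x" by (simp_all add: sum_power2_eq_zero_iff)
  then have "x \<in> H" "x \<in> imult ` H"
    using P_in[of x] P_in[of "imult x"] subspace_neg[OF subspace_H]
    by (metis, metis Q_def imageI imult_minus)
  then show "x = 0" using H_inter by blast
qed

section \<open>Complex powers of 1 + A and 1 - A\<close>

abbreviation "BA \<equiv> binop A"
abbreviation "BB \<equiv> binop (\<lambda>x. - A x)"

text \<open>\<open>M a b\<close> stands for \<open>(1 + A)\<^sup>a (1 - A)\<^sup>b\<close>.\<close>

definition M :: "complex \<Rightarrow> complex \<Rightarrow> 'a \<Rightarrow> 'a" where
  "M a b x = BA a (BB b x)"

definition adm :: "complex \<Rightarrow> bool" where
  "adm a \<longleftrightarrow> summable (\<lambda>n. cmod (a gchoose n))"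

lemma adm_1 [simp]: "adm 1" by (simp add: adm_def summable_gbinomial_1)
lemma adm_ge2: "2 \<le> Re a \<Longrightarrow> adm a" by (simp add: adm_def summable_gbinomial)
lemma adm_cnj [simp]: "adm (cnj a) = adm a"
  unfolding adm_def cnj_gbinomial[symmetric] by simp

lemmas contraction_A' = contraction_uminus[OF contraction_A]

lemma BA_add: "adm a \<Longrightarrow> adm b \<Longrightarrow> BA a (BA b x) = BA (a + b) x"
  and BB_add: "adm a \<Longrightarrow> adm b \<Longrightarrow> BB a (BB b x) = BB (a + b) x"
  using binop_add contraction_A contraction_A' unfolding adm_def by auto

lemma clinear_BA: "adm a \<Longrightarrow> clinear (BA a)" and clinear_BB: "adm a \<Longrightarrow> clinear (BB a)"
  using clinear_opseries contraction_A contraction_A' unfolding adm_def binop_def by auto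

lemma bounded_linear_BA: "adm a \<Longrightarrow> bounded_linear (BA a)"
  and bounded_linear_BB: "adm a \<Longrightarrow> bounded_linear (BB a)"
  using bounded_linear_opseries contraction_A contraction_A' unfolding adm_def binop_def by auto

lemma BA_comm:
  assumes "adm a" "bounded_linear T" "clinear T" "\<And>x. T (A x) = A (T x)"
  shows "T (BA a x) = BA a (T x)"
  unfolding binop_def
  by (rule opseries_intertwine[OF contraction_A assms(1)[unfolded adm_def] contraction_A assms(2),
        where \<sigma> = "\<lambda>x. x"]) (simp_all add: assms(4) clinearD[OF assms(3)])

lemma BB_comm:
  assumes "adm a" "bounded_linear T" "clinear T" "\<And>x. T (A x) = A (T x)"
  shows "T (BB a x) = BB a (T x)"
  unfolding binop_def
  by (rule opseries_intertwine[OF contraction_A' assms(1)[unfolded adm_def] contraction_A' assms(2),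
        where \<sigma> = "\<lambda>x. x"]) (simp_all add: assms(4) clinearD[OF assms(3)])

lemma A_BA: "adm a \<Longrightarrow> A (BA a x) = BA a (A x)" and A_BB: "adm a \<Longrightarrow> A (BB a x) = BB a (A x)"
  using BA_comm[OF _ bounded_linear_A clinear_A] BB_comm[OF _ bounded_linear_A clinear_A] by auto

lemma BB_BA: "adm a \<Longrightarrow> adm b \<Longrightarrow> BB b (BA a x) = BA a (BB b x)"
  by (rule BA_comm[OF _ bounded_linear_BB clinear_BB]) (auto simp: A_BB)

lemma S0_cscale: "S0 (c *\<^sub>C x) = cnj c *\<^sub>C S0 x"
  by (simp add: cscale_def linear_add[OF linear_S0] linear_scale[OF linear_S0] S0_imult)

text \<open>\<open>S0\<close> is antilinear and anticommutes with \<open>A\<close>: it conjugates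
  the exponent and exchanges 1 + A with 1 - A.\<close>

lemma S0_BA: "adm a \<Longrightarrow> S0 (BA a x) = BB (cnj a) (S0 x)"
  using opseries_intertwine[OF contraction_A _ contraction_A' bounded_linear_S0, where c = "\<lambda>n. a gchoose n" and \<sigma> = cnj and x = x]
  unfolding binop_def adm_def by (auto simp: S0_A S0_cscale cnj_gbinomial)

lemma S0_BB: "adm a \<Longrightarrow> S0 (BB a x) = BA (cnj a) (S0 x)"
  using opseries_intertwine[OF contraction_A' _ contraction_A bounded_linear_S0, where c = "\<lambda>n. a gchoose n" and \<sigma> = cnj and x = x]
  unfolding binop_def adm_def by (auto simp: S0_A S0_cscale cnj_gbinomial linear_neg[OF linear_S0])

lemma M_M: "adm a \<Longrightarrow> adm b \<Longrightarrow> adm c \<Longrightarrow> adm d \<Longrightarrow> M a b (M c d x) = M (a + c) (b + d) x"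
  by (simp add: M_def BB_BA BA_add BB_add flip: BB_add)

lemma M_adjoint:
  assumes "adm a" "adm b"
  shows "cinner (M a b x) y = cinner x (M (cnj a) (cnj b) y)"
proof -
  have "cinner (BA a x) y = cinner x (BA (cnj a) y)" for x y
    using opseries_adjoint[OF contraction_A _ A_sym] assms unfolding binop_def adm_def
    by (simp add: cnj_gbinomial)
  moreover have "cinner (BB b x) y = cinner x (BB (cnj b) y)" for x y
    using opseries_adjoint[OF contraction_A'] A_sym assms unfolding binop_def adm_def
    by (simp add: cnj_gbinomial)
  ultimately show ?thesis using assms by (simp add: M_def BB_BA)
qed

lemma bounded_linear_M: "adm a \<Longrightarrow> adm b \<Longrightarrow> bounded_linear (M a b)"
  unfolding M_def[abs_def] by (rule bounded_linear_compose[OF bounded_linear_BA bounded_linear_BB])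

lemma clinear_M: "adm a \<Longrightarrow> adm b \<Longrightarrow> clinear (M a b)"
  using clinear_BA[of a] clinear_BB[of b] linear_compose[of "BB b" "BA a"]
  by (auto simp: clinear_def M_def[abs_def] o_def)

lemma S0_M: "adm a \<Longrightarrow> adm b \<Longrightarrow> S0 (M a b x) = M (cnj b) (cnj a) (S0 x)"
  by (simp add: M_def S0_BA S0_BB BB_BA)

lemma A_M: "adm a \<Longrightarrow> adm b \<Longrightarrow> A (M a b x) = M a b (A x)"
  by (simp add: M_def A_BA A_BB)

text \<open>Since \<open>\<Delta> = (1 + A) / (1 - A)\<close>, \<open>q z\<close> is \<open>\<Delta>\<close> to the power \<open>- i z\<close>, regularised by the
  injective factor \<open>R = (1 - A\<^sup>2)\<^sup>3\<close> so that the binomial series converge for \<open>\<bar>Im z\<bar> \<le> 1\<close>.\<close>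

definition q :: "complex \<Rightarrow> 'a \<Rightarrow> 'a" where
  "q z = M (3 - \<i> * z) (3 + \<i> * z)"

definition R :: "'a \<Rightarrow> 'a" where "R = M 3 3"

text \<open>The square root of 1 - A^2 contained in \<open>S0\<close> is already part of the
  regularisation: with exponent 5/2 left for \<open>G\<close>, \<open>S0\<close> after
  \<open>G\<close> is J (1 - A^2)^3, that is, \<open>J\<close> after \<open>R\<close>.\<close>

definition G :: "'a \<Rightarrow> 'a" where "G = M (5/2) (5/2)"

lemma adm_q: "\<bar>Im z\<bar> \<le> 1 \<Longrightarrow> adm (3 - \<i> * z)" "\<bar>Im z\<bar> \<le> 1 \<Longrightarrow> adm (3 + \<i> * z)"
  by (auto intro!: adm_ge2)

lemma adm_num: "adm 3" "adm (5/2)" "adm (7/2)" "adm 2" "adm 6"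
  by (auto intro!: adm_ge2)

lemma q_0: "q 0 = R" by (simp add: q_def R_def)

lemma q_q: "\<bar>Im z\<bar> \<le> 1 \<Longrightarrow> \<bar>Im w\<bar> \<le> 1 \<Longrightarrow>
    q z (q w x) = M (6 - \<i> * (z + w)) (6 + \<i> * (z + w)) x"
  unfolding q_def by (subst M_M) (simp_all add: adm_q, simp add: algebra_simps)

lemma q_commute: "\<bar>Im z\<bar> \<le> 1 \<Longrightarrow> \<bar>Im w\<bar> \<le> 1 \<Longrightarrow> q z (q w x) = q w (q z x)"
  by (simp add: q_q add.commute)

lemma q_adjoint: "\<bar>Im z\<bar> \<le> 1 \<Longrightarrow> cinner (q z x) y = cinner x (q (- cnj z) y)"
  by (simp add: q_def M_adjoint adm_q)

lemma R_adjoint: "cinner (R x) y = cinner x (R y)"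
  using q_adjoint[of 0 x y] by (simp add: q_0)

lemma bounded_linear_q: "\<bar>Im z\<bar> \<le> 1 \<Longrightarrow> bounded_linear (q z)"
  and clinear_q: "\<bar>Im z\<bar> \<le> 1 \<Longrightarrow> clinear (q z)"
  by (simp_all add: q_def bounded_linear_M clinear_M adm_q)

lemma bounded_linear_R: "bounded_linear R" and clinear_R: "clinear R"
  using bounded_linear_q[of 0] clinear_q[of 0] by (simp_all add: q_0)

lemma clinear_G: "clinear G"
  unfolding G_def by (intro clinear_M adm_num)

lemma q_S0: "S0 (q (of_real t) x) = q (of_real t) (S0 x)"
  by (simp add: q_def S0_M adm_q)

lemma G_S0: "S0 (G x) = G (S0 x)"
  by (simp add: G_def S0_M adm_num)

lemma q_P: "P (q (of_real t) x) = q (of_real t) (P x)"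
  unfolding P_eq clinearD[OF clinear_q[of "of_real t", simplified]] q_S0
  by (simp add: q_def A_M adm_q)

lemma G_P: "P (G x) = G (P x)" and G_Q: "Q (G x) = G (Q x)"
  unfolding P_eq Q_eq clinearD[OF clinear_G] G_S0 by (simp_all add: G_def A_M adm_num)

text \<open>\<open>R\<close> splits into three factors 1 + A and three factors 1 - A, each of them
  injective.\<close>

lemma R_inj: "R x = 0 \<Longrightarrow> x = 0"
proof -
  have BA1: "y = 0" if "BA 1 y = 0" for y
    using that A_neg_fix[of y] by (simp add: binop_1 add_eq_0_iff)
  have BB1: "y = 0" if "BB 1 y = 0" for y
  proof -
    have "y - A y = 0" using that by (simp add: binop_1)
    then have "A y = y" by (metis right_minus_eq)
    then show ?thesis by (rule A_fix)
  qed
  have "BA 3 y = BA 1 (BA 1 (BA 1 y))" "BB 3 y = BB 1 (BB 1 (BB 1 y))" for y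
    using BA_add[of 1 2 y] BA_add[of 1 1 y] BB_add[of 1 2 y] BB_add[of 1 1 y]
    by (simp_all add: adm_num)
  moreover assume "R x = 0"
  ultimately have "BA 1 (BA 1 (BA 1 (BB 1 (BB 1 (BB 1 x))))) = 0" by (simp add: R_def M_def)
  then show "x = 0" by (rule BB1[OF BB1[OF BB1[OF BA1[OF BA1[OF BA1]]]]])
qed

lemma R_eq_iff: "R x = R y \<longleftrightarrow> x = y"
  using R_inj[of "x - y"] by (auto simp: clinearD[OF clinear_R])

lemma R_dense: "closure (range R) = UNIV"
proof (rule dense_subspaceI)
  show "subspace (range R)"
    using clinearD(1)[OF clinear_R] subspace_UNIV by (rule linear_subspace_image)
  fix x assume x: "\<And>y. y \<in> range R \<Longrightarrow> inner x y = 0"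
  have "cinner (R x) (R x) = cinner x (R (R x))" by (rule R_adjoint)
  then have "inner (R x) (R x) = inner x (R (R x))" by (metis Re_cinner)
  then show "x = 0" using x[of "R (R x)"] R_inj by simp
qed

text \<open>The imaginary parts of the exponents cancel between q (t) and its adjoint q (- t), whose
  product is R^2; so q (t) composed with the inverse of \<open>R\<close> is isometric.\<close>

lemma norm_q: "norm (q (of_real t) x) = norm (R x)"
proof -
  have "cinner (q (of_real t) x) (q (of_real t) x) = cinner x (R (R x))"
    unfolding q_0[symmetric] by (simp add: q_adjoint q_q)
  also have "\<dots> = cinner (R x) (R x)" by (rule R_adjoint[symmetric])
  finally have "(norm (q (of_real t) x))\<^sup>2 = (norm (R x))\<^sup>2"
    unfolding cinner_self by (metis of_real_eq_iff)
  then show ?thesis by simp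
qed

text \<open>\<open>D t\<close> is the modular unitary, \<open>\<Delta>\<close> to the power \<open>- i t\<close>.\<close>

definition D :: "real \<Rightarrow> 'a \<Rightarrow> 'a" where
  "D t = (SOME D. linear D \<and> (\<forall>x. norm (D x) = norm x) \<and> (\<forall>x. D (R x) = q (of_real t) x))"

lemma linear_D: "linear (D t)" and norm_D [simp]: "norm (D t x) = norm x"
  and D_R: "D t (R x) = q (of_real t) x"
proof -
  have "\<exists>D. linear D \<and> (\<forall>x. norm (D x) = norm x) \<and> (\<forall>x. D (R x) = q (of_real t) x)"
    by (rule isometric_extension[OF clinearD(1)[OF clinear_R]
          clinearD(1)[OF clinear_q[of "of_real t", simplified]] R_dense norm_q]) blast
  from someI_ex[OF this] show "linear (D t)" "norm (D t x) = norm x" "D t (R x) = q (of_real t) x"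
    unfolding D_def by auto
qed

lemma bounded_linear_D: "bounded_linear (D t)"
  by (rule isometry_bounded_linear[OF linear_D norm_D])

lemma D_comm:
  assumes "bounded_linear T" "bounded_linear T'" "\<And>x. T (R x) = R (T' x)"
    "\<And>x. T (q (of_real t) x) = q (of_real t) (T' x)"
  shows "T (D t x) = D t (T x)"
proof (rule bounded_linear_eq_on_dense[OF bounded_linear_compose[OF assms(1) bounded_linear_D]
      bounded_linear_compose[OF bounded_linear_D assms(1)] R_dense])
  fix y assume "y \<in> range R"
  then show "T (D t y) = D t (T y)" using assms by (auto simp: D_R)
qed

lemma clinear_D: "clinear (D t)"
  unfolding clinear_def
  using linear_D D_comm[OF bounded_linear_imult bounded_linear_imult, of t]
    clinearD(2)[OF clinear_R] clinearD(2)[OF clinear_q[of "of_real t"]] by simp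

lemma D_P: "D t (P x) = P (D t x)"
  using D_comm[OF bounded_linear_P bounded_linear_P, of t] q_P[of 0] q_P[of t] by (simp add: q_0)

lemma D_Q: "D t (Q x) = Q (D t x)"
  using D_P clinearD[OF clinear_D] by (simp add: Q_def)

lemma D_H: "x \<in> H \<Longrightarrow> D t x \<in> H"
  by (metis D_P P_fix P_in)

lemma D_Hc: "x \<in> Hc \<Longrightarrow> D t x \<in> Hc"
  unfolding Hc_def using D_Q[of t x] clinearD(6)[OF clinear_D] by simp

text \<open>Real translations of z act through the modular unitaries, so that what holds at one
  point of a horizontal line extends along it; this gives the values on the edges of the strip and a
  bound that does not depend on Re z.\<close>

lemma q_add_real: "\<bar>Im z\<bar> \<le> 1 \<Longrightarrow> q (z + of_real t) x = q z (D t x)"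
proof -
  assume z: "\<bar>Im z\<bar> \<le> 1"
  then have z': "\<bar>Im (z + of_real t)\<bar> \<le> 1" by simp
  show ?thesis
  proof (rule bounded_linear_eq_on_dense[OF bounded_linear_q[OF z']
        bounded_linear_compose[OF bounded_linear_q[OF z] bounded_linear_D] R_dense])
    fix y assume "y \<in> range R"
    then obtain u where "y = q 0 u" by (auto simp: q_0)
    then show "q (z + of_real t) y = q z (D t y)"
      using z D_R[of t u] by (simp add: q_q flip: q_0)
  qed
qed

lemma D_inverse: "D t (D (- t) x) = x"
proof -
  have comm: "R (D t y) = D t (R y)" for y
    using q_commute[of 0 "of_real t"] by (intro D_comm[OF bounded_linear_R bounded_linear_R]) (auto simp: q_0)
  show ?thesis
  proof (rule bounded_linear_eq_on_dense[OF bounded_linear_compose[OF bounded_linear_D bounded_linear_D]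
        bounded_linear_ident R_dense])
    fix y assume "y \<in> range R"
    then obtain u where y: "y = R u" by auto
    have "R (D t (D (- t) y)) = q (of_real t) (q (- of_real t) u)"
      unfolding y comm D_R by (simp add: comm D_R flip: comm)
    also have "\<dots> = R y" unfolding y q_0[symmetric] by (simp add: q_q)
    finally show "D t (D (- t) y) = y" by (simp add: R_eq_iff)
  qed
qed

lemma D_cinner: "cinner (D t x) (D t y) = cinner x y"
  by (rule isometry_cinner[OF clinear_D norm_D])

subsection \<open>The modular conjugation\<close>

text \<open>Since S0^2 = 1 - A^2 and G = (1 - A^2)^(5/2), both squared norms are the matrix element
  of (1 - A^2)^6 at x.\<close>

lemma norm_S0_G: "norm (S0 (G x)) = norm (R x)"
proof -
  have "S0 (S0 (G x)) = BA 1 (BB 1 (G x))"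
    by (simp add: S0_S0 binop_1 linear_diff[OF linear_A])
  also have "\<dots> = M 1 1 (G x)" by (simp add: M_def)
  also have "\<dots> = M (7/2) (7/2) x" by (simp add: G_def M_M adm_num)
  finally have *: "S0 (S0 (G x)) = M (7/2) (7/2) x" .
  have "inner (S0 (G x)) (S0 (G x)) = Re (cinner (G x) (M (7/2) (7/2) x))"
    by (simp add: S0_sym * )
  also have "cinner (G x) (M (7/2) (7/2) x) = cinner x (R (R x))"
    by (simp add: G_def R_def M_adjoint M_M adm_num)
  also have "\<dots> = cinner (R x) (R x)" by (rule R_adjoint[symmetric])
  finally show ?thesis by (simp add: norm_eq_sqrt_inner)
qed

definition J :: "'a \<Rightarrow> 'a" where
  "J = (SOME J. linear J \<and> (\<forall>x. norm (J x) = norm x) \<and> (\<forall>x. J (R x) = S0 (G x)))"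

lemma linear_J: "linear J" and norm_J [simp]: "norm (J x) = norm x"
  and J_R: "J (R x) = S0 (G x)"
proof -
  have "linear (\<lambda>x. S0 (G x))"
    using linear_compose[OF clinearD(1)[OF clinear_G] linear_S0] by (simp add: o_def)
  then have "\<exists>J. linear J \<and> (\<forall>x. norm (J x) = norm x) \<and> (\<forall>x. J (R x) = S0 (G x))"
    by (rule isometric_extension[OF clinearD(1)[OF clinear_R] _ R_dense norm_S0_G]) blast
  from someI_ex[OF this] show "linear J" "norm (J x) = norm x" "J (R x) = S0 (G x)"
    unfolding J_def by auto
qed

lemma bounded_linear_J: "bounded_linear J"
  by (rule isometry_bounded_linear[OF linear_J norm_J])

lemma J_imult: "J (imult x) = - imult (J x)"
proof (rule bounded_linear_eq_on_dense[OF bounded_linear_compose[OF bounded_linear_J bounded_linear_imult]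
      bounded_linear_minus[OF bounded_linear_compose[OF bounded_linear_imult bounded_linear_J]] R_dense])
  fix y assume "y \<in> range R"
  then show "J (imult y) = - imult (J y)"
    by (auto simp: J_R S0_imult clinearD[OF clinear_G] simp flip: clinearD(2)[OF clinear_R])
qed

lemma J_R_commute: "J (R x) = R (J x)"
proof (rule bounded_linear_eq_on_dense[OF bounded_linear_compose[OF bounded_linear_J bounded_linear_R]
      bounded_linear_compose[OF bounded_linear_R bounded_linear_J] R_dense])
  fix y assume "y \<in> range R"
  then obtain u where y: "y = R u" by auto
  have "G (R u) = R (G u)" by (simp add: G_def R_def M_M adm_num add.commute)
  then show "J (R y) = R (J y)"
    unfolding y J_R using q_S0[of 0 "G u"] by (simp add: q_0)
qed

lemma q_half: "q (\<i> / 2) x = BA 1 (G x)" and q_minus_half: "q (- (\<i> / 2)) x = BB 1 (G x)"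
proof -
  have "BA 1 (M (5/2) (5/2) x) = M (7/2) (5/2) x" "BB 1 (M (5/2) (5/2) x) = M (5/2) (7/2) x"
    by (simp_all add: M_def BB_BA BA_add BB_add adm_num)
  then show "q (\<i> / 2) x = BA 1 (G x)" "q (- (\<i> / 2)) x = BB 1 (G x)"
    by (simp_all add: q_def G_def)
qed

text \<open>q (i/2) is 1 + A after \<open>G\<close>, and \<open>G\<close> preserves H. On H both 1 +
  A = 2 - P - Q and S0 = P - Q reduce to 1 - Q.\<close>

lemma q_half_H: "x \<in> H \<Longrightarrow> q (\<i> / 2) x = J (R x)"
proof -
  assume "x \<in> H"
  then have "P (G x) = G x" by (simp add: G_P P_fix)
  then show ?thesis by (simp add: q_half J_R binop_1 S0_def A_def)
qed

text \<open>On the kernel of \<open>Q\<close>, which \<open>G\<close> preserves, both 1 - A = P + Q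
  and S0 = P - Q reduce to P.\<close>

lemma q_minus_half_Hc: "x \<in> Hc \<Longrightarrow> q (- (\<i> / 2)) x = J (R x)"
proof -
  assume "x \<in> Hc"
  then have "Q (G x) = 0" by (simp add: G_Q Hc_def clinearD(6)[OF clinear_G])
  then show ?thesis by (simp add: q_minus_half J_R binop_1 S0_def A_def)
qed

lemma J_R_H: "x \<in> H \<Longrightarrow> J (R x) \<in> Hc"
  using P_fix by (simp add: J_R Hc_def S0_def G_P Q_lin)

lemma J_R_Hc: "x \<in> Hc \<Longrightarrow> J (R x) \<in> H"
  using P_in by (simp add: J_R S0_def Hc_def G_Q clinearD(6)[OF clinear_G])

text \<open>On \<open>H\<close> the operators \<open>\<Delta>\<^sup>1\<^sup>/\<^sup>2\<close> and \<open>J\<close> agree, and on \<open>Hc\<close> so do \<open>\<Delta>\<close> to the power \<open>- 1/2\<close> and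
  \<open>J\<close>; as \<open>V\<close> preserves \<open>H\<close>, conjugating it by \<open>\<Delta>\<^sup>1\<^sup>/\<^sup>2\<close> therefore gives \<open>J V J\<close>.\<close>

lemma q_half_sandwich:
  assumes V: "bounded_linear V" "clinear V" "V ` H \<subseteq> H"
  shows "cinner (q (\<i> / 2) x) (V (q (- (\<i> / 2)) y)) = cinner (R x) (J (V (J (R y))))"
proof (rule bounded_linear_eq_on_dense[where
      f = "\<lambda>y. cinner (q (\<i> / 2) x) (V (q (- (\<i> / 2)) y))" and
      g = "\<lambda>y. cinner (R x) (J (V (J (R y))))", OF _ _ Hc_dense])
  have bq: "bounded_linear (q (- (\<i> / 2)))" by (rule bounded_linear_q) simp
  note lin = clinearD[OF V(2)] clinearD[OF clinear_q[of "- (\<i> / 2)", simplified]]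
  note bci = bounded_bilinear.bounded_linear_right[OF bounded_bilinear_cinner]
  show "bounded_linear (\<lambda>y. cinner (q (\<i> / 2) x) (V (q (- (\<i> / 2)) y)))"
    by (rule bounded_linear_compose[OF bci bounded_linear_compose[OF V(1) bq]])
  show "bounded_linear (\<lambda>y. cinner (R x) (J (V (J (R y)))))"
    by (intro bounded_linear_compose[OF bci] bounded_linear_compose[OF bounded_linear_J]
        bounded_linear_compose[OF V(1)] bounded_linear_R)
  \<comment> \<open>For k in the complement, q (- i/2) k = J R k lies in H, where \<open>V\<close>
    keeps it; there the self-adjoint q (i/2), moved to the right-hand slot, again acts as
    \<open>J\<close> after \<open>R\<close>.\<close>
  have *: "cinner (q (\<i> / 2) x) (V (q (- (\<i> / 2)) k)) = cinner (R x) (J (V (J (R k))))" if k: "k \<in> Hc" for k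
  proof -
    have l: "V (J (R k)) \<in> H" using J_R_Hc[OF k] V(3) by auto
    have "cinner (q (\<i> / 2) x) (V (q (- (\<i> / 2)) k)) = cinner (q (\<i> / 2) x) (V (J (R k)))"
      using q_minus_half_Hc[OF k] by simp
    also have "\<dots> = cinner x (q (\<i> / 2) (V (J (R k))))"
      by (subst q_adjoint) auto
    also have "\<dots> = cinner x (R (J (V (J (R k)))))"
      using q_half_H[OF l] by (simp add: J_R_commute)
    finally show ?thesis by (simp add: R_adjoint)
  qed
  fix y assume "y \<in> {k + imult k' | k k'. k \<in> Hc \<and> k' \<in> Hc}"
  then obtain k k' where y: "y = k + imult k'" and k: "k \<in> Hc" "k' \<in> Hc" by blast
  have "cinner (q (\<i> / 2) x) (V (q (- (\<i> / 2)) y)) =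
      cinner (q (\<i> / 2) x) (V (q (- (\<i> / 2)) k)) + \<i> * cinner (q (\<i> / 2) x) (V (q (- (\<i> / 2)) k'))"
    unfolding y by (simp add: lin cinner_add_right cinner_imult_right)
  also have "\<dots> = cinner (R x) (J (V (J (R y))))"
    unfolding *[OF k(1)] *[OF k(2)] y
    by (simp add: clinearD(4)[OF clinear_R] clinearD(2)[OF clinear_R] linear_add[OF linear_J]
        J_imult lin linear_neg[OF linear_J] linear_diff[OF linear_J] cinner_add_right cinner_imult_right)
  finally show "cinner (q (\<i> / 2) x) (V (q (- (\<i> / 2)) y)) = cinner (R x) (J (V (J (R y))))" .
qed

text \<open>Both factors of \<open>q\<close> depend on z. Moving the power of 1 + A to the other
  slot makes the matrix element an inner product of two weakly holomorphic vectors.\<close>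

lemma wholo_q: "wholo (\<lambda>z. q z x) {z. \<bar>Im z\<bar> < 1}"
proof (rule wholoI)
  fix y
  have X: "wholo (\<lambda>z. BB (3 + \<i> * z) x) {z. \<bar>Im z\<bar> < 1}"
    by (rule wholo_compose[OF wholo_binop[OF contraction_A'] _ _ open_abs_Im_less])
       (auto intro!: holomorphic_intros)
  have K: "wholo (\<lambda>z. BA (3 + \<i> * z) y) (cnj ` {z. \<bar>Im z\<bar> < 1})"
  proof (rule wholo_subset[OF wholo_compose[OF wholo_binop[OF contraction_A] _ _ open_abs_Im_less]])
    show "(\<lambda>z. 3 + \<i> * z) holomorphic_on {z. \<bar>Im z\<bar> < 1}" by (intro holomorphic_intros)
  qed auto
  have "(\<lambda>z. cinner (BA (3 + \<i> * cnj z) y) (BB (3 + \<i> * z) x)) holomorphic_on {z. \<bar>Im z\<bar> < 1}"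
    by (rule holomorphic_cinner[OF X K open_abs_Im_less])
  moreover have "cinner y (q z x) = cinner (BA (3 + \<i> * cnj z) y) (BB (3 + \<i> * z) x)" if "\<bar>Im z\<bar> < 1" for z
  proof -
    have "adm (3 + \<i> * cnj z)" using that by (intro adm_ge2) auto
    then have "cinner (BA (3 + \<i> * cnj z) y) (BB (3 + \<i> * z) x) = cinner y (BA (cnj (3 + \<i> * cnj z)) (BB (3 + \<i> * z) x))"
      using opseries_adjoint[OF contraction_A _ A_sym] unfolding binop_def adm_def
      by (simp add: cnj_gbinomial)
    then show ?thesis by (simp add: q_def M_def)
  qed
  ultimately show "(\<lambda>z. cinner y (q z x)) holomorphic_on {z. \<bar>Im z\<bar> < 1}"
    by (elim holomorphic_transform) simp
next
  fix z assume z: "z \<in> {z. \<bar>Im z\<bar> < 1}"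
  obtain e where e: "e > 0" "ball z e \<subseteq> {z. \<bar>Im z\<bar> < 1}" using openE[OF open_abs_Im_less z] by blast
  define r where "r = 3 + (cmod z + e)"
  obtain K1 where K1: "K1 \<ge> 0" "\<And>a x. 2 \<le> Re a \<Longrightarrow> cmod a \<le> r \<Longrightarrow> norm (BA a x) \<le> K1 * norm x"
    by (rule binop_bounded[OF contraction_A, of r]) blast
  obtain K2 where K2: "K2 \<ge> 0" "\<And>a x. 2 \<le> Re a \<Longrightarrow> cmod a \<le> r \<Longrightarrow> norm (BB a x) \<le> K2 * norm x"
    by (rule binop_bounded[OF contraction_A', of r]) blast
  have "norm (q w x) \<le> K1 * (K2 * norm x)" if w: "w \<in> ball z e" for w
  proof -
    have im: "\<bar>Im w\<bar> < 1" using w e by auto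
    have "cmod w \<le> cmod z + e" using w norm_triangle_sub[of w z] by (simp add: dist_norm norm_minus_commute)
    then have c: "cmod (3 - \<i> * w) \<le> r" "cmod (3 + \<i> * w) \<le> r"
      using norm_triangle_ineq4[of 3 "\<i> * w"] norm_triangle_ineq[of 3 "\<i> * w"] by (auto simp: r_def norm_mult)
    have "norm (q w x) \<le> K1 * norm (BB (3 + \<i> * w) x)"
      unfolding q_def M_def using im c by (intro K1) auto
    also have "\<dots> \<le> K1 * (K2 * norm x)"
      using im c K1(1) by (intro mult_left_mono K2) auto
    finally show ?thesis .
  qed
  then show "\<exists>e>0. \<exists>M. \<forall>w\<in>ball z e. norm (q w x) \<le> M" using e(1) by blast
qed

text \<open>The binomial bounds are uniform only on bounded sets of exponents. Absorbing Re z in the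
  isometry \<open>D\<close> leaves z on the imaginary axis, where both exponents lie between 2 and
  4.\<close>

lemma q_bounded:
  obtains K where "K \<ge> 0" "\<And>z x. \<bar>Im z\<bar> \<le> 1 \<Longrightarrow> norm (q z x) \<le> K * norm x"
proof -
  obtain K1 where K1: "K1 \<ge> 0" "\<And>a x. 2 \<le> Re a \<Longrightarrow> cmod a \<le> 4 \<Longrightarrow> norm (BA a x) \<le> K1 * norm x"
    by (rule binop_bounded[OF contraction_A, of 4]) blast
  obtain K2 where K2: "K2 \<ge> 0" "\<And>a x. 2 \<le> Re a \<Longrightarrow> cmod a \<le> 4 \<Longrightarrow> norm (BB a x) \<le> K2 * norm x"
    by (rule binop_bounded[OF contraction_A', of 4]) blast
  have "norm (q z x) \<le> K1 * K2 * norm x" if z: "\<bar>Im z\<bar> \<le> 1" for z x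
  proof -
    define w where "w = \<i> * of_real (Im z)"
    have w: "\<bar>Im w\<bar> \<le> 1" "3 - \<i> * w = of_real (3 + Im z)" "3 + \<i> * w = of_real (3 - Im z)"
      using z by (auto simp: w_def complex_eq_iff)
    have "q z x = q w (D (Re z) x)"
      using q_add_real[OF w(1), of "Re z" x] by (simp add: w_def) (metis add.commute complex_eq)
    also have "norm \<dots> \<le> K1 * norm (BB (3 + \<i> * w) (D (Re z) x))"
      unfolding q_def M_def w using z by (intro K1) (auto simp del: of_real_add of_real_diff)
    also have "\<dots> \<le> K1 * (K2 * norm (D (Re z) x))"
      unfolding w using K1(1) z by (intro mult_left_mono K2) (auto simp del: of_real_add of_real_diff)
    finally show ?thesis by (simp add: mult.assoc)
  qed
  then show thesis using K1(1) K2(1) that[of "K1 * K2"] by simp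
qed

end

section \<open>Analytic continuation of unitary groups\<close>

lemma exp_diff_bound:
  assumes "cmod u \<le> r" "cmod v \<le> r"
  shows "cmod (exp u - exp v) \<le> exp r * cmod (u - v)"
proof (rule field_differentiable_bound[of "cball 0 r" exp exp])
  show "cmod (exp z) \<le> exp r" if "z \<in> cball 0 r" for z
    using that norm_exp[of z] by (auto intro: order_trans)
qed (use assms in \<open>auto intro: has_field_derivative_at_within DERIV_exp\<close>)

lemma sum_pairs: "(\<Sum>k<2 * n. f k) = (\<Sum>k<n::nat. f (2 * k) + f (2 * k + 1) :: 'a::comm_monoid_add)"
  by (induction n) (auto simp: ac_simps)

lemma zero_islimpt_of_real: "(0::complex) islimpt range of_real"
  unfolding islimpt_approachable
proof (intro allI impI)
  fix e :: real assume "e > 0"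
  then show "\<exists>x'\<in>range of_real. x' \<noteq> (0::complex) \<and> dist x' 0 < e"
    by (intro bexI[of _ "of_real (e / 2)"] rangeI) auto
qed

lemma wholo_unique:
  assumes X: "wholo X UNIV" and Y: "wholo Y UNIV" and eq: "\<And>s. X (of_real s) = Y (of_real s)"
  shows "X z = Y z"
proof (rule cinner_eqI)
  fix y
  have hol: "(\<lambda>z. cinner y (X z) - cinner y (Y z)) holomorphic_on UNIV"
    using X Y by (intro holomorphic_intros) (auto simp: wholo_def)
  have "cinner y (X z) - cinner y (Y z) = 0"
    by (rule analytic_continuation[OF hol open_UNIV connected_UNIV subset_UNIV UNIV_I zero_islimpt_of_real])
       (auto simp: eq)
  then show "cinner y (X z) = cinner y (Y z)" by simp
qed

section \<open>Spectral projections of a unitary group\<close>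

locale spectral_group =
  fixes U :: "real \<Rightarrow> 'a::complex_hilbert \<Rightarrow> 'a" and E :: "real set \<Rightarrow> 'a \<Rightarrow> 'a"
  assumes unitary: "unitary_group U" and spectral: "spectral_measure_of U E"
begin

lemma clinear_U: "clinear (U s)" and norm_U [simp]: "norm (U s x) = norm x"
  and U_0 [simp]: "U 0 x = x" and U_add: "U (s + t) x = U s (U t x)"
  using unitary by (auto simp: unitary_group_def)

lemma U_minus [simp]: "U s (U (- s) x) = x" "U (- s) (U s x) = x"
  using U_add[of s "- s" x] U_add[of "- s" s x] by auto

lemma bounded_linear_U: "bounded_linear (U s)"
  by (rule isometry_bounded_linear[OF clinearD(1)[OF clinear_U] norm_U])

lemma U_cinner: "cinner (U s x) (U s y) = cinner x y"
  by (rule isometry_cinner[OF clinear_U norm_U])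

lemma U_adjoint: "cinner x (U s y) = cinner (U (- s) x) y"
  using U_cinner[of "- s" x "U s y"] by simp

lemma pvm: "proj_valued_measure E" using spectral by (simp add: spectral_measure_of_def)

lemma clinear_E: "B \<in> sets borel \<Longrightarrow> clinear (E B)"
  and E_sym: "B \<in> sets borel \<Longrightarrow> inner (E B x) y = inner x (E B y)"
  and E_UNIV: "E UNIV x = x"
  and E_Int: "B \<in> sets borel \<Longrightarrow> C \<in> sets borel \<Longrightarrow> E B (E C x) = E (B \<inter> C) x"
  using pvm by (auto simp: proj_valued_measure_def)

lemma E_idem: "B \<in> sets borel \<Longrightarrow> E B (E B x) = E B x"
  using E_Int[of B B x] by simp

lemma E_sums: "range Bs \<subseteq> sets borel \<Longrightarrow> disjoint_family Bs \<Longrightarrow> (\<lambda>n. E (Bs n) x) sums E (\<Union>n. Bs n) x"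
  using pvm by (auto simp: proj_valued_measure_def)

lemma E_adjoint: "B \<in> sets borel \<Longrightarrow> cinner (E B x) y = cinner x (E B y)"
  using E_sym[of B] clinearD(2)[OF clinear_E[of B]] by (simp add: cinner_def) metis

lemma E_empty [simp]: "E {} x = 0"
proof -
  have "(\<lambda>n. E {} x) sums E (\<Union>n::nat. {}) x"
    by (rule E_sums) (auto simp: disjoint_family_on_def)
  then have "(\<lambda>n::nat. E {} x) \<longlonglongrightarrow> 0" using summable_LIMSEQ_zero sums_summable by blast
  then show ?thesis by (simp add: LIMSEQ_const_iff)
qed

lemma E_Un: "B \<in> sets borel \<Longrightarrow> C \<in> sets borel \<Longrightarrow> B \<inter> C = {} \<Longrightarrow> E (B \<union> C) x = E B x + E C x"
proof -
  assume BC: "B \<in> sets borel" "C \<in> sets borel" "B \<inter> C = {}"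
  have "(\<lambda>n. E (binaryset B C n) x) sums E (\<Union>n. binaryset B C n) x"
    using BC by (intro E_sums) (auto simp: range_binaryset_eq disjoint_family_on_def binaryset_def)
  moreover have "(\<lambda>n. E (binaryset B C n) x) sums (\<Sum>n<2. E (binaryset B C n) x)"
    by (rule sums_finite) (auto simp: binaryset_def)
  ultimately have "E (\<Union>n. binaryset B C n) x = (\<Sum>n<2. E (binaryset B C n) x)"
    by (rule sums_unique2)
  then show ?thesis by (simp add: UN_binaryset_eq numeral_2_eq_2 binaryset_def)
qed

lemma E_orth: "B \<in> sets borel \<Longrightarrow> C \<in> sets borel \<Longrightarrow> B \<inter> C = {} \<Longrightarrow> cinner (E B x) (E C y) = 0"
  by (simp add: E_adjoint E_Int)

lemma inner_E_self: "B \<in> sets borel \<Longrightarrow> inner x (E B x) = (norm (E B x))\<^sup>2"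
  using E_sym[of B x "E B x"] by (simp add: E_idem power2_norm_eq_inner)

lemma norm_E_le: "B \<in> sets borel \<Longrightarrow> norm (E B x) \<le> norm x"
proof (cases "E B x = 0")
  case False
  assume "B \<in> sets borel"
  then have "norm (E B x) * norm (E B x) \<le> norm x * norm (E B x)"
    using norm_cauchy_schwarz[of x "E B x"] by (simp add: inner_E_self power2_eq_square)
  then show ?thesis using False by simp
qed auto

lemma bounded_linear_E: "B \<in> sets borel \<Longrightarrow> bounded_linear (E B)"
  using clinearD[OF clinear_E] norm_E_le by (intro bounded_linear_intro[where K = 1]) auto

lemma E_finite_UN:
  assumes "finite I" "\<And>i. i \<in> I \<Longrightarrow> B i \<in> sets borel" "disjoint_family_on B I"
  shows "E (\<Union>i\<in>I. B i) x = (\<Sum>i\<in>I. E (B i) x)"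
  using assms
proof (induction I rule: finite_induct)
  case (insert i I)
  have "E (B i \<union> (\<Union>i\<in>I. B i)) x = E (B i) x + E (\<Union>i\<in>I. B i) x"
    using insert by (intro E_Un) (auto simp: disjoint_family_on_def)
  then show ?case using insert by (auto simp: disjoint_family_on_def)
qed auto

lemma norm_sum_E:
  assumes I: "finite I" and B: "\<And>i. i \<in> I \<Longrightarrow> B i \<in> sets borel" and d: "disjoint_family_on B I"
  shows "(norm (\<Sum>i\<in>I. c i *\<^sub>C E (B i) x))\<^sup>2 = (\<Sum>i\<in>I. (cmod (c i))\<^sup>2 * (norm (E (B i) x))\<^sup>2)"
  using I B d
proof (induction I rule: finite_induct)
  case (insert i I)
  have "cinner (c i *\<^sub>C E (B i) x) (\<Sum>i\<in>I. c i *\<^sub>C E (B i) x) = 0"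
    unfolding cinner_sum_right using insert
    by (intro sum.neutral ballI) (auto simp: cinner_cscale_left cinner_cscale_right disjoint_family_on_def intro!: E_orth)
  then have "inner (c i *\<^sub>C E (B i) x) (\<Sum>i\<in>I. c i *\<^sub>C E (B i) x) = 0"
    by (metis Re_cinner zero_complex.sel(1))
  then have "(norm (c i *\<^sub>C E (B i) x + (\<Sum>i\<in>I. c i *\<^sub>C E (B i) x)))\<^sup>2
      = (norm (c i *\<^sub>C E (B i) x))\<^sup>2 + (norm (\<Sum>i\<in>I. c i *\<^sub>C E (B i) x))\<^sup>2"
    by (simp add: power2_norm_eq_inner inner_add_left inner_add_right inner_commute)
  then show ?case
    using insert by (auto simp: disjoint_family_on_def norm_cscale power_mult_distrib)
qed auto

lemma norm_sum_E_le:
  assumes I: "finite I" and B: "\<And>i. i \<in> I \<Longrightarrow> B i \<in> sets borel" and d: "disjoint_family_on B I"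
    and c: "\<And>i. i \<in> I \<Longrightarrow> cmod (c i) \<le> K" and K: "0 \<le> K"
  shows "norm (\<Sum>i\<in>I. c i *\<^sub>C E (B i) x) \<le> K * norm x"
proof -
  have "(norm (\<Sum>i\<in>I. c i *\<^sub>C E (B i) x))\<^sup>2 = (\<Sum>i\<in>I. (cmod (c i))\<^sup>2 * (norm (E (B i) x))\<^sup>2)"
    by (rule norm_sum_E[OF I B d])
  also have "\<dots> \<le> (\<Sum>i\<in>I. K\<^sup>2 * (norm (E (B i) x))\<^sup>2)"
    using c by (intro sum_mono mult_right_mono power_mono) auto
  also have "\<dots> = K\<^sup>2 * (norm (\<Sum>i\<in>I. 1 *\<^sub>C E (B i) x))\<^sup>2"
    by (subst norm_sum_E[OF I B d]) (simp_all add: sum_distrib_left)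
  also have "(\<Sum>i\<in>I. 1 *\<^sub>C E (B i) x) = E (\<Union>i\<in>I. B i) x"
    using E_finite_UN[OF I B d] by simp
  also have "K\<^sup>2 * (norm (E (\<Union>i\<in>I. B i) x))\<^sup>2 \<le> (K * norm x)\<^sup>2"
    unfolding power_mult_distrib using I B by (intro mult_left_mono power_mono norm_E_le) auto
  finally show ?thesis by (rule power2_le_imp_le) (use K in simp)
qed

lemma spectral_integral:
  obtains \<mu> where "sets \<mu> = sets borel" "finite_measure \<mu>"
    "\<forall>B\<in>sets borel. measure \<mu> B = (norm (E B x))\<^sup>2"
    "\<forall>s. cinner x (U s x) = (LINT l|\<mu>. cis (s * l))"
proof -
  obtain \<mu> where \<mu>: "sets \<mu> = sets borel" "\<forall>B\<in>sets borel. emeasure \<mu> B = ennreal ((norm (E B x))\<^sup>2)"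
    "\<forall>s. cinner x (U s x) = (LINT l|\<mu>. cis (s * l))"
    using spectral unfolding spectral_measure_of_def by meson
  have "finite_measure \<mu>"
    using \<mu> sets_eq_imp_space_eq[OF \<mu>(1)] by (intro finite_measureI) auto
  moreover have "\<forall>B\<in>sets borel. measure \<mu> B = (norm (E B x))\<^sup>2"
    using \<mu>(2) by (simp add: measure_def)
  ultimately show thesis using that \<mu> by blast
qed

section \<open>Complex orbits as limits of dyadic Riemann sums\<close>

definition pt :: "real \<Rightarrow> real \<Rightarrow> nat \<Rightarrow> nat \<Rightarrow> real" where
  "pt a w n k = a + real k * (w / 2 ^ n)"

definition blk :: "real \<Rightarrow> real \<Rightarrow> nat \<Rightarrow> nat \<Rightarrow> real set" where
  "blk a w n k = {pt a w n k..<pt a w n (Suc k)}"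

text \<open>Riemann sums over dyadic partitions for \<open>exp (i \<zeta> P) E {a..<a + w} y\<close>.\<close>

definition approx_orbit :: "real \<Rightarrow> real \<Rightarrow> nat \<Rightarrow> complex \<Rightarrow> 'a \<Rightarrow> 'a" where
  "approx_orbit a w n \<zeta> y = (\<Sum>k<2^n. exp (\<i> * \<zeta> * of_real (pt a w n k)) *\<^sub>C E (blk a w n k) y)"

lemma blk_borel [simp]: "blk a w n k \<in> sets borel" by (simp add: blk_def)

lemma pt_mono: "0 \<le> w \<Longrightarrow> j \<le> k \<Longrightarrow> pt a w n j \<le> pt a w n k"
  by (simp add: pt_def divide_right_mono mult_right_mono)

lemma blk_disjoint: "0 \<le> w \<Longrightarrow> disjoint_family_on (blk a w n) I"
proof -
  assume w: "0 \<le> w"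
  have "blk a w n j \<inter> blk a w n k = {}" if "j < k" for j k
    using pt_mono[OF w, of "Suc j" k a n] that by (auto simp: blk_def)
  then show ?thesis unfolding disjoint_family_on_def by (metis Int_commute linorder_neqE_nat)
qed

lemma blk_UN: "0 \<le> w \<Longrightarrow> (\<Union>k<m. blk a w n k) = {a..<pt a w n m}"
proof (induction m)
  case (Suc m)
  have "a \<le> pt a w n m" using Suc(2) by (simp add: pt_def)
  then show ?case
    using Suc pt_mono[OF Suc(2), of m "Suc m" a n] by (auto simp: lessThan_Suc blk_def)
qed (simp add: pt_def)

lemma blk_UN_all: "0 \<le> w \<Longrightarrow> (\<Union>k<2^n. blk a w n k) = {a..<a + w}"
  by (simp add: blk_UN) (simp add: pt_def)

lemma pt_range: "0 \<le> w \<Longrightarrow> k < 2 ^ n \<Longrightarrow> pt a w n k \<in> {a..a + w}"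
proof -
  assume w: "0 \<le> w" and k: "k < 2 ^ n"
  have "real k \<le> real (2 ^ n)" using k by (simp only: of_nat_le_iff less_imp_le)
  then have "real k * (w / 2 ^ n) \<le> 2 ^ n * (w / 2 ^ n)"
    using w by (intro mult_right_mono) auto
  then show ?thesis using w by (simp add: pt_def)
qed

lemma pt_Suc_even: "pt a w (Suc n) (2 * k) = pt a w n k"
  by (simp add: pt_def)

lemma E_blk_split: "0 \<le> w \<Longrightarrow> E (blk a w n k) y = E (blk a w (Suc n) (2 * k)) y + E (blk a w (Suc n) (2 * k + 1)) y"
proof -
  assume w: "0 \<le> w"
  have "blk a w n k = blk a w (Suc n) (2 * k) \<union> blk a w (Suc n) (2 * k + 1)"
    using pt_mono[OF w, of "2 * k" "2 * k + 1" a "Suc n"] pt_mono[OF w, of "2 * k + 1" "2 * k + 2" a "Suc n"]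
      pt_Suc_even[of a w n k] pt_Suc_even[of a w n "Suc k"]
    by (auto simp: blk_def)
  moreover have "blk a w (Suc n) (2 * k) \<inter> blk a w (Suc n) (2 * k + 1) = {}"
    by (rule disjoint_family_onD[OF blk_disjoint[OF w, of a "Suc n" UNIV]]) auto
  ultimately show ?thesis by (simp add: E_Un)
qed

text \<open>The maximum of the modulus of exp (i \<zeta> l) over l in [a, b]: the modulus is
  monotone in l, so an end point attains it.\<close>

definition growth :: "real \<Rightarrow> real \<Rightarrow> complex \<Rightarrow> real" where
  "growth a b \<zeta> = max (exp (- a * Im \<zeta>)) (exp (- b * Im \<zeta>))"

lemma norm_exp_pt_le: "l \<in> {a..b} \<Longrightarrow> cmod (exp (\<i> * \<zeta> * of_real l)) \<le> growth a b \<zeta>"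
proof (cases "0 \<le> Im \<zeta>")
  case True
  assume "l \<in> {a..b}"
  with True have "a * Im \<zeta> \<le> l * Im \<zeta>" by (intro mult_right_mono) auto
  then show ?thesis by (simp add: growth_def max_def mult.commute)
next
  case False
  assume "l \<in> {a..b}"
  with False have "b * Im \<zeta> \<le> l * Im \<zeta>" by (intro mult_right_mono_neg) auto
  then show ?thesis by (simp add: growth_def max_def mult.commute)
qed

lemma norm_approx_orbit_le: "0 \<le> w \<Longrightarrow> norm (approx_orbit a w n \<zeta> y) \<le> growth a (a + w) \<zeta> * norm y"
  unfolding approx_orbit_def
proof (rule norm_sum_E_le[OF _ _ blk_disjoint])
  assume w: "0 \<le> w"
  show "0 \<le> growth a (a + w) \<zeta>" by (simp add: growth_def le_max_iff_disj)
  show "cmod (exp (\<i> * \<zeta> * of_real (pt a w n k))) \<le> growth a (a + w) \<zeta>" if "k \<in> {..<2 ^ n}" for k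
    using that by (intro norm_exp_pt_le pt_range w) auto
qed auto

lemma clinear_approx_orbit: "clinear (approx_orbit a w n \<zeta>)"
proof -
  note lin = clinearD[OF clinear_E[OF blk_borel]]
  show ?thesis
    unfolding clinear_def approx_orbit_def
    by (auto intro!: linearI sum.cong simp: lin cscale_add_right sum.distrib imult_sum imult_cscale
        linear_scale[OF linear_cscale] scaleR_sum_right)
qed

text \<open>Refining the partition moves the sample point only on the right half of each block, and
  by half a block length. The difference is a step function of the spectral projections, bounded
  through the Lipschitz constant of \<open>exp\<close>.\<close>

lemma approx_orbit_step:
  assumes w: "0 \<le> w" and \<rho>: "cmod \<zeta> \<le> \<rho>"
  shows "norm (approx_orbit a w (Suc n) \<zeta> y - approx_orbit a w n \<zeta> y)
    \<le> exp (\<rho> * (\<bar>a\<bar> + w)) * (\<rho> * (w / 2 ^ Suc n)) * norm y"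
proof -
  define e where "e l = exp (\<i> * \<zeta> * of_real l)" for l
  define p where "p = pt a w (Suc n)"
  have "approx_orbit a w (Suc n) \<zeta> y = (\<Sum>k<2 * 2 ^ n. e (p k) *\<^sub>C E (blk a w (Suc n) k) y)"
    by (simp add: approx_orbit_def e_def p_def)
  also have "\<dots> = (\<Sum>k<2 ^ n. e (p (2 * k)) *\<^sub>C E (blk a w (Suc n) (2 * k)) y
      + e (p (2 * k + 1)) *\<^sub>C E (blk a w (Suc n) (2 * k + 1)) y)"
    by (rule sum_pairs)
  moreover have "approx_orbit a w n \<zeta> y = (\<Sum>k<2 ^ n. e (p (2 * k)) *\<^sub>C E (blk a w (Suc n) (2 * k)) y
      + e (p (2 * k)) *\<^sub>C E (blk a w (Suc n) (2 * k + 1)) y)"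
    unfolding approx_orbit_def p_def pt_Suc_even e_def
    by (rule sum.cong) (simp_all add: E_blk_split[OF w, of a n] cscale_add_right)
  ultimately have "approx_orbit a w (Suc n) \<zeta> y - approx_orbit a w n \<zeta> y
      = (\<Sum>k<2 ^ n. (e (p (2 * k + 1)) - e (p (2 * k))) *\<^sub>C E (blk a w (Suc n) (2 * k + 1)) y)"
    by (simp add: cscale_diff_left flip: sum_subtractf)
  also have "norm \<dots> \<le> (exp (\<rho> * (\<bar>a\<bar> + w)) * (\<rho> * (w / 2 ^ Suc n))) * norm y"
  proof (rule norm_sum_E_le)
    show "disjoint_family_on (\<lambda>k. blk a w (Suc n) (2 * k + 1)) {..<2 ^ n}"
      using blk_disjoint[OF w, of a "Suc n" UNIV] by (auto simp: disjoint_family_on_def)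
    have "0 \<le> \<rho>" using \<rho> norm_ge_zero[of \<zeta>] by linarith
    show "0 \<le> exp (\<rho> * (\<bar>a\<bar> + w)) * (\<rho> * (w / 2 ^ Suc n))" using w \<open>0 \<le> \<rho>\<close> by simp
    fix k :: nat assume k: "k \<in> {..<2 ^ n}"
    then have k': "2 * k + 1 < 2 ^ Suc n" "2 * k < 2 ^ Suc n" by auto
    have le: "cmod (\<i> * \<zeta> * of_real l) \<le> \<rho> * (\<bar>a\<bar> + w)" if "l \<in> {a..a + w}" for l
      unfolding norm_mult using \<rho> that w \<open>0 \<le> \<rho>\<close> by (auto intro!: mult_mono)
    have "cmod (e (p (2 * k + 1)) - e (p (2 * k)))
        \<le> exp (\<rho> * (\<bar>a\<bar> + w)) * cmod (\<i> * \<zeta> * of_real (p (2 * k + 1)) - \<i> * \<zeta> * of_real (p (2 * k)))"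
      unfolding e_def p_def by (rule exp_diff_bound[OF le[OF pt_range[OF w k'(1)]] le[OF pt_range[OF w k'(2)]]])
    also have "\<i> * \<zeta> * of_real (p (2 * k + 1)) - \<i> * \<zeta> * of_real (p (2 * k)) = \<i> * \<zeta> * of_real (w / 2 ^ Suc n)"
      unfolding p_def pt_def by (simp add: field_simps)
    also have "cmod (\<i> * \<zeta> * of_real (w / 2 ^ Suc n)) = cmod \<zeta> * (w / 2 ^ Suc n)"
      using w by (simp add: norm_mult norm_divide norm_power)
    finally show "cmod (e (p (2 * k + 1)) - e (p (2 * k))) \<le> exp (\<rho> * (\<bar>a\<bar> + w)) * (\<rho> * (w / 2 ^ Suc n))"
      using \<rho> w by (elim order_trans) (intro mult_left_mono mult_right_mono, auto)
  qed auto
  finally show ?thesis .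
qed

text \<open>The limit of the Riemann sums, written as a telescoping series so that the M-test gives
  convergence uniform on discs.\<close>

definition orbit :: "real \<Rightarrow> real \<Rightarrow> complex \<Rightarrow> 'a \<Rightarrow> 'a" where
  "orbit a w \<zeta> y = approx_orbit a w 0 \<zeta> y
     + (\<Sum>n. approx_orbit a w (Suc n) \<zeta> y - approx_orbit a w n \<zeta> y)"

lemma approx_orbit_uniform:
  assumes w: "0 \<le> w"
  shows "uniform_limit (cball 0 \<rho>) (\<lambda>n \<zeta>. approx_orbit a w n \<zeta> y) (\<lambda>\<zeta>. orbit a w \<zeta> y) sequentially"
proof -
  have "uniform_limit (cball 0 \<rho>) (\<lambda>n \<zeta>. \<Sum>i<n. approx_orbit a w (Suc i) \<zeta> y - approx_orbit a w i \<zeta> y)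
      (\<lambda>\<zeta>. \<Sum>i. approx_orbit a w (Suc i) \<zeta> y - approx_orbit a w i \<zeta> y) sequentially"
  proof (rule Weierstrass_m_test)
    show "norm (approx_orbit a w (Suc n) \<zeta> y - approx_orbit a w n \<zeta> y)
        \<le> (exp (\<rho> * (\<bar>a\<bar> + w)) * \<rho> * w * norm y / 2) * (1 / 2) ^ n" if "\<zeta> \<in> cball 0 \<rho>" for n \<zeta>
      using approx_orbit_step[OF w, of \<zeta> \<rho> a n y] that by (simp add: power_divide field_simps)
    show "summable (\<lambda>n. (exp (\<rho> * (\<bar>a\<bar> + w)) * \<rho> * w * norm y / 2) * (1 / 2) ^ n)"
      by (intro summable_mult summable_geometric) simp
  qed
  from uniform_limit_add[OF uniform_limit_const[where c = "\<lambda>\<zeta>. approx_orbit a w 0 \<zeta> y"] this]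
  have "uniform_limit (cball 0 \<rho>)
      (\<lambda>n \<zeta>. approx_orbit a w 0 \<zeta> y + (\<Sum>i<n. approx_orbit a w (Suc i) \<zeta> y - approx_orbit a w i \<zeta> y))
      (\<lambda>\<zeta>. orbit a w \<zeta> y) sequentially"
    by (simp add: orbit_def)
  moreover have "approx_orbit a w 0 \<zeta> y + (\<Sum>i<n. approx_orbit a w (Suc i) \<zeta> y - approx_orbit a w i \<zeta> y)
      = approx_orbit a w n \<zeta> y" for n \<zeta>
    unfolding sum_lessThan_telescope[of "\<lambda>i. approx_orbit a w i \<zeta> y" n] by simp
  ultimately show ?thesis by simp
qed

lemma approx_orbit_tendsto: "0 \<le> w \<Longrightarrow> (\<lambda>n. approx_orbit a w n \<zeta> y) \<longlonglongrightarrow> orbit a w \<zeta> y"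
  using tendsto_uniform_limitI[OF approx_orbit_uniform[where \<rho> = "cmod \<zeta>" and w = w]] by simp

lemma norm_orbit_le: "0 \<le> w \<Longrightarrow> norm (orbit a w \<zeta> y) \<le> growth a (a + w) \<zeta> * norm y"
  by (rule LIMSEQ_le_const2[OF tendsto_norm[OF approx_orbit_tendsto]]) (use norm_approx_orbit_le in auto)

lemma clinear_orbit: "0 \<le> w \<Longrightarrow> clinear (orbit a w \<zeta>)"
proof -
  assume w: "0 \<le> w"
  note lin = clinearD[OF clinear_approx_orbit] and lim = approx_orbit_tendsto[OF w]
  have "linear (orbit a w \<zeta>)"
  proof (rule linearI)
    fix x y r
    show "orbit a w \<zeta> (x + y) = orbit a w \<zeta> x + orbit a w \<zeta> y"
      using lim[of a \<zeta> "x + y"] tendsto_add[OF lim[of a \<zeta> x] lim[of a \<zeta> y]] LIMSEQ_unique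
      by (simp add: lin(4))
    show "orbit a w \<zeta> (r *\<^sub>R x) = r *\<^sub>R orbit a w \<zeta> x"
      using lim[of a \<zeta> "r *\<^sub>R x"] tendsto_scaleR[OF tendsto_const[of r] lim[of a \<zeta> x]] LIMSEQ_unique
      by (simp add: lin(7))
  qed
  moreover have "orbit a w \<zeta> (imult x) = imult (orbit a w \<zeta> x)" for x
    using lim[of a \<zeta> "imult x"] bounded_linear.tendsto[OF bounded_linear_imult lim[of a \<zeta> x]] LIMSEQ_unique
    by (simp add: lin(2))
  ultimately show ?thesis by (simp add: clinear_def)
qed

lemma wholo_orbit: "0 \<le> w \<Longrightarrow> wholo (\<lambda>\<zeta>. orbit a w \<zeta> y) UNIV"
proof (rule wholoI)
  assume w: "0 \<le> w"
  fix x
  show "(\<lambda>\<zeta>. cinner x (orbit a w \<zeta> y)) holomorphic_on UNIV"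
  proof (rule holomorphic_uniform_sequence)
    show "(\<lambda>\<zeta>. cinner x (approx_orbit a w n \<zeta> y)) holomorphic_on UNIV" for n
      unfolding approx_orbit_def cinner_sum_right cinner_cscale_right by (intro holomorphic_intros)
    fix \<zeta> :: complex
    have "uniform_limit (cball \<zeta> 1) (\<lambda>n \<zeta>. approx_orbit a w n \<zeta> y) (\<lambda>\<zeta>. orbit a w \<zeta> y) sequentially"
    proof (rule uniform_limit_on_subset[OF approx_orbit_uniform[OF w]])
      show "cball \<zeta> 1 \<subseteq> cball 0 (cmod \<zeta> + 1)"
      proof
        fix z assume "z \<in> cball \<zeta> 1"
        then show "z \<in> cball 0 (cmod \<zeta> + 1)"
          using norm_triangle_sub[of z \<zeta>] by (simp add: dist_norm norm_minus_commute)
      qed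
    qed
    from bounded_linear.uniform_limit[OF bounded_bilinear.bounded_linear_right[OF bounded_bilinear_cinner] this]
    show "\<exists>d>0. cball \<zeta> d \<subseteq> UNIV \<and>
        uniform_limit (cball \<zeta> d) (\<lambda>n \<zeta>. cinner x (approx_orbit a w n \<zeta> y)) (\<lambda>\<zeta>. cinner x (orbit a w \<zeta> y)) sequentially"
      by (intro exI[of _ 1]) auto
  qed auto
next
  assume w: "0 \<le> w"
  fix \<zeta> :: complex
  have "norm (orbit a w z y) \<le> exp ((\<bar>a\<bar> + w) * (cmod \<zeta> + 1)) * norm y" if z: "z \<in> ball \<zeta> 1" for z
  proof -
    have z': "\<bar>Im z\<bar> \<le> cmod \<zeta> + 1"
      using z abs_Im_le_cmod[of z] norm_triangle_sub[of z \<zeta>] by (simp add: dist_norm norm_minus_commute)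
    have "- c * Im z \<le> (\<bar>a\<bar> + w) * (cmod \<zeta> + 1)" if "\<bar>c\<bar> \<le> \<bar>a\<bar> + w" for c
    proof -
      have "- c * Im z \<le> \<bar>c\<bar> * \<bar>Im z\<bar>" by (metis abs_ge_self abs_minus_cancel abs_mult)
      also have "\<dots> \<le> (\<bar>a\<bar> + w) * (cmod \<zeta> + 1)" using that z' by (intro mult_mono) auto
      finally show ?thesis .
    qed
    from this[of a] this[of "a + w"] have "growth a (a + w) z \<le> exp ((\<bar>a\<bar> + w) * (cmod \<zeta> + 1))"
      using w by (auto simp: growth_def)
    then show ?thesis using norm_orbit_le[OF w, of a z y] by (meson mult_right_mono norm_ge_zero order_trans)
  qed
  then show "\<exists>e>0. \<exists>M. \<forall>w'\<in>ball \<zeta> e. norm (orbit a w w' y) \<le> M"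
    using zero_less_one by blast
qed

text \<open>The spectral measure is tied to \<open>U\<close> through diagonal matrix elements, so
  the comparison is made there: the Riemann sum is the integral of a step function that follows
  \<open>cis\<close> up to the mesh size.\<close>

lemma cinner_approx_orbit_real:
  assumes w: "0 \<le> w" and y: "E {a..<a + w} y = y"
  shows "cmod (cinner y (approx_orbit a w n (of_real s) y) - cinner y (U s y))
    \<le> exp (\<bar>s\<bar> * (\<bar>a\<bar> + w)) * (\<bar>s\<bar> * (w / 2 ^ n)) * (norm y)\<^sup>2"
proof -
  obtain \<mu> where \<mu>: "sets \<mu> = sets borel" "finite_measure \<mu>"
    "\<forall>B\<in>sets borel. measure \<mu> B = (norm (E B y))\<^sup>2"
    "\<forall>s. cinner y (U s y) = (LINT l|\<mu>. cis (s * l))"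
    by (rule spectral_integral)
  interpret finite_measure \<mu> by (rule \<mu>(2))
  note [measurable_cong] = \<mu>(1)
  have sp: "space \<mu> = UNIV" using sets_eq_imp_space_eq[OF \<mu>(1)] by simp
  define f where "f l = (\<Sum>k<2^n. indicator (blk a w n k) l *\<^sub>R cis (s * pt a w n k))" for l
  have e_cis: "exp (\<i> * of_real s * of_real l) = cis (s * l)" for l
    by (simp add: cis_conv_exp mult.assoc)
  have inti: "integrable \<mu> (indicator (blk a w n k) :: real \<Rightarrow> real)" for k
    by (rule integrable_real_indicator) (simp_all add: \<mu>(1) less_top[symmetric] emeasure_eq_measure)
  then have intk: "integrable \<mu> (\<lambda>l. indicator (blk a w n k) l *\<^sub>R cis (s * pt a w n k))" for k
    by (intro integrable_scaleR_left)
  have intf: "integrable \<mu> f" unfolding f_def by (rule Bochner_Integration.integrable_sum) (rule intk)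
  have "continuous_on UNIV (\<lambda>l. cis (s * l))" by (intro continuous_intros)
  then have "(\<lambda>l. cis (s * l)) \<in> borel_measurable \<mu>"
    using borel_measurable_continuous_onI by (simp cong: measurable_cong_sets add: \<mu>(1))
  then have intc: "integrable \<mu> (\<lambda>l. cis (s * l))"
    by (intro integrable_const_bound[where B = 1]) auto
  have "(LINT l|\<mu>. f l) = (\<Sum>k<2^n. measure \<mu> (blk a w n k) *\<^sub>R cis (s * pt a w n k))"
    unfolding f_def
    by (subst Bochner_Integration.integral_sum[OF intk]) (simp add: integral_scaleR_left[OF inti] sp)
  also have "\<dots> = cinner y (approx_orbit a w n (of_real s) y)"
  proof -
    have "cinner y (E (blk a w n k) y) = of_real ((norm (E (blk a w n k) y))\<^sup>2)" for k
      using E_adjoint[OF blk_borel, of a w n k y "E (blk a w n k) y"] by (simp add: E_idem cinner_self)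
    then show ?thesis
      unfolding approx_orbit_def cinner_sum_right cinner_cscale_right e_cis using \<mu>(3)
      by (simp add: scaleR_conv_of_real mult.commute)
  qed
  finally have 1: "cinner y (approx_orbit a w n (of_real s) y) = (LINT l|\<mu>. f l)" by simp
  \<comment> \<open>\<open>y\<close> is fixed by the projection of the window, so its measure is
    concentrated there and the step function has to be compared with \<open>cis\<close> only on the
    window.\<close>
  have "E (- {a..<a + w}) y = 0"
    using E_Int[of "- {a..<a + w}" "{a..<a + w}" y] y by simp
  then have "measure \<mu> (- {a..<a + w}) = 0" using \<mu>(3) by simp
  then have AE: "AE l in \<mu>. l \<in> {a..<a + w}"
    by (intro AE_I[of _ _ "- {a..<a + w}"]) (auto simp: emeasure_eq_measure \<mu>(1))
  have fb: "norm (f l - cis (s * l)) \<le> exp (\<bar>s\<bar> * (\<bar>a\<bar> + w)) * (\<bar>s\<bar> * (w / 2 ^ n))"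
    if l: "l \<in> {a..<a + w}" for l
  proof -
    obtain k where k: "k < 2 ^ n" "l \<in> blk a w n k" using l blk_UN_all[OF w, of a n] by blast
    have "f l = (\<Sum>j\<in>{k}. cis (s * pt a w n j))"
      unfolding f_def
    proof (rule sum.mono_neutral_cong_right)
      show "\<forall>i\<in>{..<2 ^ n} - {k}. indicator (blk a w n i) l *\<^sub>R cis (s * pt a w n i) = 0"
        using k blk_disjoint[OF w, of a n UNIV] by (auto simp: disjoint_family_on_def indicator_def)
    qed (use k in auto)
    then have f: "f l = cis (s * pt a w n k)" by simp
    have le: "cmod (\<i> * of_real s * of_real t) \<le> \<bar>s\<bar> * (\<bar>a\<bar> + w)" if "t \<in> {a..a + w}" for t
      unfolding norm_mult using that w by (auto intro!: mult_mono)
    have "cmod (cis (s * pt a w n k) - cis (s * l))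
        \<le> exp (\<bar>s\<bar> * (\<bar>a\<bar> + w)) * cmod (\<i> * of_real s * of_real (pt a w n k) - \<i> * of_real s * of_real l)"
      unfolding e_cis[symmetric] using l by (intro exp_diff_bound le pt_range[OF w k(1)]) auto
    also have "\<i> * of_real s * of_real (pt a w n k) - \<i> * of_real s * of_real l = \<i> * of_real (s * (pt a w n k - l))"
      by (simp add: algebra_simps)
    also have "cmod \<dots> = \<bar>s\<bar> * \<bar>pt a w n k - l\<bar>" by (simp only: norm_mult norm_ii norm_of_real abs_mult)
    also have "\<dots> \<le> \<bar>s\<bar> * (w / 2 ^ n)"
    proof (rule mult_left_mono)
      have "pt a w n (Suc k) = pt a w n k + w / 2 ^ n" by (simp add: pt_def field_simps)
      then show "\<bar>pt a w n k - l\<bar> \<le> w / 2 ^ n" using k(2) by (auto simp: blk_def)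
    qed auto
    finally show ?thesis unfolding f by simp
  qed
  have "cmod ((LINT l|\<mu>. f l) - (LINT l|\<mu>. cis (s * l))) = cmod (LINT l|\<mu>. f l - cis (s * l))"
    using intf intc by simp
  also have "\<dots> \<le> (LINT l|\<mu>. norm (f l - cis (s * l)))" by (rule integral_norm_bound)
  also have "\<dots> \<le> (LINT l|\<mu>. exp (\<bar>s\<bar> * (\<bar>a\<bar> + w)) * (\<bar>s\<bar> * (w / 2 ^ n)))"
    using AE fb intf intc by (intro integral_mono_AE) auto
  also have "\<dots> = exp (\<bar>s\<bar> * (\<bar>a\<bar> + w)) * (\<bar>s\<bar> * (w / 2 ^ n)) * (norm y)\<^sup>2"
    using \<mu>(3) by (simp add: sp E_UNIV)
  finally show ?thesis unfolding 1 using \<mu>(4) by simp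
qed

text \<open>Polarization is available only inside the spectral subspace, and at this stage
  \<open>U s y\<close> is not known to lie in it. It still shows that the inner product of the orbit
  with \<open>U s y\<close> is the squared norm of the orbit; as both vectors have the norm of y,
  they coincide.\<close>

lemma orbit_real:
  assumes w: "0 \<le> w" and y: "E {a..<a + w} y = y"
  shows "orbit a w (of_real s) y = U s y"
proof -
  define S where "S = {y. E {a..<a + w} y = y}"
  define B where "B = {a..<a + w}"
  have Bb: "B \<in> sets borel" by (simp add: B_def)
  note linE = clinearD[OF clinear_E[OF Bb]] and linU = clinearD[OF clinear_U]
    and linO = clinearD[OF clinear_orbit[OF w]]
  have diag: "cinner x (orbit a w (of_real s) x - U s x) = 0" if "x \<in> S" for x
  proof -
    have "(\<lambda>n. cinner x (approx_orbit a w n (of_real s) x) - cinner x (U s x)) \<longlonglongrightarrow> 0"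
    proof (rule Lim_null_comparison)
      show "eventually (\<lambda>n. norm (cinner x (approx_orbit a w n (of_real s) x) - cinner x (U s x))
          \<le> exp (\<bar>s\<bar> * (\<bar>a\<bar> + w)) * (\<bar>s\<bar> * (w / 2 ^ n)) * (norm x)\<^sup>2) sequentially"
        using cinner_approx_orbit_real[OF w] that by (simp add: S_def)
      show "(\<lambda>n. exp (\<bar>s\<bar> * (\<bar>a\<bar> + w)) * (\<bar>s\<bar> * (w / 2 ^ n)) * (norm x)\<^sup>2) \<longlonglongrightarrow> 0"
        by real_asymp
    qed
    moreover have "(\<lambda>n. cinner x (approx_orbit a w n (of_real s) x) - cinner x (U s x)) \<longlonglongrightarrow>
        cinner x (orbit a w (of_real s) x) - cinner x (U s x)"
      by (intro tendsto_intros approx_orbit_tendsto[OF w])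
    ultimately show ?thesis using LIMSEQ_unique by (fastforce simp: cinner_diff_right)
  qed
  have yS: "y \<in> S" using y by (simp add: S_def)
  have EX: "E B (approx_orbit a w n \<zeta> y) = approx_orbit a w n \<zeta> y" for n \<zeta>
  proof -
    have "B \<inter> blk a w n k = blk a w n k" if "k < 2 ^ n" for k
      using blk_UN_all[OF w, of a n] that by (auto simp: B_def)
    then show ?thesis
      unfolding approx_orbit_def linear_sum[OF linE(1)]
      by (intro sum.cong) (auto simp: linE E_Int Bb)
  qed
  have "E B (orbit a w (of_real s) y) = orbit a w (of_real s) y"
    using bounded_linear.tendsto[OF bounded_linear_E[OF Bb] approx_orbit_tendsto[OF w, of a "of_real s" y]]
    unfolding EX using approx_orbit_tendsto[OF w] by (rule LIMSEQ_unique)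
  then have OS: "orbit a w (of_real s) y \<in> S" by (simp add: S_def B_def)
  have "clinear (\<lambda>y. orbit a w (of_real s) y - U s y)"
    unfolding clinear_def using linear_compose_sub[OF linO(1) linU(1)]
    by (simp add: linO linU imult_diff)
  then have "cinner (orbit a w (of_real s) y) (orbit a w (of_real s) y - U s y) = 0"
  proof (rule cinner_polarization[where S = S])
    show "subspace S" by (auto simp: subspace_def S_def linE[unfolded B_def])
    show "imult x \<in> S" if "x \<in> S" for x using that by (simp add: S_def linE[unfolded B_def])
  qed (use diag OS yS in auto)
  then have ip: "cinner (orbit a w (of_real s) y) (U s y) = cinner (orbit a w (of_real s) y) (orbit a w (of_real s) y)"
    by (simp add: cinner_diff_right)
  have nX: "norm (approx_orbit a w n (of_real s) y) = norm y" for n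
  proof -
    have c1: "cmod (exp (\<i> * of_real s * of_real l)) = 1" for l by simp
    have "(norm (approx_orbit a w n (of_real s) y))\<^sup>2 = (\<Sum>k<2 ^ n. (norm (E (blk a w n k) y))\<^sup>2)"
      unfolding approx_orbit_def by (subst norm_sum_E[OF _ _ blk_disjoint[OF w]]) (auto simp: c1)
    also have "\<dots> = (norm (\<Sum>k<2 ^ n. 1 *\<^sub>C E (blk a w n k) y))\<^sup>2"
      by (subst norm_sum_E[OF _ _ blk_disjoint[OF w]]) auto
    also have "(\<Sum>k<2 ^ n. 1 *\<^sub>C E (blk a w n k) y) = y"
      using E_finite_UN[of "{..<2 ^ n}" "blk a w n" y] blk_disjoint[OF w] blk_UN_all[OF w, of a n] y by simp
    finally show ?thesis by simp
  qed
  have nO: "norm (orbit a w (of_real s) y) = norm y"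
    using tendsto_norm[OF approx_orbit_tendsto[OF w, of a "of_real s" y]] by (simp add: nX LIMSEQ_const_iff)
  have "inner (orbit a w (of_real s) y) (U s y) = (norm y)\<^sup>2"
    using arg_cong[OF ip, of Re] nO by (simp add: power2_norm_eq_inner[symmetric])
  then have "(norm (orbit a w (of_real s) y - U s y))\<^sup>2 = 0"
    using nO norm_U[of s y]
    by (simp add: power2_norm_eq_inner inner_diff_left inner_diff_right inner_commute norm_eq_sqrt_inner)
  then show ?thesis by simp
qed

lemma orbit_bounds:
  assumes "0 \<le> w"
  shows "0 \<le> Im \<zeta> \<Longrightarrow> norm (orbit a w \<zeta> y) \<le> exp (- a * Im \<zeta>) * norm y"
    and "Im \<zeta> \<le> 0 \<Longrightarrow> norm (orbit a w \<zeta> y) \<le> exp (- (a + w) * Im \<zeta>) * norm y"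
proof -
  have "growth a (a + w) \<zeta> \<le> exp (- a * Im \<zeta>)" if "0 \<le> Im \<zeta>"
    using that assms by (simp add: growth_def algebra_simps)
  then show "0 \<le> Im \<zeta> \<Longrightarrow> norm (orbit a w \<zeta> y) \<le> exp (- a * Im \<zeta>) * norm y"
    using norm_orbit_le[OF assms, of a \<zeta> y] by (meson mult_right_mono norm_ge_zero order_trans)
  have "growth a (a + w) \<zeta> \<le> exp (- (a + w) * Im \<zeta>)" if "Im \<zeta> \<le> 0"
    using that assms mult_nonneg_nonpos[of w "Im \<zeta>"] by (simp add: growth_def algebra_simps)
  then show "Im \<zeta> \<le> 0 \<Longrightarrow> norm (orbit a w \<zeta> y) \<le> exp (- (a + w) * Im \<zeta>) * norm y"
    using norm_orbit_le[OF assms, of a \<zeta> y] by (meson mult_right_mono norm_ge_zero order_trans)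
qed

end

text \<open>For a unit vector both measures are probability measures whose characteristic function
  is read off from \<open>U\<close>, so Levy's uniqueness theorem identifies them.\<close>

lemma spectral_group_norm_unique:
  assumes "spectral_group U E" "spectral_group U E'" and B: "B \<in> sets borel"
  shows "norm (E B x) = norm (E' B x)"
proof -
  interpret e: spectral_group U E by fact
  interpret e': spectral_group U E' by fact
  have unit: "norm (E B x) = norm (E' B x)" if x: "norm x = 1" for x
  proof -
    obtain \<mu> where \<mu>: "sets \<mu> = sets borel" "finite_measure \<mu>"
      "\<forall>B\<in>sets borel. measure \<mu> B = (norm (E B x))\<^sup>2"
      "\<forall>s. cinner x (U s x) = (LINT l|\<mu>. cis (s * l))"
      by (rule e.spectral_integral)
    obtain \<nu> where \<nu>: "sets \<nu> = sets borel" "finite_measure \<nu>"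
      "\<forall>B\<in>sets borel. measure \<nu> B = (norm (E' B x))\<^sup>2"
      "\<forall>s. cinner x (U s x) = (LINT l|\<nu>. cis (s * l))"
      by (rule e'.spectral_integral)
    have dist: "real_distribution M"
      if "sets M = sets borel" "finite_measure M" "measure M UNIV = 1" for M :: "real measure"
    proof -
      interpret finite_measure M by fact
      have "space M = UNIV" using sets_eq_imp_space_eq[OF that(1)] by simp
      then have "prob_space M" using that by (intro prob_spaceI) (simp add: emeasure_eq_measure)
      then show ?thesis using that by (simp add: real_distribution_def real_distribution_axioms_def)
    qed
    have "\<mu> = \<nu>"
    proof (rule Levy_uniqueness)
      show "real_distribution \<mu>" using \<mu> x by (intro dist) (auto simp: e.E_UNIV)
      show "real_distribution \<nu>" using \<nu> x by (intro dist) (auto simp: e'.E_UNIV)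
      have ce: "iexp (s * l) = cis (s * l)" for s l by (simp add: cis_conv_exp)
      show "char \<mu> = char \<nu>"
        unfolding char_def ce using \<mu>(4) \<nu>(4) by simp
    qed
    then have "(norm (E B x))\<^sup>2 = (norm (E' B x))\<^sup>2" using \<mu>(3) \<nu>(3) B by metis
    then show ?thesis by simp
  qed
  show ?thesis
  proof (cases "x = 0")
    case True
    then show ?thesis using clinearD(6)[OF e.clinear_E[OF B]] clinearD(6)[OF e'.clinear_E[OF B]] by simp
  next
    case False
    then have "norm (E B ((1 / norm x) *\<^sub>R x)) = norm (E' B ((1 / norm x) *\<^sub>R x))"
      by (intro unit) simp
    then show ?thesis
      using False by (simp add: clinearD(7)[OF e.clinear_E[OF B]] clinearD(7)[OF e'.clinear_E[OF B]])
  qed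
qed

context spectral_group
begin

lemma E_incseq_tendsto:
  assumes B: "\<And>n. B n \<in> sets borel" and inc: "incseq B"
  shows "(\<lambda>n. E (B n) x) \<longlonglongrightarrow> E (\<Union>n. B n) x"
proof -
  obtain \<mu> where \<mu>: "sets \<mu> = sets borel" "finite_measure \<mu>"
    "\<forall>B\<in>sets borel. measure \<mu> B = (norm (E B x))\<^sup>2"
    "\<forall>s. cinner x (U s x) = (LINT l|\<mu>. cis (s * l))"
    by (rule spectral_integral)
  interpret finite_measure \<mu> by (rule \<mu>(2))
  define C where "C = (\<Union>n. B n)"
  have C: "C \<in> sets borel" unfolding C_def using B by auto
  have "(\<lambda>n. measure \<mu> (C - B n)) \<longlonglongrightarrow> measure \<mu> (\<Inter>n. C - B n)"
  proof (rule finite_Lim_measure_decseq)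
    show "range (\<lambda>n. C - B n) \<subseteq> sets \<mu>" using B C by (auto simp: \<mu>(1))
    show "decseq (\<lambda>n. C - B n)" using inc by (auto simp: decseq_def incseq_def)
  qed
  moreover have "(\<Inter>n. C - B n) = {}" by (auto simp: C_def)
  then have "measure \<mu> (\<Inter>n. C - B n) = 0" by (simp only: measure_empty)
  moreover have "measure \<mu> (C - B n) = (norm (E (C - B n) x))\<^sup>2" for n
    using \<mu>(3) B C by (auto intro: sets.Diff)
  ultimately have "(\<lambda>n. (norm (E (C - B n) x))\<^sup>2) \<longlonglongrightarrow> 0" by (simp only:)
  then have "(\<lambda>n. sqrt ((norm (E (C - B n) x))\<^sup>2)) \<longlonglongrightarrow> sqrt 0" by (rule tendsto_real_sqrt)
  then have "(\<lambda>n. norm (E (C - B n) x)) \<longlonglongrightarrow> 0" by simp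
  then have "(\<lambda>n. E (C - B n) x) \<longlonglongrightarrow> 0" by (rule tendsto_norm_zero_cancel)
  then have "(\<lambda>n. E C x - E (C - B n) x) \<longlonglongrightarrow> E C x - 0" by (intro tendsto_intros)
  moreover have "E C x - E (C - B n) x = E (B n) x" for n
  proof -
    have "B n \<union> (C - B n) = C" by (auto simp: C_def)
    then show ?thesis using E_Un[of "B n" "C - B n" x] B C by (simp add: sets.Diff)
  qed
  ultimately show ?thesis by (simp add: C_def)
qed

lemma E_fixed_mono: "B \<in> sets borel \<Longrightarrow> C \<in> sets borel \<Longrightarrow> B \<subseteq> C \<Longrightarrow> E B x = x \<Longrightarrow> E C x = x"
  using E_Int[of C B x] by (simp add: Int_absorb1)

end

section \<open>The contraction semigroup exp (i \<zeta> P) on the upper half plane\<close>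

locale positive_group = spectral_group +
  assumes positive: "E {..<0} = (\<lambda>_. 0)"
begin

lemma E_cutoff_tendsto: "(\<lambda>n. E {0..<real n} y) \<longlonglongrightarrow> y"
proof -
  have "(\<lambda>n. E {0..<real n} y) \<longlonglongrightarrow> E (\<Union>n. {0..<real n}) y"
    by (rule E_incseq_tendsto) (auto simp: incseq_def)
  also have "(\<Union>n. {0..<real n}) = {0..}" by (auto intro: reals_Archimedean2)
  also have "E {0..} y = y"
  proof -
    have "{..<0} \<union> {0..} = (UNIV :: real set)" by auto
    then show ?thesis using E_Un[of "{..<0}" "{0..}" y] positive by (simp add: E_UNIV disjoint_iff)
  qed
  finally show ?thesis .
qed

lemma orbit_0_real: "E {0..<real n} y = y \<Longrightarrow> orbit 0 (real n) (of_real s) y = U s y"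
  by (rule orbit_real) auto

text \<open>The part of exp (i \<zeta> P) with spectrum below n, which is entire in \<zeta>.\<close>

definition tr :: "nat \<Rightarrow> complex \<Rightarrow> 'a \<Rightarrow> 'a" where
  "tr n \<zeta> y = orbit 0 (real n) \<zeta> (E {0..<real n} y)"

text \<open>\<open>T \<zeta> = exp (i \<zeta> P)\<close> for \<open>Im \<zeta> \<ge> 0\<close>.\<close>

definition T :: "complex \<Rightarrow> 'a \<Rightarrow> 'a" where
  "T \<zeta> y = lim (\<lambda>n. tr n \<zeta> y)"

text \<open>Orbits built on different windows agree on common vectors, both being entire and equal
  to \<open>U\<close> on the real axis. The difference is then an orbit of the tail vector alone,
  contracted because the window starts at 0 and Im \<zeta> \<ge> 0.\<close>

lemma tr_diff_le:
  assumes "m \<le> n" "0 \<le> Im \<zeta>"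
  shows "norm (tr n \<zeta> y - tr m \<zeta> y) \<le> norm (E {0..<real n} y - E {0..<real m} y)"
proof -
  have fx: "E {0..<real n} (E {0..<real m} y) = E {0..<real m} y"
    by (rule E_fixed_mono[of "{0..<real m}"]) (use assms in \<open>auto simp: E_idem\<close>)
  have "tr m \<zeta> y = orbit 0 (real n) \<zeta> (E {0..<real m} y)"
    unfolding tr_def
    by (rule wholo_unique) (simp_all add: wholo_orbit orbit_0_real E_idem fx)
  then have "tr n \<zeta> y - tr m \<zeta> y = orbit 0 (real n) \<zeta> (E {0..<real n} y - E {0..<real m} y)"
    by (simp add: tr_def clinearD(5)[OF clinear_orbit])
  also have "norm \<dots> \<le> exp (- 0 * Im \<zeta>) * norm (E {0..<real n} y - E {0..<real m} y)"
    by (rule orbit_bounds(1)) (use assms in auto)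
  finally show ?thesis by simp
qed

lemma tr_tendsto: "0 \<le> Im \<zeta> \<Longrightarrow> (\<lambda>n. tr n \<zeta> y) \<longlonglongrightarrow> T \<zeta> y"
proof -
  assume \<zeta>: "0 \<le> Im \<zeta>"
  have "Cauchy (\<lambda>n. E {0..<real n} y)" using E_cutoff_tendsto LIMSEQ_imp_Cauchy by blast
  have le: "norm (tr m \<zeta> y - tr n \<zeta> y) \<le> norm (E {0..<real m} y - E {0..<real n} y)" for m n
    using tr_diff_le[OF _ \<zeta>, of m n y] tr_diff_le[OF _ \<zeta>, of n m y]
    by (cases "m \<le> n") (auto simp: norm_minus_commute)
  have "Cauchy (\<lambda>n. tr n \<zeta> y)"
  proof (rule CauchyI)
    fix e :: real assume "e > 0"
    then obtain N where "\<forall>m\<ge>N. \<forall>n\<ge>N. norm (E {0..<real m} y - E {0..<real n} y) < e"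
      using CauchyD[OF \<open>Cauchy (\<lambda>n. E {0..<real n} y)\<close>] by blast
    then show "\<exists>N. \<forall>m\<ge>N. \<forall>n\<ge>N. norm (tr m \<zeta> y - tr n \<zeta> y) < e"
      using le order_le_less_trans by blast
  qed
  then show ?thesis unfolding T_def by (simp add: Cauchy_convergent_iff convergent_LIMSEQ_iff)
qed

lemma T_diff_tr_le: "0 \<le> Im \<zeta> \<Longrightarrow> norm (T \<zeta> y - tr n \<zeta> y) \<le> norm (y - E {0..<real n} y)"
proof -
  assume \<zeta>: "0 \<le> Im \<zeta>"
  show ?thesis
  proof (rule LIMSEQ_le)
    show "(\<lambda>m. norm (tr m \<zeta> y - tr n \<zeta> y)) \<longlonglongrightarrow> norm (T \<zeta> y - tr n \<zeta> y)"
      by (intro tendsto_intros tr_tendsto \<zeta>)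
    show "(\<lambda>m. norm (E {0..<real m} y - E {0..<real n} y)) \<longlonglongrightarrow> norm (y - E {0..<real n} y)"
      by (intro tendsto_intros E_cutoff_tendsto)
    show "\<exists>N. \<forall>m\<ge>N. norm (tr m \<zeta> y - tr n \<zeta> y) \<le> norm (E {0..<real m} y - E {0..<real n} y)"
      using tr_diff_le[OF _ \<zeta>] by blast
  qed
qed

lemma tr_uniform: "uniform_limit {\<zeta>. 0 \<le> Im \<zeta>} (\<lambda>n \<zeta>. tr n \<zeta> y) (\<lambda>\<zeta>. T \<zeta> y) sequentially"
proof (rule uniform_limitI)
  fix e :: real assume "e > 0"
  then have "eventually (\<lambda>n. dist (E {0..<real n} y) y < e) sequentially"
    using E_cutoff_tendsto tendstoD by blast
  then show "\<forall>\<^sub>F n in sequentially. \<forall>\<zeta>\<in>{\<zeta>. 0 \<le> Im \<zeta>}. dist (tr n \<zeta> y) (T \<zeta> y) < e"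
  proof eventually_elim
    case (elim n)
    then show ?case
      using T_diff_tr_le[of _ y n] by (auto simp: dist_norm norm_minus_commute intro: order_le_less_trans)
  qed
qed

lemma T_real: "T (of_real s) y = U s y"
proof (rule LIMSEQ_unique)
  show "(\<lambda>n. tr n (of_real s) y) \<longlonglongrightarrow> T (of_real s) y" by (rule tr_tendsto) simp
  have "(\<lambda>n. U s (E {0..<real n} y)) \<longlonglongrightarrow> U s y"
    by (rule bounded_linear.tendsto[OF bounded_linear_U E_cutoff_tendsto])
  then show "(\<lambda>n. tr n (of_real s) y) \<longlonglongrightarrow> U s y"
    by (simp add: tr_def orbit_0_real E_idem)
qed

lemma norm_tr_le: "0 \<le> Im \<zeta> \<Longrightarrow> norm (tr n \<zeta> y) \<le> norm y"
  unfolding tr_def using orbit_bounds(1)[of "real n" \<zeta> 0 "E {0..<real n} y"] norm_E_le[of "{0..<real n}" y]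
  by simp

lemma norm_T_le: "0 \<le> Im \<zeta> \<Longrightarrow> norm (T \<zeta> y) \<le> norm y"
  by (rule LIMSEQ_le_const2[OF tendsto_norm[OF tr_tendsto]]) (use norm_tr_le in auto)

lemma T_diff: "0 \<le> Im \<zeta> \<Longrightarrow> T \<zeta> (x - y) = T \<zeta> x - T \<zeta> y"
proof -
  assume \<zeta>: "0 \<le> Im \<zeta>"
  have "tr n \<zeta> (x - y) = tr n \<zeta> x - tr n \<zeta> y" for n
    by (simp add: tr_def clinearD(5)[OF clinear_orbit] clinearD(5)[OF clinear_E])
  then show ?thesis
    using tr_tendsto[OF \<zeta>, of "x - y"] tendsto_diff[OF tr_tendsto[OF \<zeta>, of x] tr_tendsto[OF \<zeta>, of y]]
      LIMSEQ_unique by simp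
qed

lemma continuous_on_T: "continuous_on {\<zeta>. 0 \<le> Im \<zeta>} (\<lambda>\<zeta>. T \<zeta> y)"
proof (rule uniform_limit_theorem[OF _ tr_uniform])
  show "\<forall>\<^sub>F n in sequentially. continuous_on {\<zeta>. 0 \<le> Im \<zeta>} (\<lambda>\<zeta>. tr n \<zeta> y)"
    unfolding tr_def
    by (intro always_eventually allI continuous_on_subset[OF wholo_continuous_on[OF wholo_orbit]]) auto
qed simp

lemma wholo_T: "wholo (\<lambda>\<zeta>. T \<zeta> y) {\<zeta>. 0 < Im \<zeta>}"
proof (rule wholoI)
  have opn: "open {\<zeta>. 0 < Im \<zeta>}" by (rule open_halfspace_Im_gt)
  fix x
  show "(\<lambda>\<zeta>. cinner x (T \<zeta> y)) holomorphic_on {\<zeta>. 0 < Im \<zeta>}"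
  proof (rule holomorphic_uniform_sequence[OF opn])
    show "(\<lambda>\<zeta>. cinner x (tr n \<zeta> y)) holomorphic_on {\<zeta>. 0 < Im \<zeta>}" for n
      using wholo_orbit[of "real n" 0 "E {0..<real n} y"] holomorphic_on_subset[OF _ subset_UNIV]
      by (auto simp: wholo_def tr_def)
    fix \<zeta> assume "\<zeta> \<in> {\<zeta>. 0 < Im \<zeta>}"
    then obtain d where d: "d > 0" "cball \<zeta> d \<subseteq> {\<zeta>. 0 < Im \<zeta>}" using opn open_contains_cball by blast
    have "uniform_limit (cball \<zeta> d) (\<lambda>n \<zeta>. tr n \<zeta> y) (\<lambda>\<zeta>. T \<zeta> y) sequentially"
      by (rule uniform_limit_on_subset[OF tr_uniform]) (use d in auto)
    from d bounded_linear.uniform_limit[OF bounded_bilinear.bounded_linear_right[OF bounded_bilinear_cinner] this]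
    show "\<exists>d>0. cball \<zeta> d \<subseteq> {\<zeta>. 0 < Im \<zeta>} \<and>
        uniform_limit (cball \<zeta> d) (\<lambda>n \<zeta>. cinner x (tr n \<zeta> y)) (\<lambda>\<zeta>. cinner x (T \<zeta> y)) sequentially"
      by blast
  qed
next
  fix \<zeta> assume "\<zeta> \<in> {\<zeta>. 0 < Im \<zeta>}"
  moreover have "open {\<zeta>. 0 < Im \<zeta>}" by (rule open_halfspace_Im_gt)
  ultimately obtain d where d: "d > 0" "ball \<zeta> d \<subseteq> {\<zeta>. 0 < Im \<zeta>}" using openE by blast
  then have "\<forall>w\<in>ball \<zeta> d. norm (T w y) \<le> norm y" by (intro ballI norm_T_le) force
  then show "\<exists>e>0. \<exists>M. \<forall>w\<in>ball \<zeta> e. norm (T w y) \<le> M" using d(1) by blast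
qed

text \<open>On vectors of bounded spectral support both sides are entire and agree on the real axis,
  where this is unitarity of \<open>U\<close>. The map to minus the conjugate preserves the upper
  half plane, so the cut-off can be removed on both sides.\<close>

lemma T_adjoint:
  assumes \<zeta>: "0 \<le> Im \<zeta>"
  shows "cinner x (T \<zeta> y) = cinner (T (- cnj \<zeta>) x) y"
proof -
  have fin: "cinner x (orbit 0 (real n) \<zeta> y) = cinner (orbit 0 (real n) (- cnj \<zeta>) x) y"
    if xy: "E {0..<real n} x = x" "E {0..<real n} y = y" for n x y
  proof -
    have "wholo (\<lambda>z. orbit 0 (real n) (- z) x) UNIV"
      by (rule wholo_compose[OF wholo_orbit]) (auto intro!: holomorphic_intros)
    then have K: "wholo (\<lambda>z. orbit 0 (real n) (- z) x) (cnj ` UNIV)"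
      by (rule wholo_subset) simp
    define d where "d z = cinner x (orbit 0 (real n) z y) - cinner (orbit 0 (real n) (- cnj z) x) y" for z
    have hol: "d holomorphic_on UNIV"
      unfolding d_def using wholo_orbit[of "real n" 0 y] holomorphic_cinner_cnj[OF K]
      by (intro holomorphic_intros) (auto simp: wholo_def)
    have "d \<zeta> = 0"
    proof (rule analytic_continuation[OF hol open_UNIV connected_UNIV subset_UNIV UNIV_I zero_islimpt_of_real])
      fix z :: complex assume "z \<in> range of_real"
      then obtain s where z: "z = of_real s" by auto
      show "d z = 0"
        unfolding d_def z using orbit_0_real[OF xy(1), of "- s"] orbit_0_real[OF xy(2), of s]
        by (simp add: U_adjoint)
    qed simp
    then show ?thesis by (simp add: d_def)
  qed
  have \<zeta>': "0 \<le> Im (- cnj \<zeta>)" using \<zeta> by simp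
  have "(\<lambda>n. cinner (E {0..<real n} x) (tr n \<zeta> y)) \<longlonglongrightarrow> cinner x (T \<zeta> y)"
    by (intro tendsto_intros E_cutoff_tendsto tr_tendsto \<zeta>)
  moreover have "(\<lambda>n. cinner (tr n (- cnj \<zeta>) x) (E {0..<real n} y)) \<longlonglongrightarrow> cinner (T (- cnj \<zeta>) x) y"
    by (intro tendsto_intros E_cutoff_tendsto tr_tendsto \<zeta>')
  moreover have "cinner (E {0..<real n} x) (tr n \<zeta> y) = cinner (tr n (- cnj \<zeta>) x) (E {0..<real n} y)" for n
    unfolding tr_def by (rule fin) (simp_all add: E_idem)
  ultimately show ?thesis using LIMSEQ_unique by simp
qed

text \<open>Strong continuity of \<open>T\<close> handles the parameter; contractivity handles the
  vector, uniformly in the parameter.\<close>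

lemma continuous_on_T_compose:
  assumes X: "continuous_on S X" and g: "continuous_on S g" "\<And>z. z \<in> S \<Longrightarrow> 0 \<le> Im (g z)"
  shows "continuous_on S (\<lambda>z. T (g z) (X z))"
  unfolding continuous_on_def
proof
  fix z0 assume z0: "z0 \<in> S"
  have "continuous_on S (\<lambda>z. T (g z) (X z0))"
    by (rule continuous_on_compose2[OF continuous_on_T g(1)]) (use g(2) in auto)
  then have 1: "((\<lambda>z. T (g z) (X z0)) \<longlongrightarrow> T (g z0) (X z0)) (at z0 within S)"
    using z0 by (auto simp: continuous_on_def)
  have "((\<lambda>z. X z - X z0) \<longlongrightarrow> 0) (at z0 within S)"
    using X z0 by (auto simp: continuous_on_def intro: LIM_zero)
  then have "((\<lambda>z. norm (X z - X z0)) \<longlongrightarrow> 0) (at z0 within S)" by (rule tendsto_norm_zero)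
  moreover have "eventually (\<lambda>z. norm (T (g z) (X z) - T (g z) (X z0)) \<le> norm (X z - X z0)) (at z0 within S)"
    unfolding eventually_at_filter
    by (rule always_eventually) (use g(2) norm_T_le in \<open>auto simp flip: T_diff\<close>)
  ultimately have "((\<lambda>z. T (g z) (X z) - T (g z) (X z0)) \<longlongrightarrow> 0) (at z0 within S)"
    by (rule Lim_null_comparison[rotated])
  from tendsto_add[OF this 1] show "((\<lambda>z. T (g z) (X z)) \<longlongrightarrow> T (g z0) (X z0)) (at z0 within S)" by simp
qed

end

section \<open>Borchers' theorem\<close>

lemma Im_exp_2pi: "Im (exp (2 * of_real pi * z)) = exp (2 * pi * Re z) * sin (2 * pi * Im z)"
  by (simp add: Im_exp)

lemma Im_exp_strip: "z \<in> strip (1/2) \<Longrightarrow> 0 < Im (exp (2 * of_real pi * z))"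
  unfolding Im_exp_2pi using sin_gt_zero[of "2 * pi * Im z"] by (auto simp: strip_def field_simps)

lemma Im_exp_cstrip: "z \<in> cstrip (1/2) \<Longrightarrow> 0 \<le> Im (exp (2 * of_real pi * z))"
  unfolding Im_exp_2pi using sin_ge_zero[of "2 * pi * Im z"] by (auto simp: cstrip_def field_simps)

context standard_sub
begin

lemma R_H: "x \<in> H \<Longrightarrow> R x \<in> H"
  using q_P[of 0 x] P_fix[of x] P_in[of "R x"] by (simp add: q_0)

lemma q_real_R: "q (of_real t) x = R (D t x)"
  using q_add_real[of 0 t x] by (simp add: q_0)

lemma R_D: "R (D t x) = D t (R x)"
  by (simp add: D_R q_real_R)

lemma R_Hc: "x \<in> Hc \<Longrightarrow> R x \<in> Hc"
proof -
  have "Q (R x) = R (Q x)" for x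
    using q_P[of 0 "imult x"] clinearD[OF clinear_R] by (simp add: q_0 Q_def)
  then show "x \<in> Hc \<Longrightarrow> R x \<in> Hc" by (simp add: Hc_def clinearD(6)[OF clinear_R])
qed

end

locale half_sided = standard_sub H + positive_group U E
  for H :: "'a::complex_hilbert set" and U :: "real \<Rightarrow> 'a \<Rightarrow> 'a" and E :: "real set \<Rightarrow> 'a \<Rightarrow> 'a" +
  assumes half_sided: "0 \<le> s \<Longrightarrow> x \<in> H \<Longrightarrow> U s x \<in> H"
begin

text \<open>The function \<open>\<langle>q (cnj z) k, T (exp (2 \<pi> z)) (q z h)\<rangle>\<close> on the strip \<open>0 \<le> Im z \<le> 1/2\<close> is real on
  the lower edge because \<open>U s\<close> maps \<open>H\<close> into itself, and on the upper edge because there \<open>q\<close>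
  exchanges \<open>H\<close> and \<open>Hc\<close> while \<open>exp (2 \<pi> z)\<close> is negative; hence it is constant.\<close>

lemma borchers_form:
  assumes k: "k \<in> Hc" and h: "h \<in> H"
  shows "cinner (q (of_real t) k) (U (exp (2 * pi * t)) (q (of_real t) h)) = cinner (R k) (U 1 (R h))"
proof -
  define g where "g z = exp (2 * of_real pi * z)" for z :: complex
  define F where "F z = cinner (q (cnj z) k) (T (g z) (q z h))" for z
  have sub: "cstrip (1/2) \<subseteq> {z. \<bar>Im z\<bar> < 1}" "strip (1/2) \<subseteq> {z. \<bar>Im z\<bar> < 1}"
    by (auto simp: cstrip_def strip_def)
  note cq = wholo_continuous_on[OF wholo_q open_abs_Im_less]
  obtain K where K: "K \<ge> 0" "\<And>z x. \<bar>Im z\<bar> \<le> 1 \<Longrightarrow> norm (q z x) \<le> K * norm x"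
    by (rule q_bounded) blast
  have g_hol: "g holomorphic_on A" for A unfolding g_def by (intro holomorphic_intros)
  have cont: "continuous_on (cstrip (1/2)) F"
    unfolding F_def
  proof (intro continuous_on_cinner continuous_on_T_compose)
    show "continuous_on (cstrip (1/2)) (\<lambda>z. q (cnj z) k)"
      by (rule continuous_on_compose2[OF cq]) (auto intro!: continuous_intros simp: cstrip_def)
    show "continuous_on (cstrip (1/2)) (\<lambda>z. q z h)" by (rule continuous_on_subset[OF cq sub(1)])
    show "continuous_on (cstrip (1/2)) g" using g_hol holomorphic_on_imp_continuous_on by blast
    show "0 \<le> Im (g z)" if "z \<in> cstrip (1/2)" for z using Im_exp_cstrip[OF that] by (simp add: g_def)
  qed
  have L: "wholo (\<lambda>z. T (g z) (q z h)) (strip (1/2))"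
  proof (rule wholoI)
    fix w
    \<comment> \<open>The semigroup and the vector both depend on z. The adjoint of
      \<open>T (g z)\<close> is \<open>T\<close> at minus the conjugate, again in the upper half
      plane, so the semigroup can be moved to the other slot and holomorphy of sesquilinear products
      applies.\<close>
    have "wholo (\<lambda>z. T (- g z) w) (cnj ` strip (1/2))"
    proof (rule wholo_compose[OF wholo_T])
      show "(\<lambda>z. - g z) holomorphic_on cnj ` strip (1/2)" by (intro holomorphic_intros g_hol)
      show "(\<lambda>z. - g z) ` cnj ` strip (1/2) \<subseteq> {\<zeta>. 0 < Im \<zeta>}"
        using Im_exp_strip by (auto simp: g_def Im_exp_2pi)
      show "open (cnj ` strip (1/2))" by (rule open_cnj_image[OF open_strip])
    qed
    from holomorphic_cinner[OF wholo_subset[OF wholo_q sub(2)] this open_strip]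
    have "(\<lambda>z. cinner (T (- g (cnj z)) w) (q z h)) holomorphic_on strip (1/2)" .
    moreover have "cinner (T (- g (cnj z)) w) (q z h) = cinner w (T (g z) (q z h))" if "z \<in> strip (1/2)" for z
    proof -
      have "cnj (g z) = g (cnj z)" by (simp add: g_def exp_cnj)
      then show ?thesis using T_adjoint[of "g z" w "q z h"] Im_exp_strip[OF that] by (simp add: g_def)
    qed
    ultimately show "(\<lambda>z. cinner w (T (g z) (q z h))) holomorphic_on strip (1/2)"
      by (elim holomorphic_transform) simp
  next
    fix z assume z: "z \<in> strip (1/2)"
    obtain e where e: "e > 0" "ball z e \<subseteq> strip (1/2)" using openE[OF open_strip z] by blast
    have "norm (T (g w) (q w h)) \<le> K * norm h" if "w \<in> ball z e" for w
    proof -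
      have w: "w \<in> strip (1/2)" using that e by auto
      then have "norm (T (g w) (q w h)) \<le> norm (q w h)"
        using Im_exp_strip[OF w] by (intro norm_T_le) (simp add: g_def)
      also have "\<dots> \<le> K * norm h" using w by (intro K(2)) (auto simp: strip_def)
      finally show ?thesis .
    qed
    then show "\<exists>e>0. \<exists>M. \<forall>w\<in>ball z e. norm (T (g w) (q w h)) \<le> M" using e(1) by blast
  qed
  have hol: "F holomorphic_on strip (1/2)"
    unfolding F_def
    by (rule holomorphic_cinner[OF L wholo_subset[OF wholo_q] open_strip]) (auto simp: strip_def)
  have bdd: "cmod (F z) \<le> (K * norm k) * (K * norm h)" if z: "z \<in> cstrip (1/2)" for z
  proof -
    have "norm (q (cnj z) k) \<le> K * norm k" using z by (intro K(2)) (auto simp: cstrip_def)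
    moreover have "norm (T (g z) (q z h)) \<le> norm (q z h)"
      using Im_exp_cstrip[OF z] by (intro norm_T_le) (simp add: g_def)
    moreover have "norm (q z h) \<le> K * norm h" using z by (intro K(2)) (auto simp: cstrip_def)
    ultimately show ?thesis
      unfolding F_def using K(1) by (intro order_trans[OF cmod_cinner_le] mult_mono) auto
  qed
  have g_real: "g (of_real s) = of_real (exp (2 * pi * s))" for s
    by (simp add: g_def flip: exp_of_real)
  have bot: "Im (F (of_real s)) = 0" for s
    unfolding F_def g_real T_real q_real_R complex_cnj_complex_of_real
    by (intro Im_cinner_Hc_H R_Hc D_Hc k half_sided R_H D_H h) simp
  have top: "Im (F (Complex s (1/2))) = 0" for s
  proof -
    have z: "Complex s (1/2) = \<i> / 2 + of_real s" "cnj (Complex s (1/2)) = - (\<i> / 2) + of_real s"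
      by (simp_all add: complex_eq_iff)
    \<comment> \<open>On the upper edge the parameter is negative, so \<open>T\<close> is the
      inverse of a unitary with positive parameter; its adjoint therefore acts on the other slot,
      where the vector has become an element of H.\<close>
    have g: "g (Complex s (1/2)) = of_real (- exp (2 * pi * s))"
      by (simp add: g_def complex_eq_iff Re_exp Im_exp)
    have "q (Complex s (1/2)) h = J (R (D s h))"
      unfolding z(1) using q_add_real[of "\<i> / 2" s h] q_half_H[OF D_H[OF h]] by simp
    moreover have "q (cnj (Complex s (1/2))) k = J (R (D s k))"
      unfolding z(2) using q_add_real[of "- (\<i> / 2)" s k] q_minus_half_Hc[OF D_Hc[OF k]] by simp
    ultimately have "F (Complex s (1/2)) = cinner (U (exp (2 * pi * s)) (J (R (D s k)))) (J (R (D s h)))"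
      unfolding F_def g T_real U_adjoint by simp
    then show ?thesis
      using Im_cinner_H_Hc[OF J_R_H[OF D_H[OF h]] half_sided[OF _ J_R_Hc[OF D_Hc[OF k]]]] by simp
  qed
  have "F (of_real t) = F (of_real 0)"
    by (rule strip_real_boundary_const[OF _ cont hol bdd bot top]) simp_all
  then show ?thesis
    unfolding F_def g_real T_real by (simp add: q_0)
qed

text \<open>\<open>borchers_form\<close> says that the difference \<open>W\<close> of the conjugated
  and the original unitary has vanishing matrix elements between R k for k in the complement and R h
  for h in H. The complex spans of both real subspaces are dense and \<open>R\<close> is injective
  with dense range, so \<open>W\<close> vanishes.\<close>

theorem borchers: "U (exp (2 * pi * t)) x = D t (U 1 (D (- t) x))"
proof -
  define W where "W x = D (- t) (U (exp (2 * pi * t)) (D t x)) - U 1 x" for x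
  have bW: "bounded_linear W"
    unfolding W_def
    by (intro bounded_linear_sub bounded_linear_compose[OF bounded_linear_D]
        bounded_linear_compose[OF bounded_linear_U] bounded_linear_D bounded_linear_U)
  note lin = clinearD[OF clinear_D] clinearD[OF clinear_U]
  have W_imult: "W (imult x) = imult (W x)" for x by (simp add: W_def lin imult_diff)
  have D_adj: "cinner x (D (- t) y) = cinner (D t x) y" for x y
    using D_cinner[of t x "D (- t) y"] by (simp add: D_inverse)
  have z: "R (W (R h)) = 0" if h: "h \<in> H" for h
  proof -
    have kz: "cinner k (R (W (R h))) = 0" if k: "k \<in> Hc" for k
      unfolding R_adjoint[symmetric] W_def cinner_diff_right D_adj D_R
      using borchers_form[OF k h, of t] by simp
    have "inner k (R (W (R h))) = 0" for k
    proof (rule bounded_linear_eq_on_dense[OF bounded_linear_inner_left bounded_linear_zero Hc_dense])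
      fix y assume "y \<in> {k + imult k' | k k'. k \<in> Hc \<and> k' \<in> Hc}"
      then obtain a b where y: "y = a + imult b" "a \<in> Hc" "b \<in> Hc" by blast
      have "inner a (R (W (R h))) = Re 0" unfolding kz[OF y(2), symmetric] by simp
      moreover have "inner (imult b) (R (W (R h))) = Im 0" unfolding kz[OF y(3), symmetric] by (simp add: Im_cinner)
      ultimately show "inner y (R (W (R h))) = 0" by (simp add: y(1) inner_add_left)
    qed
    from this[of "R (W (R h))"] show ?thesis by simp
  qed
  have WR: "W (R y) = 0" for y
  proof (rule bounded_linear_eq_on_dense[OF bounded_linear_compose[OF bW bounded_linear_R] bounded_linear_zero H_dense])
    fix y assume "y \<in> {h + imult k | h k. h \<in> H \<and> k \<in> H}"
    then obtain a b where y: "y = a + imult b" "a \<in> H" "b \<in> H" by blast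
    have "W (R a) = 0" "W (R b) = 0" using z y R_inj by blast+
    then show "W (R y) = 0"
      unfolding y(1) clinearD(4)[OF clinear_R] clinearD(2)[OF clinear_R]
      by (simp add: W_imult linear_add[OF bounded_linear.linear[OF bW]])
  qed
  have "W y = 0" for y
    by (rule bounded_linear_eq_on_dense[OF bW bounded_linear_zero R_dense]) (use WR in auto)
  from this[of "D (- t) x"] have "D (- t) (U (exp (2 * pi * t)) x) = U 1 (D (- t) x)"
    by (simp add: W_def D_inverse)
  then show ?thesis using D_inverse[of t "U (exp (2 * pi * t)) x"] by simp
qed

end


section \<open>Comparison of two standard pairs\<close>

locale two_half_sided =
  p1: half_sided H U1 E1 + p2: half_sided H U2 E2
  for H :: "'a::complex_hilbert set" and U1 E1 U2 E2 +
  assumes inclusion: "U1 1 ` H \<subseteq> U2 1 ` H"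
begin

definition V :: "'a \<Rightarrow> 'a" where "V x = U2 (- 1) (U1 1 x)"

lemma clinear_V: "clinear V"
  using linear_compose[OF clinearD(1)[OF p1.clinear_U] clinearD(1)[OF p2.clinear_U]]
  by (simp add: clinear_def V_def[abs_def] o_def clinearD[OF p1.clinear_U] clinearD[OF p2.clinear_U])

lemma norm_V [simp]: "norm (V x) = norm x" by (simp add: V_def)

lemma bounded_linear_V: "bounded_linear V"
  by (rule isometry_bounded_linear[OF clinearD(1)[OF clinear_V] norm_V])

lemma V_H: "V ` H \<subseteq> H"
proof
  fix y assume "y \<in> V ` H"
  then obtain x where x: "x \<in> H" "y = V x" by auto
  then obtain x' where "x' \<in> H" "U1 1 x = U2 1 x'" using inclusion by blast
  then show "y \<in> H" using x by (simp add: V_def)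
qed

lemma cinner_V: "cinner x (V y) = cinner (U2 1 x) (U1 1 y)"
  unfolding V_def p2.U_adjoint by simp

lemma cinner_U2_U1: "cinner (U2 (exp (2 * pi * t)) x) (U1 (exp (2 * pi * t)) y)
    = cinner (p1.D (- t) x) (V (p1.D (- t) y))"
  unfolding p1.borchers p2.borchers p1.D_cinner cinner_V ..

text \<open>Formally the matrix element of \<Delta>^(- i z) V \<Delta>^(i z) between
  \<open>p1.R x\<close> and \<open>p1.R y\<close>, with the two powers of \<Delta> split over the
  slots. At real t this is the product of the two groups at parameter exp (2 pi t), and at i/2 it is
  V conjugated by \<Delta>^(1/2).\<close>

definition form :: "'a \<Rightarrow> 'a \<Rightarrow> complex \<Rightarrow> complex" where
  "form x y z = cinner (p1.q (- cnj z) x) (V (p1.q (- z) y))"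

lemma wholo_q_minus: "wholo (\<lambda>z. p1.q (- z) x) {z. \<bar>Im z\<bar> < 1}"
  by (rule wholo_compose[OF p1.wholo_q _ _ open_abs_Im_less]) (auto intro!: holomorphic_intros)

lemma form_holomorphic: "form x y holomorphic_on {z. \<bar>Im z\<bar> < 1}"
  unfolding form_def
proof (rule holomorphic_cinner[where K = "\<lambda>z. p1.q (- z) x", OF _ _ open_abs_Im_less])
  have adj: "cinner w (V u) = cinner (U1 (- 1) (U2 1 w)) u" for w u
    unfolding cinner_V p1.U_adjoint ..
  show "wholo (\<lambda>z. V (p1.q (- z) y)) {z. \<bar>Im z\<bar> < 1}"
    using wholo_q_minus[of y] unfolding wholo_def adj norm_V by blast
  show "wholo (\<lambda>z. p1.q (- z) x) (cnj ` {z. \<bar>Im z\<bar> < 1})"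
    by (rule wholo_subset[OF wholo_q_minus]) auto
qed

lemma cstrip_sub: "cstrip (1/2) \<subseteq> {z. \<bar>Im z\<bar> < 1}" "strip (1/2) \<subseteq> {z. \<bar>Im z\<bar> < 1}"
  by (auto simp: cstrip_def strip_def)

lemma form_real: "form x y (of_real t) = cinner (p1.D (- t) (p1.R x)) (V (p1.D (- t) (p1.R y)))"
  using p1.q_real_R[of "- t"] by (simp add: form_def p1.R_D)

text \<open>\<open>V\<close> is isometric on the lower edge and J V J on the upper one. The three
  lines theorem replaces the constant of the a priori bound by 1 and leaves only the norms of the
  regularised vectors, which is what permits removing the regularisation.\<close>

lemma form_le: "z \<in> cstrip (1/2) \<Longrightarrow> cmod (form x y z) \<le> norm (p1.R x) * norm (p1.R y)"
proof -
  assume z: "z \<in> cstrip (1/2)"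
  obtain K where K: "K \<ge> 0" "\<And>z x. \<bar>Im z\<bar> \<le> 1 \<Longrightarrow> norm (p1.q z x) \<le> K * norm x"
    by (rule p1.q_bounded) blast
  show ?thesis
  proof (rule phragmen_lindelof_strip[where f = "form x y", OF _ _ _ _ _ z])
    show "continuous_on (cstrip (1/2)) (form x y)"
      using holomorphic_on_imp_continuous_on[OF form_holomorphic] cstrip_sub continuous_on_subset by blast
    show "form x y holomorphic_on strip (1/2)"
      using form_holomorphic cstrip_sub holomorphic_on_subset by blast
    show "cmod (form x y w) \<le> (K * norm x) * (K * norm y)" if "w \<in> cstrip (1/2)" for w
      unfolding form_def using that K(1)
      by (intro order_trans[OF cmod_cinner_le] mult_mono) (auto intro!: K(2) simp: cstrip_def)
    show "cmod (form x y (of_real t)) \<le> norm (p1.R x) * norm (p1.R y)" for t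
      unfolding form_real by (rule order_trans[OF cmod_cinner_le]) simp
    show "cmod (form x y (Complex t (1/2))) \<le> norm (p1.R x) * norm (p1.R y)" for t
    proof -
      have z: "- cnj (Complex t (1/2)) = \<i> / 2 + of_real (- t)" "- Complex t (1/2) = - (\<i> / 2) + of_real (- t)"
        by (simp_all add: complex_eq_iff)
      have "p1.q (- cnj (Complex t (1/2))) x = p1.q (\<i> / 2) (p1.D (- t) x)"
        unfolding z by (rule p1.q_add_real) simp
      moreover have "p1.q (- Complex t (1/2)) y = p1.q (- (\<i> / 2)) (p1.D (- t) y)"
        unfolding z by (rule p1.q_add_real) simp
      ultimately have "form x y (Complex t (1/2))
          = cinner (p1.R (p1.D (- t) x)) (p1.J (V (p1.J (p1.R (p1.D (- t) y)))))"
        unfolding form_def by (simp only: p1.q_half_sandwich[OF bounded_linear_V clinear_V V_H])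
      then show ?thesis by (simp add: p1.R_D order_trans[OF cmod_cinner_le])
    qed
  qed
qed

lemma form_diff: "form (x - x') y z = form x y z - form x' y z" "form x (y - y') z = form x y z - form x y' z"
  if "\<bar>Im z\<bar> \<le> 1"
  using that clinearD(5)[OF clinear_V] clinearD(5)[OF p1.clinear_q[of "- z"]] clinearD(5)[OF p1.clinear_q[of "- cnj z"]]
  by (simp_all add: form_def cinner_diff_left cinner_diff_right)

text \<open>For \<open>\<zeta> = exp (2 \<pi> z)\<close> in the upper half plane, the value at \<open>z\<close> is the matrix element of
  \<open>exp (- i \<zeta> P\<^sub>2) exp (i \<zeta> P\<^sub>1)\<close>, which is therefore a contraction.\<close>

lemma product_extension:
  obtains W where "continuous_on (cstrip (1/2)) W" "W holomorphic_on strip (1/2)"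
    "\<forall>z\<in>cstrip (1/2). cmod (W z) \<le> norm x * norm y"
    "\<forall>t. W (of_real t) = cinner (U2 (exp (2 * pi * t)) x) (U1 (exp (2 * pi * t)) y)"
proof -
  note ex = dense_range_sequence[OF p1.R_dense]
  obtain a where a: "(\<lambda>n. p1.R (a n)) \<longlonglongrightarrow> x" using ex[of x] by blast
  obtain b where b: "(\<lambda>n. p1.R (b n)) \<longlonglongrightarrow> y" using ex[of y] by blast
  have R_diff: "p1.R (u - v) = p1.R u - p1.R v" for u v by (rule clinearD(5)[OF p1.clinear_R])
  define F where "F n = form (a n) (b n)" for n
  obtain Ka where Ka: "\<And>n. norm (p1.R (a n)) \<le> Ka" "Ka > 0"
    using convergent_imp_Bseq[of "\<lambda>n. p1.R (a n)"] a by (auto simp: convergent_def Bseq_def)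
  obtain Kb where Kb: "\<And>n. norm (p1.R (b n)) \<le> Kb" "Kb > 0"
    using convergent_imp_Bseq[of "\<lambda>n. p1.R (b n)"] b by (auto simp: convergent_def Bseq_def)
  have diff: "cmod (F m z - F n z) \<le> norm (p1.R (a m) - p1.R (a n)) * Kb + Ka * norm (p1.R (b m) - p1.R (b n))"
    if z: "z \<in> cstrip (1/2)" for m n z
  proof -
    have z1: "\<bar>Im z\<bar> \<le> 1" using z cstrip_sub by force
    have "F m z - F n z = form (a m - a n) (b m) z + form (a n) (b m - b n) z"
      by (simp add: F_def form_diff[OF z1])
    also have "cmod \<dots> \<le> norm (p1.R (a m - a n)) * norm (p1.R (b m)) + norm (p1.R (a n)) * norm (p1.R (b m - b n))"
      using form_le[OF z] by (intro order_trans[OF norm_triangle_ineq] add_mono)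
    also have "\<dots> \<le> norm (p1.R (a m - a n)) * Kb + Ka * norm (p1.R (b m - b n))"
      using Ka Kb by (intro add_mono mult_left_mono mult_right_mono) auto
    finally show ?thesis by (simp add: R_diff)
  qed
  \<comment> \<open>By \<open>form_le\<close> the forms are controlled by \<open>p1.R (a n)\<close>
    and \<open>p1.R (b n)\<close> alone, so convergence of these vectors gives convergence uniform
    up to the edges.\<close>
  have "uniformly_Cauchy_on (cstrip (1/2)) F"
    unfolding uniformly_Cauchy_on_def dist_norm
  proof (intro allI impI)
    fix e :: real assume e: "e > 0"
    have "e / (2 * Kb) > 0" "e / (2 * Ka) > 0" using e Ka Kb by auto
    then obtain N1 N2 where N1: "\<forall>m\<ge>N1. \<forall>n\<ge>N1. norm (p1.R (a m) - p1.R (a n)) < e / (2 * Kb)"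
      and N2: "\<forall>m\<ge>N2. \<forall>n\<ge>N2. norm (p1.R (b m) - p1.R (b n)) < e / (2 * Ka)"
      using CauchyD[OF LIMSEQ_imp_Cauchy[OF a]] CauchyD[OF LIMSEQ_imp_Cauchy[OF b]] by meson
    have "cmod (F m z - F n z) < e" if "z \<in> cstrip (1/2)" "m \<ge> max N1 N2" "n \<ge> max N1 N2" for z m n
    proof -
      have "norm (p1.R (a m) - p1.R (a n)) * Kb < e / (2 * Kb) * Kb"
        using N1 that Kb(2) by (intro mult_strict_right_mono) auto
      moreover have "Ka * norm (p1.R (b m) - p1.R (b n)) < Ka * (e / (2 * Ka))"
        using N2 that Ka(2) by (intro mult_strict_left_mono) auto
      ultimately show ?thesis using diff[OF that(1), of m n] Ka(2) Kb(2) by simp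
    qed
    then show "\<exists>M. \<forall>z\<in>cstrip (1/2). \<forall>m\<ge>M. \<forall>n\<ge>M. norm (F m z - F n z) < e" by blast
  qed
  then obtain W where W: "uniform_limit (cstrip (1/2)) F W sequentially"
    using Cauchy_uniformly_convergent uniformly_convergent_on_def by blast
  have lim: "(\<lambda>n. F n z) \<longlonglongrightarrow> W z" if "z \<in> cstrip (1/2)" for z
    by (rule tendsto_uniform_limitI[OF W that])
  show thesis
  proof (rule that[of W])
    show "continuous_on (cstrip (1/2)) W"
    proof (rule uniform_limit_theorem[OF _ W])
      have "continuous_on (cstrip (1/2)) (F n)" for n
        unfolding F_def using holomorphic_on_imp_continuous_on[OF form_holomorphic] cstrip_sub continuous_on_subset by blast
      then show "\<forall>\<^sub>F n in sequentially. continuous_on (cstrip (1/2)) (F n)" by simp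
    qed simp
    show "W holomorphic_on strip (1/2)"
    proof (rule holomorphic_uniform_sequence[OF open_strip])
      show "F n holomorphic_on strip (1/2)" for n
        unfolding F_def using form_holomorphic cstrip_sub holomorphic_on_subset by blast
      fix z :: complex assume "z \<in> strip (1/2)"
      then obtain d where d: "d > 0" "cball z d \<subseteq> strip (1/2)" using open_strip open_contains_cball by blast
      then have "cball z d \<subseteq> cstrip (1/2)" using strip_subset_cstrip by blast
      then show "\<exists>d>0. cball z d \<subseteq> strip (1/2) \<and> uniform_limit (cball z d) F W sequentially"
        using d uniform_limit_on_subset[OF W] by blast
    qed
    show "\<forall>z\<in>cstrip (1/2). cmod (W z) \<le> norm x * norm y"
    proof
      fix z assume z: "z \<in> cstrip (1/2)"
      show "cmod (W z) \<le> norm x * norm y"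
      proof (rule LIMSEQ_le[OF tendsto_norm[OF lim[OF z]]])
        show "(\<lambda>n. norm (p1.R (a n)) * norm (p1.R (b n))) \<longlonglongrightarrow> norm x * norm y"
          by (intro tendsto_intros a b)
        show "\<exists>N. \<forall>n\<ge>N. norm (F n z) \<le> norm (p1.R (a n)) * norm (p1.R (b n))"
          unfolding F_def using form_le[OF z] by blast
      qed
    qed
    show "\<forall>t. W (of_real t) = cinner (U2 (exp (2 * pi * t)) x) (U1 (exp (2 * pi * t)) y)"
    proof
      fix t
      show "W (of_real t) = cinner (U2 (exp (2 * pi * t)) x) (U1 (exp (2 * pi * t)) y)"
      proof (rule LIMSEQ_unique[OF lim])
        show "of_real t \<in> cstrip (1/2)" by (simp add: cstrip_def)
        show "(\<lambda>n. F n (of_real t)) \<longlonglongrightarrow> cinner (U2 (exp (2 * pi * t)) x) (U1 (exp (2 * pi * t)) y)"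
          unfolding F_def form_real cinner_U2_U1
          by (intro tendsto_cinner bounded_linear.tendsto[OF bounded_linear_V]
              bounded_linear.tendsto[OF p1.bounded_linear_D] a b)
      qed
    qed
  qed
qed

text \<open>The entire function \<open>f \<zeta> = \<langle>exp (i (cnj \<zeta>) P\<^sub>2) y, exp (i \<zeta> P\<^sub>1) x\<rangle>\<close> is bounded on the upper half
  plane by the contraction property above and decays like \<open>exp ((a2 - b1) Im \<zeta>)\<close> in the lower one
  by the spectral supports of \<open>x\<close> and \<open>y\<close>, so it vanishes by Liouville's theorem.\<close>

lemma spectral_orthogonal_separated:
  assumes ab: "0 \<le> a1" "a1 \<le> b1" "b1 < a2" "a2 \<le> b2"
    and y: "E2 {a2..<b2} y = y" and x: "E1 {a1..<b1} x = x"
  shows "cinner y x = 0"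
proof -
  define Y where "Y \<zeta> = p2.orbit a2 (b2 - a2) \<zeta> y" for \<zeta>
  define X where "X \<zeta> = p1.orbit a1 (b1 - a1) \<zeta> x" for \<zeta>
  have wY: "wholo Y UNIV" and wX: "wholo X UNIV"
    unfolding Y_def X_def using p1.wholo_orbit p2.wholo_orbit ab by auto
  have Yr: "Y (of_real s) = U2 s y" and Xr: "X (of_real s) = U1 s x" for s
    unfolding Y_def X_def using p1.orbit_real[of "b1 - a1" a1] p2.orbit_real[of "b2 - a2" a2] ab x y by auto
  have Yb: "0 \<le> Im \<zeta> \<Longrightarrow> norm (Y \<zeta>) \<le> exp (- a2 * Im \<zeta>) * norm y"
    "Im \<zeta> \<le> 0 \<Longrightarrow> norm (Y \<zeta>) \<le> exp (- b2 * Im \<zeta>) * norm y" for \<zeta>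
    unfolding Y_def using p2.orbit_bounds[of "b2 - a2" \<zeta> a2 y] ab by auto
  have Xb: "0 \<le> Im \<zeta> \<Longrightarrow> norm (X \<zeta>) \<le> exp (- a1 * Im \<zeta>) * norm x"
    "Im \<zeta> \<le> 0 \<Longrightarrow> norm (X \<zeta>) \<le> exp (- b1 * Im \<zeta>) * norm x" for \<zeta>
    unfolding X_def using p1.orbit_bounds[of "b1 - a1" \<zeta> a1 x] ab by auto
  define f where "f \<zeta> = cinner (Y (cnj \<zeta>)) (X \<zeta>)" for \<zeta>
  have f_hol: "f holomorphic_on UNIV"
    unfolding f_def by (rule holomorphic_cinner[OF wX wholo_subset[OF wY] open_UNIV]) auto
  have f_up: "cmod (f \<zeta>) \<le> exp (b2 * Im \<zeta>) * (norm y * norm x)" if "0 \<le> Im \<zeta>" for \<zeta>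
  proof -
    have "norm (Y (cnj \<zeta>)) \<le> exp (b2 * Im \<zeta>) * norm y" using Yb(2)[of "cnj \<zeta>"] that by simp
    moreover have "norm (X \<zeta>) \<le> 1 * norm x"
      using Xb(1)[OF that] ab that by (elim order_trans) (intro mult_right_mono, auto)
    ultimately have "cmod (f \<zeta>) \<le> (exp (b2 * Im \<zeta>) * norm y) * (1 * norm x)"
      unfolding f_def by (intro order_trans[OF cmod_cinner_le] mult_mono) auto
    then show ?thesis by simp
  qed
  have f_low: "cmod (f \<zeta>) \<le> exp ((a2 - b1) * Im \<zeta>) * (norm y * norm x)" if "Im \<zeta> \<le> 0" for \<zeta>
  proof -
    have "norm (Y (cnj \<zeta>)) \<le> exp (a2 * Im \<zeta>) * norm y" using Yb(1)[of "cnj \<zeta>"] that by simp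
    moreover have "norm (X \<zeta>) \<le> exp (- b1 * Im \<zeta>) * norm x" using Xb(2)[OF that] .
    ultimately have "cmod (f \<zeta>) \<le> (exp (a2 * Im \<zeta>) * norm y) * (exp (- b1 * Im \<zeta>) * norm x)"
      unfolding f_def by (intro order_trans[OF cmod_cinner_le] mult_mono) auto
    also have "\<dots> = exp ((a2 - b1) * Im \<zeta>) * (norm y * norm x)"
      by (simp add: algebra_simps flip: exp_add)
    finally show ?thesis .
  qed
  obtain W where W: "continuous_on (cstrip (1/2)) W" "W holomorphic_on strip (1/2)"
    "\<forall>z\<in>cstrip (1/2). cmod (W z) \<le> norm y * norm x"
    "\<forall>t. W (of_real t) = cinner (U2 (exp (2 * pi * t)) y) (U1 (exp (2 * pi * t)) x)"
    by (rule product_extension)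
  define g where "g z = exp (2 * of_real pi * z)" for z :: complex
  have g_hol: "g holomorphic_on A" for A unfolding g_def by (intro holomorphic_intros)
  have fg_hol: "(\<lambda>z. f (g z)) holomorphic_on A" for A
    using holomorphic_on_compose_gen[OF g_hol f_hol, of A] by (simp add: o_def)
  \<comment> \<open>The available bound on \<open>f\<close> grows like exp (b2 Im \<zeta>), whereas
    uniqueness on the strip asks for a bounded function; the exponential factor cancels this growth
    and never vanishes.\<close>
  define d where "d z = exp (\<i> * of_real b2 * g z) * (f (g z) - W z)" for z
  have fW: "f (g z) = W z" if z: "z \<in> strip (1/2)" for z
  proof -
    have "d z = 0"
    proof (rule strip_unique[where b = "1/2" and f = d, OF _ _ _ _ _ z])
      show "continuous_on (cstrip (1/2)) d"
        unfolding d_def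
        by (intro continuous_intros W(1) holomorphic_on_imp_continuous_on[OF g_hol]
            holomorphic_on_imp_continuous_on[OF fg_hol])
      show "d holomorphic_on strip (1/2)"
        unfolding d_def using W(2) g_hol fg_hol by (intro holomorphic_intros) auto
      show "cmod (d w) \<le> 2 * (norm y * norm x)" if w: "w \<in> cstrip (1/2)" for w
      proof -
        have i: "0 \<le> Im (g w)" using Im_exp_cstrip[OF w] by (simp add: g_def)
        have "cmod (f (g w) - W w) \<le> exp (b2 * Im (g w)) * (norm y * norm x) + 1 * (norm y * norm x)"
          using f_up[OF i] W(3) w by (intro order_trans[OF norm_triangle_ineq4] add_mono) auto
        also have "\<dots> \<le> exp (b2 * Im (g w)) * (norm y * norm x) + exp (b2 * Im (g w)) * (norm y * norm x)"
          using i ab by (intro add_mono mult_right_mono) auto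
        finally have le: "cmod (f (g w) - W w) \<le> exp (b2 * Im (g w)) * (2 * (norm y * norm x))" by (simp add: mult_ac)
        have "cmod (d w) = exp (- (b2 * Im (g w))) * cmod (f (g w) - W w)"
          by (simp add: d_def norm_mult)
        also have "\<dots> \<le> exp (- (b2 * Im (g w))) * (exp (b2 * Im (g w)) * (2 * (norm y * norm x)))"
          using le by (rule mult_left_mono) simp
        also have "\<dots> = 2 * (norm y * norm x)" by (simp add: exp_minus)
        finally show ?thesis .
      qed
      show "d (of_real t) = 0" for t
      proof -
        have "g (of_real t) = of_real (exp (2 * pi * t))" by (simp add: g_def flip: exp_of_real)
        then show ?thesis using W(4) by (simp add: d_def f_def Xr Yr del: of_real_exp)
      qed
    qed simp
    then show ?thesis by (simp add: d_def)
  qed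
  have f_bdd: "cmod (f \<zeta>) \<le> norm y * norm x" for \<zeta>
  proof (cases "0 < Im \<zeta>")
    case True
    \<comment> \<open>The inverse of \<open>g\<close> on the open strip: the principal logarithm has
      imaginary part strictly between 0 and pi on the upper half plane.\<close>
    define z where "z = Ln \<zeta> / (2 * of_real pi)"
    have \<zeta>0: "\<zeta> \<noteq> 0" using True by auto
    have "g z = \<zeta>" by (simp add: g_def z_def \<zeta>0)
    moreover have "z \<in> strip (1/2)"
      using True Im_Ln_pos_lt[OF \<zeta>0] Im_Ln_less_pi[of \<zeta>]
      by (auto simp: strip_def z_def Im_divide power2_eq_square field_simps)
    ultimately show ?thesis using fW W(3) strip_subset_cstrip by (metis subsetD)
  next
    case False
    then have "exp ((a2 - b1) * Im \<zeta>) \<le> 1" using ab by (simp add: mult_nonneg_nonpos)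
    then have "exp ((a2 - b1) * Im \<zeta>) * (norm y * norm x) \<le> 1 * (norm y * norm x)"
      by (rule mult_right_mono) simp
    then show ?thesis using f_low[of \<zeta>] False by simp
  qed
  have "bounded (range f)" using f_bdd by (auto simp: bounded_iff)
  then obtain c where c: "\<And>\<zeta>. f \<zeta> = c"
    using Liouville_theorem[OF f_hol] by (auto simp: constant_on_def)
  have "(\<lambda>n. exp (- (a2 - b1) * real n) * (norm y * norm x)) \<longlonglongrightarrow> 0"
    using ab by real_asymp
  moreover have "cmod c \<le> exp (- (a2 - b1) * real n) * (norm y * norm x)" for n
    using f_low[of "- \<i> * of_nat n"] c by (simp add: algebra_simps)
  ultimately have "cmod c \<le> 0" by (intro LIMSEQ_le_const) auto
  moreover have "f 0 = cinner y x"
    using Xr[of 0] Yr[of 0] by (simp add: f_def)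
  ultimately show ?thesis using c by simp
qed

lemma spectral_orthogonal:
  assumes ab: "0 \<le> a1" "a1 \<le> b1" "b1 \<le> a2" "a2 \<le> b2"
  shows "cinner (E2 {a2..<b2} y) (E1 {a1<..<b1} x) = 0"
proof (cases "a1 = b1")
  case False
  then have a1b1: "a1 < b1" using ab by simp
  define u where "u = E1 {a1<..<b1} x"
  have "(\<lambda>n. E1 {a1..<b1 - 1 / real (Suc n)} u) \<longlonglongrightarrow> E1 (\<Union>n. {a1..<b1 - 1 / real (Suc n)}) u"
    by (rule p1.E_incseq_tendsto) (auto simp: incseq_def intro!: frac_le elim!: order_less_le_trans)
  also have "E1 (\<Union>n. {a1..<b1 - 1 / real (Suc n)}) u = u"
  proof (rule p1.E_fixed_mono[of "{a1<..<b1}"])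
    show "{a1<..<b1} \<subseteq> (\<Union>n. {a1..<b1 - 1 / real (Suc n)})"
    proof
      fix l assume l: "l \<in> {a1<..<b1}"
      then obtain n where "1 / real (Suc n) < b1 - l" using reals_Archimedean[of "b1 - l"] by (auto simp: inverse_eq_divide)
      then show "l \<in> (\<Union>n. {a1..<b1 - 1 / real (Suc n)})" using l by (intro UN_I[of n]) auto
    qed
    show "E1 {a1<..<b1} u = u" by (simp add: u_def p1.E_idem)
  qed auto
  finally have lim: "(\<lambda>n. E1 {a1..<b1 - 1 / real (Suc n)} u) \<longlonglongrightarrow> u" .
  have "eventually (\<lambda>n. 1 / real (Suc n) < b1 - a1) sequentially"
    using a1b1 by real_asymp
  then have "eventually (\<lambda>n. cinner (E2 {a2..<b2} y) (E1 {a1..<b1 - 1 / real (Suc n)} u) = 0) sequentially"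
  proof eventually_elim
    case (elim n)
    have "0 < 1 / real (Suc n)" by simp
    then have "b1 - 1 / real (Suc n) < a2" using ab by linarith
    with elim show ?case
      by (intro spectral_orthogonal_separated[of a1 "b1 - 1 / real (Suc n)" a2 b2] ab)
         (simp_all add: p1.E_idem p2.E_idem)
  qed
  then have "(\<lambda>n. cinner (E2 {a2..<b2} y) (E1 {a1..<b1 - 1 / real (Suc n)} u)) \<longlonglongrightarrow> 0"
    by (rule tendsto_eventually)
  moreover have "(\<lambda>n. cinner (E2 {a2..<b2} y) (E1 {a1..<b1 - 1 / real (Suc n)} u)) \<longlonglongrightarrow> cinner (E2 {a2..<b2} y) u"
    by (intro tendsto_intros lim)
  ultimately show ?thesis using LIMSEQ_unique unfolding u_def by blast
qed simp

text \<open>The range of E1 (0, 1) is orthogonal to that of E2 on [1, \<infinity>), and E2 vanishes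
  on (- \<infinity>, 0]. So E2 (0, 1) fixes it, and the adjoint identity E1 E2 = E1 for these
  projections turns this into an inequality of norms.\<close>

lemma spectral_projection_le:
  assumes zero: "E2 {0} = (\<lambda>_. 0)"
  shows "inner x (E1 {0<..<1} x) \<le> inner x (E2 {0<..<1} x)"
proof -
  have E2E1: "E2 {0<..<1} (E1 {0<..<1} x) = E1 {0<..<1} x" for x
  proof -
    define u where "u = E1 {0<..<1} x"
    have "E2 {1..<1 + real n} u = 0" for n
    proof (rule cinner_eqI)
      fix y
      show "cinner y (E2 {1..<1 + real n} u) = cinner y 0"
        using spectral_orthogonal[of 0 1 1 "1 + real n" y x] by (simp add: u_def p2.E_adjoint)
    qed
    moreover have "(\<lambda>n. E2 {1..<1 + real n} u) \<longlonglongrightarrow> E2 (\<Union>n. {1..<1 + real n}) u"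
      by (rule p2.E_incseq_tendsto) (auto simp: incseq_def)
    ultimately have "E2 (\<Union>n. {1..<1 + real n}) u = 0" by (simp add: LIMSEQ_const_iff)
    moreover have "(\<Union>n. {1..<1 + real n}) = {1..}"
    proof -
      have "\<exists>n. l < 1 + real n" for l using reals_Archimedean2[of "l - 1"] by (auto simp: algebra_simps)
      then show ?thesis by auto
    qed
    ultimately have "E2 {1..} u = 0" by simp
    moreover have "E2 ({..<0} \<union> {0}) u = E2 {..<0} u + E2 {0} u" by (rule p2.E_Un) auto
    then have "E2 ({..<0} \<union> {0}) u = 0" using p2.positive zero by simp
    moreover have "E2 (({..<0} \<union> {0}) \<union> {1..}) u = E2 ({..<0} \<union> {0}) u + E2 {1..} u" by (rule p2.E_Un) auto
    moreover have "E2 ({0<..<1} \<union> (({..<0} \<union> {0}) \<union> {1..})) u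
        = E2 {0<..<1} u + E2 (({..<0} \<union> {0}) \<union> {1..}) u" by (rule p2.E_Un) auto
    moreover have "{0<..<1} \<union> (({..<0} \<union> {0}) \<union> {1..}) = (UNIV :: real set)" by auto
    ultimately show ?thesis by (simp add: p2.E_UNIV u_def)
  qed
  have "E1 {0<..<1} (E2 {0<..<1} x) = E1 {0<..<1} x"
  proof (rule cinner_eqI)
    fix y
    have "cinner y (E1 {0<..<1} (E2 {0<..<1} x)) = cinner (E2 {0<..<1} (E1 {0<..<1} y)) x"
      by (simp add: p1.E_adjoint p2.E_adjoint)
    then show "cinner y (E1 {0<..<1} (E2 {0<..<1} x)) = cinner y (E1 {0<..<1} x)"
      by (simp add: E2E1 p1.E_adjoint)
  qed
  then have "norm (E1 {0<..<1} x) \<le> norm (E2 {0<..<1} x)"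
    using p1.norm_E_le[of "{0<..<1}" "E2 {0<..<1} x"] by simp
  then show ?thesis by (simp add: p1.inner_E_self p2.inner_E_self)
qed

end

text \<open>\<open>standard_pair\<close> supplies some spectral measure without negative part,
  whereas the locale speaks of the given \<open>E\<close>; uniqueness of the norms of spectral
  projections transfers positivity.\<close>

lemma half_sided_standard_pair:
  assumes "standard_pair H U" "spectral_measure_of U E"
  shows "half_sided H U E"
proof -
  obtain E' where E': "spectral_measure_of U E'" "E' {..<0} = (\<lambda>_. 0)" and H: "standard_subspace H"
    and U: "unitary_group U" and hs: "\<forall>s\<ge>0. U s ` H \<subseteq> H"
    using assms(1) unfolding standard_pair_def by blast
  have sg: "spectral_group U E" "spectral_group U E'" using assms(2) E' U by (auto intro: spectral_group.intro)
  have "norm (E {..<0} x) = norm (E' {..<0} x)" for x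
    by (rule spectral_group_norm_unique[OF sg]) simp
  then have "E {..<0} = (\<lambda>_. 0)" using E'(2) by auto
  then show ?thesis
    using H sg(1) hs by (auto intro!: half_sided.intro standard_sub.intro positive_group.intro
        positive_group_axioms.intro half_sided_axioms.intro)
qed

theorem mainTheorem6:
  fixes H :: "'a::complex_hilbert set"
    and U1 U2 :: "real \<Rightarrow> 'a \<Rightarrow> 'a"
    and E1 E2 :: "real set \<Rightarrow> 'a \<Rightarrow> 'a"
  assumes "nondegenerate_standard_pair H U1"
    and "nondegenerate_standard_pair H U2"
    and "spectral_measure_of U1 E1"
    and "spectral_measure_of U2 E2"
    and "U1 1 ` H \<subseteq> U2 1 ` H"
  shows "(\<forall>a1 b1 a2 b2::real. 0 < a1 \<and> a1 \<le> b1 \<and> b1 \<le> a2 \<and> a2 \<le> b2 \<longrightarrow>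
            (\<forall>x y. cinner (E1 {a1<..<b1} x) (E2 {a2<..<b2} y) = 0))
         \<and> (\<forall>x. inner x (E1 {0<..<1} x) \<le> inner x (E2 {0<..<1} x))"
proof -
  interpret two_half_sided H U1 E1 U2 E2
    using assms half_sided_standard_pair
    by (auto intro!: two_half_sided.intro two_half_sided_axioms.intro simp: nondegenerate_standard_pair_def)
  have "cinner (E1 {a1<..<b1} x) (E2 {a2<..<b2} y) = 0"
    if "0 < a1" "a1 \<le> b1" "b1 \<le> a2" "a2 \<le> b2" for a1 b1 a2 b2 x y
  proof -
    \<comment> \<open>A vector supported in the open interval is also supported in the half-open
      one, for which orthogonality has been shown.\<close>
    have "E2 {a2<..<b2} y = E2 {a2..<b2} (E2 {a2<..<b2} y)"
      by (rule p2.E_fixed_mono[of "{a2<..<b2}", symmetric]) (auto simp: p2.E_idem)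
    then have "cinner (E2 {a2<..<b2} y) (E1 {a1<..<b1} x) = 0"
      using spectral_orthogonal[of a1 b1 a2 b2 "E2 {a2<..<b2} y" x] that by simp
    then show ?thesis by (subst cinner_commute) simp
  qed
  moreover have "E2 {0} = (\<lambda>_. 0)"
    using assms(2,4) by (auto simp: nondegenerate_standard_pair_def)
  ultimately show ?thesis using spectral_projection_le by blast
qed

end
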